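(* Let $\alpha>0$, let $J_\alpha$ be the random Jacobi matrix and $A_\alpha$ the non-random Jacobi matrix described in the context, and let $\bar\mu_\alpha$ be the mean spectral measure of $J_\alpha$. (i) The mean spectral measure $\bar\mu_\alpha$ coincides with the spectral measure of the non-random Jacobi matrix $A_\alpha$ (that is, of $(A_\alpha,e_1)$). (ii) The measure $\bar\mu_\alpha$ has the following density function with respect to Lebesgue measure on $\mathbb{R}$: $$\bar\mu_\alpha(y)=\frac{e^{-y^2/2}}{\sqrt{2\pi}}\,\frac{1}{|\hat f_\alpha(y)|^2},\qquad y\in\mathbb{R},$$ where $$\hat f_\alpha(y)=\sqrt{\frac{2}{\pi}}\int_0^\infty f_\alpha(t)\,e^{iyt}\,dt,\qquad f_\alpha(t)=\pi\sqrt{\frac{\alpha}{\Gamma(\alpha)}}\;t^{\alpha-1}\,\frac{e^{-t^2/2}}{\sqrt{2\pi}}.$$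
   Context: A (semi-infinite) Jacobi matrix is a symmetric tridiagonal matrix $J=(J(i,j))_{i,j\ge 1}$ with $J(i,i)=a_i\in\mathbb{R}$, $J(i,i+1)=J(i+1,i)=b_i>0$, and all other entries $0$. There is always a probability measure $\mu$ on $\mathbb{R}$ with $\int_{\mathbb{R}} x^k\,d\mu(x)=\langle J^k e_1,e_1\rangle=J^k(1,1)$ for all $k=0,1,2,\dots$, where $e_1=(1,0,0,\dots)^T\in\ell^2$. When this $\mu$ is unique it is called the spectral measure of $J$ (or of $(J,e_1)$). Uniqueness holds whenever $\sum_{i\ge1}1/b_i=\infty$. For $k>0$, $\tilde\chi_k=\chi_k/\sqrt2$ denotes the distribution on $(0,\infty)$ with probability density $\frac{2}{\Gamma(k/2)}u^{k-1}e^{-u^2}$, $u>0$. For $\alpha>0$, $J_\alpha$ is the random Jacobi matrix whose diagonal entries $\{a_i\}_{i\ge1}$ are i.i.d. standard Gaussian $\mathcal{N}(0,1)$ and whose off-diagonal entries $\{b_j\}_{j\ge1}$ are i.i.d. with distribution $\tilde\chi_{2\alpha}$, with all the $a_i$ and $b_j$ independent. Almost surely $\sum_j 1/b_j=\infty$, so almost surely the (random) spectral measure $\mu_\alpha$ of $J_\alpha$ is well defined and unique. The mean spectral measure $\bar\mu_\alpha$ is the probability measure on $\mathbb{R}$ satisfying $\int f\,d\bar\mu_\alpha=\mathbb{E}\left[\int f\,d\mu_\alpha\right]$ for all bounded continuous functions $f$ on $\mathbb{R}$. $A_\alpha$ is the non-random Jacobi matrix with zero diagonal and off-diagonal entries $A_\alpha(j,j+1)=A_\alpha(j+1,j)=\sqrt{\alpha+j}$,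 $j=1,2,\dots$. Since $\sum_j 1/\sqrt{\alpha+j}=\infty$, its spectral measure is unique. *)

theory Defs
  imports "HOL-Probability.Probability"
begin

text \<open>
  Indices start at 0: \<open>a i\<close> and \<open>b i\<close> stand for the entries usually written
  \<open>a\<^sub>i\<^sub>+\<^sub>1\<close> and \<open>b\<^sub>i\<^sub>+\<^sub>1\<close>,
  and the entry (1,1) of a matrix is its entry (0,0) here.
\<close>

definition jacobi :: "(nat \<Rightarrow> real) \<Rightarrow> (nat \<Rightarrow> real) \<Rightarrow> nat \<Rightarrow> nat \<Rightarrow> real" where
  "jacobi a b i j =
     (if i = j then a i else if j = Suc i then b i else if i = Suc j then b j else 0)"

text \<open>
  In the product \<open>J * J^k\<close> only the indices \<open>l \<le> Suc i\<close> contribute to row \<open>i\<close>,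
  since \<open>J\<close> is tridiagonal.
\<close>

primrec jacobi_power ::
  "(nat \<Rightarrow> real) \<Rightarrow> (nat \<Rightarrow> real) \<Rightarrow> nat \<Rightarrow> nat \<Rightarrow> nat \<Rightarrow> real" where
  "jacobi_power a b 0 = (\<lambda>i j. if i = j then 1 else 0)"
| "jacobi_power a b (Suc k) = (\<lambda>i j. \<Sum>l\<le>Suc i. jacobi a b i l * jacobi_power a b k l j)"

definition jacobi_moment_measure ::
  "(nat \<Rightarrow> real) \<Rightarrow> (nat \<Rightarrow> real) \<Rightarrow> real measure \<Rightarrow> bool" where
  "jacobi_moment_measure a b \<mu> \<longleftrightarrow>
     prob_space \<mu> \<and> sets \<mu> = sets borel \<and>
     (\<forall>k. integrable \<mu> (\<lambda>x. x ^ k) \<and> (\<integral>x. x ^ k \<partial>\<mu>) = jacobi_power a b k 0 0)"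

definition is_spectral_measure ::
  "(nat \<Rightarrow> real) \<Rightarrow> (nat \<Rightarrow> real) \<Rightarrow> real measure \<Rightarrow> bool" where
  "is_spectral_measure a b \<mu> \<longleftrightarrow>
     jacobi_moment_measure a b \<mu> \<and> (\<forall>\<nu>. jacobi_moment_measure a b \<nu> \<longrightarrow> \<nu> = \<mu>)"

definition spectral_measure :: "(nat \<Rightarrow> real) \<Rightarrow> (nat \<Rightarrow> real) \<Rightarrow> real measure" where
  "spectral_measure a b = (THE \<mu>. is_spectral_measure a b \<mu>)"

text \<open>
  The random spectral measure is only defined almost surely, and its values on the
  exceptional null set are arbitrary. The outer expectation is therefore taken over the
  completion of \<open>M\<close>, where these values affect neither measurability nor the integral.
\<close>

definition is_mean_spectral_measure ::
  "'w measure \<Rightarrow> (nat \<Rightarrow> 'w \<Rightarrow> real) \<Rightarrow> (nat \<Rightarrow> 'w \<Rightarrow> real) \<Rightarrow> real measure \<Rightarrow> bool" where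
  "is_mean_spectral_measure M a b \<nu> \<longleftrightarrow>
     prob_space \<nu> \<and> sets \<nu> = sets borel \<and>
     (\<forall>f :: real \<Rightarrow> real. continuous_on UNIV f \<longrightarrow> bounded (range f) \<longrightarrow>
        integrable (completion M)
          (\<lambda>\<omega>. \<integral>x. f x \<partial>spectral_measure (\<lambda>i. a i \<omega>) (\<lambda>i. b i \<omega>)) \<and>
        (\<integral>x. f x \<partial>\<nu>) =
          (\<integral>\<omega>. (\<integral>x. f x \<partial>spectral_measure (\<lambda>i. a i \<omega>) (\<lambda>i. b i \<omega>)) \<partial>completion M))"

definition mean_spectral_measure ::
  "'w measure \<Rightarrow> (nat \<Rightarrow> 'w \<Rightarrow> real) \<Rightarrow> (nat \<Rightarrow> 'w \<Rightarrow> real) \<Rightarrow> real measure" where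
  "mean_spectral_measure M a b = (THE \<nu>. is_mean_spectral_measure M a b \<nu>)"

text \<open>Density of the rescaled chi distribution, that is, of a \<open>chi\<close> variable with
  parameter \<open>k\<close> divided by \<open>sqrt 2\<close>.\<close>

definition chi_tilde_density :: "real \<Rightarrow> real \<Rightarrow> real" where
  "chi_tilde_density k u =
     (if u > 0 then 2 / Gamma (k / 2) * u powr (k - 1) * exp (- u\<^sup>2) else 0)"

definition f_alpha :: "real \<Rightarrow> real \<Rightarrow> real" where
  "f_alpha \<alpha> t =
     pi * sqrt (\<alpha> / Gamma \<alpha>) * t powr (\<alpha> - 1) * (exp (- (t\<^sup>2 / 2)) / sqrt (2 * pi))"

definition f_hat :: "real \<Rightarrow> real \<Rightarrow> complex" where
  "f_hat \<alpha> y =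
     complex_of_real (sqrt (2 / pi)) *
     (LINT t:{0<..}|lborel.
        complex_of_real (f_alpha \<alpha> t) * exp (\<i> * complex_of_real y * complex_of_real t))"

end

theory Submission
  imports Defs
    "HOL-Computational_Algebra.Fundamental_Theorem_Algebra"
    "HOL-Real_Asymp.Real_Asymp"
begin

text \<open>
  The resolvent entry \<open>m(z) = \<integral> 1 / (z - x) d\<mu>(x)\<close> of a Jacobi matrix is the continued fraction
  \<open>1 / (z - a\<^sub>0 - b\<^sub>0\<^sup>2 / (z - a\<^sub>1 - b\<^sub>1\<^sup>2 / \<dots>))\<close>. Both parts of the theorem come from computing
  \<open>m\<close>, respectively its expectation, in the upper half-plane, and both answers are quotients of the
  parabolic cylinder functions \<open>G\<^sub>s(z) = \<integral>\<^sub>0\<^sup>\<infinity> t\<^sup>s\<^sup>-\<^sup>1 exp (i z t - t\<^sup>2 / 2) dt\<close>, called \<open>cyl s z\<close> below.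

  \<^emph>\<open>The deterministic matrix.\<close> Integration by parts gives \<open>G\<^sub>s\<^sub>+\<^sub>2 = s G\<^sub>s + i z G\<^sub>s\<^sub>+\<^sub>1\<close>. After
  normalization this is the three-term recurrence of \<open>A\<^sub>\<alpha>\<close>, and the resulting solution is square
  summable. Since \<open>\<Sum> 1 / b\<^sub>j\<close> diverges, the square summable solution is unique, which forces
  \<open>G\<^sub>\<alpha>\<^sub>+\<^sub>1 = i \<alpha> m G\<^sub>\<alpha>\<close> (\<open>cyl_stieltjes\<close>). On the real axis \<open>Re (G\<^sub>\<alpha>\<^sub>+\<^sub>1 cnj G\<^sub>\<alpha>)\<close> satisfies
  \<open>w' = - x w\<close>, hence equals \<open>\<Gamma>(\<alpha>) sqrt (\<pi> / 2) exp (- x\<^sup>2 / 2)\<close>, the constant being Legendre's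
  duplication formula (\<open>cyl_wronskian\<close>). Therefore \<open>G\<^sub>\<alpha>\<close> has no real zeros, \<open>m\<close> extends continuously to
  the real axis, and \<open>- Im m / \<pi>\<close> there is the density
  (\<open>hermite_moment_measure_density\<close>). It is the stated one because \<open>f_hat\<close> is a multiple of \<open>G\<^sub>\<alpha>\<close>.

  \<^emph>\<open>The random matrix.\<close> One step of the random continued fraction is the map
  \<open>w \<mapsto> z - a - b\<^sup>2 / w\<close> with \<open>a\<close> standard normal and \<open>b\<^sup>2\<close> Gamma distributed with parameter \<open>\<alpha>\<close>. In place
  of the stationary law of this map, the proof uses an explicit complex weight that is stationary for
  suitable bounded holomorphic test functions \<open>h\<close> on the upper half-plane, namely
  \<open>h \<mapsto> E [(- i (z - N)) powr (- \<alpha>) h (z - N)]\<close> with \<open>N\<close> standard normal. For \<open>h(w) = exp (i l w)\<close> both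
  sides of the invariance are explicit: averaging over \<open>a\<close> and \<open>b\<close> produces
  \<open>exp (i l z - l\<^sup>2 / 2) (1 + i l / w) powr (- \<alpha>)\<close>, and the last factor turns the weight at \<open>z\<close> into the
  weight at \<open>z + i l\<close> (\<open>step_invariant_exp\<close>). A Laplace transform in \<open>l\<close> extends the invariance to
  \<open>h(w) = 1 / (w + q)\<close>, and hence to finite continued fractions, which are Moebius maps of their
  terminal value (\<open>step_invariant_tail_resolvent\<close>). So the weighted expectation of the truncated
  continued fraction does not depend on the truncation level. At level 0 it is a multiple of
  \<open>G\<^sub>\<alpha>\<^sub>+\<^sub>1\<close>, and in the limit it is the same multiple of \<open>i \<alpha> G\<^sub>\<alpha> E m\<close>, since the truncations
  converge to \<open>m\<close> whatever their terminal values are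
  (\<open>tail_resolvent_tendsto\<close>). Thus \<open>E m\<close> is the resolvent entry of \<open>A\<^sub>\<alpha>\<close> (\<open>expectation_m_lim\<close>).

  \<^emph>\<open>From resolvents to measures.\<close> Integrals of bounded continuous functions are limits of
  integrals against the Poisson kernel, that is, against \<open>- Im m / \<pi>\<close> on horizontal lines. This recovers a
  measure from its Stieltjes transform, makes the integrals against the random spectral measure
  measurable, and turns the identity for \<open>E m\<close> into the one for the mean spectral measure.
  The general facts on Jacobi matrices are proved on the way: a measure with the given moments exists,
  by Gauss quadrature and Helly's selection theorem, and it is unique if \<open>\<Sum> 1 / b\<^sub>j\<close> diverges.
\<close>

section \<open>Orthogonal polynomials and Gauss quadrature\<close>

text \<open>The term \<open>b (n - 1) * u (n - 1)\<close> of the three-term recurrence, which is absent in row 0.\<close>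

definition prev_term :: "(nat \<Rightarrow> real) \<Rightarrow> (nat \<Rightarrow> 'a::real_algebra_1) \<Rightarrow> nat \<Rightarrow> 'a" where
  "prev_term b u n = (case n of 0 \<Rightarrow> 0 | Suc m \<Rightarrow> of_real (b m) * u m)"

lemma prev_term_simps [simp]:
  "prev_term b u 0 = 0" "prev_term b u (Suc m) = of_real (b m) * u m"
  by (simp_all add: prev_term_def)

fun orth_poly :: "(nat \<Rightarrow> real) \<Rightarrow> (nat \<Rightarrow> real) \<Rightarrow> nat \<Rightarrow> 'a::real_field poly" where
  "orth_poly a b 0 = 1"
| "orth_poly a b (Suc 0) = smult (of_real (1 / b 0)) [:- of_real (a 0), 1:]"
| "orth_poly a b (Suc (Suc n)) = smult (of_real (1 / b (Suc n)))
     ([:- of_real (a (Suc n)), 1:] * orth_poly a b (Suc n) - smult (of_real (b n)) (orth_poly a b n))"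

locale jacobi_coeffs =
  fixes a b :: "nat \<Rightarrow> real"
  assumes b_pos: "b n > 0"
begin

lemma b_nz [simp]: "b n \<noteq> 0"
  using b_pos[of n] by simp

abbreviation p :: "nat \<Rightarrow> 'a::real_field \<Rightarrow> 'a" where
  "p n \<equiv> poly (orth_poly a b n)"

lemma poly_orth_poly_Suc:
  "of_real (b n) * p (Suc n) x =
     (x - of_real (a n)) * p n x -
     prev_term b (\<lambda>k. p k (x :: 'a::real_field)) n"
  by (cases n) (auto simp: field_simps)

lemma poly_orth_poly_of_real:
  "p n (of_real x :: 'a::real_field) = of_real (p n x)"
  by (induction n rule: induct_nat_012) simp_all

lemma degree_orth_poly:
  "degree (orth_poly a b n :: 'a::real_field poly) = n"
proof (induction n rule: induct_nat_012)
  case (ge2 n)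
  have nz: "orth_poly a b (Suc n) \<noteq> (0 :: 'a poly)"
    using ge2(2) by auto
  have 1: "degree ([:- of_real (a (Suc n)), 1:] * orth_poly a b (Suc n) :: 'a poly) = Suc (Suc n)"
    by (subst degree_mult_eq) (use nz ge2(2) in auto)
  have 2: "degree (smult (of_real (b n)) (orth_poly a b n) :: 'a poly) < Suc (Suc n)"
    using ge2(1) by (auto intro: le_less_trans[OF degree_smult_le])
  have "degree ([:- of_real (a (Suc n)), 1:] * orth_poly a b (Suc n) -
      smult (of_real (b n)) (orth_poly a b n) :: 'a poly) = Suc (Suc n)"
    using degree_add_eq_left[of "- smult (of_real (b n)) (orth_poly a b n) :: 'a poly",
        unfolded degree_minus, of "[:- of_real (a (Suc n)), 1:] * orth_poly a b (Suc n)"] 1 2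
    by simp
  then show ?case
    by simp
qed auto

text \<open>
  Multiplying the sum by \<open>x - y\<close> and applying the recurrence in each variable makes it
  telescope.
\<close>

lemma christoffel_darboux:
  fixes x y :: "'a::real_field"
  shows "(x - y) * (\<Sum>k\<le>n. p k x * p k y) =
    of_real (b n) * (p (Suc n) x * p n y -
                     p n x * p (Suc n) y)"
proof (induction n)
  case 0
  have "of_real (b 0) * poly (orth_poly a b (Suc 0)) x = x - of_real (a 0)" for x :: 'a
    using poly_orth_poly_Suc[of 0 x] by simp
  note this[of x] this[of y]
  then show ?case by (simp del: orth_poly.simps(2) add: right_diff_distrib)
next
  case (Suc n)
  have r: "of_real (b (Suc n)) * p (Suc (Suc n)) x =
     (x - of_real (a (Suc n))) * p (Suc n) x - of_real (b n) * p n x" for x :: 'a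
    using poly_orth_poly_Suc[of "Suc n" x] by simp
  have "of_real (b (Suc n)) * (p (Suc (Suc n)) x * p (Suc n) y -
                     p (Suc n) x * p (Suc (Suc n)) y)
     = of_real (b (Suc n)) * p (Suc (Suc n)) x * p (Suc n) y -
       p (Suc n) x * (of_real (b (Suc n)) * p (Suc (Suc n)) y)"
    by (simp only: algebra_simps)
  also have "\<dots> = (x - y) * (p (Suc n) x * p (Suc n) y) +
      of_real (b n) * (p (Suc n) x * p n y -
                     p n x * p (Suc n) y)"
    unfolding r by (simp only: algebra_simps)
  finally show ?case
    using Suc.IH by (simp only: sum.atMost_Suc distrib_left add.commute)
qed

lemma orth_poly_kernel_pos:
  "(\<Sum>k\<le>n. (p k (x::real))\<^sup>2) \<ge> 1"
proof -
  have "(\<Sum>k\<in>{0}. (p k x)\<^sup>2) \<le> (\<Sum>k\<le>n. (p k x)\<^sup>2)"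
    by (rule sum_mono2) auto
  then show ?thesis by simp
qed

text \<open>
  At a root, the Christoffel-Darboux formula for \<open>z\<close> and its conjugate gives
  \<open>(z - cnj z) \<Sum>|p\<^sub>k(z)|\<^sup>2 = 0\<close>, and the term \<open>k = 0\<close> of the sum is 1.
\<close>

lemma orth_poly_root_real:
  assumes z: "p (Suc n) (z::complex) = 0"
  shows "z \<in> \<real>"
proof -
  have cnj: "p k (cnj z) = cnj (p k z)" for k
    by (induction k rule: induct_nat_012) simp_all
  have "(z - cnj z) * (\<Sum>k\<le>n. p k z * cnj (p k z)) = 0"
    using christoffel_darboux[where x = z and y = "cnj z" and n = n] z
    by (simp add: cnj del: orth_poly.simps)
  moreover have "(\<Sum>k\<le>n. p k z * cnj (p k z)) =
      of_real (\<Sum>k\<le>n. (cmod (p k z))\<^sup>2)"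
    by (simp only: complex_norm_square of_real_sum)
  moreover have "(\<Sum>k\<in>{0}. (cmod (p k z))\<^sup>2) \<le> (\<Sum>k\<le>n. (cmod (p k z))\<^sup>2)"
    by (rule sum_mono2) auto
  ultimately have "z - cnj z = 0"
    by (auto simp del: of_real_sum)
  then show ?thesis
    by (metis complex_is_Real_iff cnj.simps(2) eq_iff_diff_eq_0 equal_neg_zero)
qed

text \<open>
  Roots are simple: with \<open>y\<close> a fixed root, the Christoffel-Darboux formula is a polynomial
  identity in \<open>x\<close>. Its derivative at the root is \<open>\<Sum> p\<^sub>k\<^sup>2 \<ge> 1\<close>, so the derivative of the
  polynomial cannot vanish there.
\<close>

lemma rsquarefree_orth_poly:
  "rsquarefree (orth_poly a b (Suc n) :: complex poly)"
  unfolding rsquarefree_roots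
proof (intro allI notI, elim conjE)
  fix z :: complex assume z: "p (Suc n) z = 0" 
    and z': "poly (pderiv (orth_poly a b (Suc n))) z = 0"
  obtain x where x: "z = of_real x"
    using orth_poly_root_real[OF z] by (auto elim: Reals_cases)
  let ?P = "\<lambda>k. orth_poly a b k :: complex poly"
  let ?S = "\<Sum>k\<le>n. smult (poly (?P k) z) (?P k)"
  have "[:-z, 1:] * ?S = smult (of_real (b n) * poly (?P n) z) (?P (Suc n))"
  proof (rule poly_ext)
    fix w
    have "poly ?S w = (\<Sum>k\<le>n. poly (?P k) w * poly (?P k) z)"
      by (simp add: poly_sum mult.commute)
    then show "poly ([:-z, 1:] * ?S) w = poly (smult (of_real (b n) * poly (?P n) z) (?P (Suc n))) w"
      using christoffel_darboux[where x = w and y = z and n = n] z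
      by (simp add: algebra_simps del: orth_poly.simps)
  qed
  then have "poly (pderiv ([:-z, 1:] * ?S)) z = 0"
    using z' by (simp add: pderiv_smult del: orth_poly.simps)
  then have "poly ?S z = 0"
    unfolding pderiv_mult by (simp add: pderiv_pCons)
  moreover have "poly ?S z = of_real (\<Sum>k\<le>n. (p k x)\<^sup>2)"
    by (simp add: poly_sum x poly_orth_poly_of_real power2_eq_square)
  ultimately show False
    using orth_poly_kernel_pos[of x n] by (simp del: of_real_sum)
qed

lemma card_roots_orth_poly:
  "card {x::real. p (Suc n) x = 0} = Suc n"
proof -
  let ?p = "orth_poly a b (Suc n) :: complex poly"
  let ?Z = "{z. poly ?p z = 0}"
  have "?p \<noteq> 0" using degree_orth_poly[where n = "Suc n" and 'a = complex] by force
  have "degree ?p = degree (smult (lead_coeff ?p) (\<Prod>z\<in>?Z. [:-z, 1:]))"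
    by (subst complex_poly_decompose_rsquarefree[OF rsquarefree_orth_poly]) simp
  also have "\<dots> = degree (\<Prod>z\<in>?Z. [:-z, 1:])"
    using \<open>?p \<noteq> 0\<close> by (simp del: orth_poly.simps)
  also have "\<dots> = card ?Z"
    by (subst degree_prod_eq_sum_degree) auto
  finally have "card ?Z = Suc n"
    by (simp add: degree_orth_poly del: orth_poly.simps)
  moreover have "?Z = of_real ` {x::real. p (Suc n) x = 0}"
    using orth_poly_root_real[of n]
    by (force simp: poly_orth_poly_of_real elim!: Reals_cases simp del: orth_poly.simps)
  ultimately show ?thesis
    by (simp add: card_image inj_on_def)
qed

lemma orth_poly_independent:
  fixes c :: "nat \<Rightarrow> real"
  assumes "(\<Sum>k\<le>n. smult (c k) (orth_poly a b k)) = 0" "k \<le> n"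
  shows "c k = 0"
  using assms
proof (induction n)
  case 0
  then show ?case by simp
next
  case (Suc n)
  have "degree (\<Sum>k\<le>n. smult (c k) (orth_poly a b k)) \<le> n"
    by (rule degree_sum_le) (auto intro: order.trans[OF degree_smult_le] simp: degree_orth_poly)
  then have "coeff (\<Sum>k\<le>n. smult (c k) (orth_poly a b k)) (Suc n) = 0"
    by (intro coeff_eq_0) auto
  then have "c (Suc n) * coeff (orth_poly a b (Suc n)) (Suc n) = 0"
    using arg_cong[OF Suc.prems(1), of "\<lambda>p. coeff p (Suc n)"] 
    by (simp del: orth_poly.simps)
  moreover have "coeff (orth_poly a b (Suc n)) (Suc n) \<noteq> (0::real)"
    using leading_coeff_0_iff[of "orth_poly a b (Suc n) :: real poly"]
      degree_orth_poly[where n = "Suc n" and 'a = real] by (metis degree_0 nat.distinct(1))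
  ultimately have c: "c (Suc n) = 0" by simp
  then show ?case
    using Suc by (cases "k = Suc n") auto
qed

text \<open>
  The nodes are the roots of the next polynomial and the weights the reciprocals of the
  kernel \<open>K(x,x)\<close>. By Christoffel-Darboux \<open>K(x,y)\<close> vanishes at distinct nodes, so
  \<open>\<Sum> w(x) K(x,\<cdot>)\<close> has the value 1 at all \<open>n + 1\<close> nodes. Its degree is at most \<open>n\<close>, so it is
  the constant 1, and comparing its coefficients in the basis \<open>p\<^sub>k\<close> gives the claim.
\<close>

lemma gauss_quadrature:
  "\<exists>(R :: real set) w. finite R \<and> (\<forall>x\<in>R. w x > 0) \<and>
     (\<forall>k\<le>n. (\<Sum>x\<in>R. w x * p k x) = (if k = 0 then 1 else 0))"
proof -
  define R where "R = {x::real. p (Suc n) x = 0}"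
  define K where "K x = (\<Sum>k\<le>n. smult (p k x) (orth_poly a b k))" for x :: real
  define w where "w x = 1 / poly (K x) x" for x
  have card: "card R = Suc n"
    unfolding R_def by (rule card_roots_orth_poly)
  then have fin: "finite R" by (simp add: card_ge_0_finite)
  have Kpos: "poly (K x) x > 0" for x
    using orth_poly_kernel_pos[of x n] by (simp add: K_def poly_sum power2_eq_square)
  have K0: "poly (K x) y = 0" if "x \<in> R" "y \<in> R" "x \<noteq> y" for x y
    using that christoffel_darboux[where x = x and y = y and n = n]
    by (simp add: R_def K_def poly_sum del: orth_poly.simps)
  define q where "q = (\<Sum>x\<in>R. smult (w x) (K x))"
  have degK: "degree (K x) \<le> n" for x
    unfolding K_def
    by (rule degree_sum_le) (auto intro: order.trans[OF degree_smult_le] simp: degree_orth_poly)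
  have "q - 1 = 0"
  proof (rule ccontr)
    assume "q - 1 \<noteq> 0"
    then have "card {x. poly (q - 1) x = 0} \<le> degree (q - 1)"
      by (rule card_poly_roots_bound)
    also have "degree q \<le> n"
      unfolding q_def
      by (rule degree_sum_le[OF fin]) (auto intro: order.trans[OF degree_smult_le] degK)
    then have "degree (q - 1) \<le> n"
      by (intro degree_diff_le) auto
    finally have "card {x. poly (q - 1) x = 0} \<le> n" .
    moreover have "R \<subseteq> {x. poly (q - 1) x = 0}"
    proof
      fix y assume y: "y \<in> R"
      have "poly q y = (\<Sum>x\<in>R. w x * poly (K x) y)"
        by (simp add: q_def poly_sum)
      also have "\<dots> = (\<Sum>x\<in>R. if x = y then 1 else 0)"
        by (rule sum.cong) (use K0 y Kpos[of y] in \<open>auto simp: w_def\<close>)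
      also have "\<dots> = 1" using y fin by simp
      finally show "y \<in> {x. poly (q - 1) x = 0}" by simp
    qed
    then have "card R \<le> card {x. poly (q - 1) x = 0}"
      using \<open>q - 1 \<noteq> 0\<close> by (intro card_mono poly_roots_finite)
    ultimately show False using card by simp
  qed
  define c where "c k = (\<Sum>x\<in>R. w x * p k x) - (if k = 0 then 1 else 0)" for k
  have "(\<Sum>k\<le>n. smult (c k) (orth_poly a b k)) = q - 1"
  proof (rule poly_ext)
    fix y
    have "poly q y = (\<Sum>x\<in>R. \<Sum>k\<le>n. w x * (p k x * p k y))"
      by (simp add: q_def poly_sum K_def sum_distrib_left)
    also have "\<dots> = (\<Sum>k\<le>n. (\<Sum>x\<in>R. w x * p k x) * p k y)"
      by (subst sum.swap) (simp add: sum_distrib_right mult.assoc)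
    finally have "poly q y = \<dots>" .
    moreover have "(\<Sum>k\<le>n. (if k = 0 then 1 else 0) * p k y) = 1"
      by (simp add: if_distrib[of "\<lambda>u. u * _"] cong: if_cong)
    ultimately show "poly (\<Sum>k\<le>n. smult (c k) (orth_poly a b k)) y = poly (q - 1) y"
      by (simp add: poly_sum c_def left_diff_distrib sum_subtractf)
  qed
  then have "c k = 0" if "k \<le> n" for k
    using orth_poly_independent[OF _ that] \<open>q - 1 = 0\<close> by simp
  then show ?thesis
    using Kpos fin by (intro exI[of _ R] exI[of _ w]) (auto simp: w_def c_def)
qed

end

section \<open>Existence of a measure with the moments of a Jacobi matrix\<close>

text \<open>If \<open>f\<close> is not integrable its integral is 0, and the right-hand side is nonnegative.\<close>

lemma integral_norm_le_AE:
  fixes f :: "'a \<Rightarrow> 'b::{banach, second_countable_topology}" and g :: "'a \<Rightarrow> real"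
  assumes g: "integrable M g" and le: "AE x in M. norm (f x) \<le> g x"
  shows "norm (\<integral>x. f x \<partial>M) \<le> (\<integral>x. g x \<partial>M)"
proof (cases "integrable M f")
  case True
  have "norm (\<integral>x. f x \<partial>M) \<le> (\<integral>x. norm (f x) \<partial>M)"
    by (rule integral_norm_bound)
  also have "\<dots> \<le> (\<integral>x. g x \<partial>M)"
    using True g le by (intro integral_mono_AE) auto
  finally show ?thesis .
next
  case False
  have "AE x in M. 0 \<le> g x"
    using le by eventually_elim (meson norm_ge_zero order.trans)
  then show ?thesis
    using False by (simp add: not_integrable_integral_eq integral_nonneg_AE)
qed

text \<open>Row \<open>i\<close> of the product has only the three entries next to the diagonal.\<close>

lemma jacobi_power_Suc_eq:
  "jacobi_power a b (Suc k) i j =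
     b i * jacobi_power a b k (Suc i) j + a i * jacobi_power a b k i j +
     prev_term b (\<lambda>l. jacobi_power a b k l j) i"
proof (cases i)
  case 0
  then show ?thesis by (simp add: jacobi_def algebra_simps)
next
  case (Suc m)
  have "(\<Sum>l<m. jacobi a b (Suc m) l * jacobi_power a b k l j) = 0"
    by (rule sum.neutral) (auto simp: jacobi_def)
  moreover have sum_split: "(\<Sum>l\<le>m. f l) = (\<Sum>l<m. f l) + f m" for f :: "nat \<Rightarrow> real"
    by (metis lessThan_Suc_atMost sum.lessThan_Suc)
  ultimately have "(\<Sum>l\<le>Suc (Suc m). jacobi a b (Suc m) l * jacobi_power a b k l j) =
     jacobi a b (Suc m) m * jacobi_power a b k m j
     + jacobi a b (Suc m) (Suc m) * jacobi_power a b k (Suc m) j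
     + jacobi a b (Suc m) (Suc (Suc m)) * jacobi_power a b k (Suc (Suc m)) j"
    unfolding sum.atMost_Suc sum_split by simp
  then show ?thesis using Suc by (simp add: jacobi_def algebra_simps)
qed

declare orth_poly.simps(2,3) [simp del]

context jacobi_coeffs
begin

text \<open>
  Integrating \<open>x\<^sup>k p\<^sub>j\<close> and taking the \<open>(j,0)\<close> entry of the \<open>k\<close>-th power obey the same
  recurrence in \<open>k\<close>.
\<close>

lemma moments_from_orthogonality:
  fixes R :: "real set" and w :: "real \<Rightarrow> real"
  assumes "\<And>k. k \<le> n \<Longrightarrow> (\<Sum>x\<in>R. w x * p k x) = (if k = 0 then 1 else 0)"
    and "j + k \<le> n"
  shows "(\<Sum>x\<in>R. w x * (x ^ k * p j x)) = jacobi_power a b k j 0"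
  using assms(2)
proof (induction k arbitrary: j)
  case 0
  then show ?case using assms(1)[of j] by simp
next
  case (Suc k)
  let ?S = "\<lambda>j. \<Sum>x\<in>R. w x * (x ^ k * p j x)"
  have x: "x * p j x = b j * p (Suc j) x + a j * p j x + prev_term b (\<lambda>k. p k x) j" for x :: real
    using poly_orth_poly_Suc[of j x] by (simp add: algebra_simps)
  have pr: "(\<Sum>x\<in>R. w x * (x ^ k * prev_term b (\<lambda>k. p k x) j)) = prev_term b ?S j"
    by (cases j) (simp_all add: sum_distrib_left mult_ac)
  have "(\<Sum>x\<in>R. w x * (x ^ Suc k * p j x)) =
      (\<Sum>x\<in>R. b j * (w x * (x ^ k * p (Suc j) x)) + a j * (w x * (x ^ k * p j x)) +
         w x * (x ^ k * prev_term b (\<lambda>k. p k x) j))"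
  proof (rule sum.cong[OF refl])
    fix y
    have "w y * (y ^ Suc k * p j y) = w y * (y ^ k * (y * p j y))" by simp
    then show "w y * (y ^ Suc k * p j y) = b j * (w y * (y ^ k * p (Suc j) y)) + a j * (w y * (y ^ k * p j y)) +
         w y * (y ^ k * prev_term b (\<lambda>k. p k y) j)"
      unfolding x by (simp add: algebra_simps)
  qed
  also have "\<dots> = b j * ?S (Suc j) + a j * ?S j + prev_term b ?S j"
    by (simp only: sum.distrib sum_distrib_left[symmetric] pr)
  also have "\<dots> = b j * jacobi_power a b k (Suc j) 0 + a j * jacobi_power a b k j 0
       + prev_term b (\<lambda>l. jacobi_power a b k l 0) j"
    using Suc.prems Suc.IH[of "Suc j"] Suc.IH[of j] Suc.IH[of "j - 1"] by (cases j) simp_all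
  also have "\<dots> = jacobi_power a b (Suc k) j 0"
    by (simp only: jacobi_power_Suc_eq)
  finally show ?case .
qed

lemma finite_moment_measure:
  "\<exists>\<mu>. real_distribution \<mu> \<and> (\<forall>k. integrable \<mu> (\<lambda>x. x ^ k)) \<and>
     (\<forall>k\<le>n. (\<integral>x. x ^ k \<partial>\<mu>) = jacobi_power a b k 0 0)"
proof -
  from gauss_quadrature[of n] obtain R :: "real set" and w :: "real \<Rightarrow> real" where ex: "finite R" "\<forall>x\<in>R. w x > 0"
    "\<forall>k\<le>n. (\<Sum>x\<in>R. w x * p k x) = (if k = 0 then 1 else 0)"
    by blast
  then have R: "finite R" "\<And>x. x \<in> R \<Longrightarrow> w x > 0"
    and orth: "\<And>k. k \<le> n \<Longrightarrow> (\<Sum>x\<in>R. w x * p k x) = (if k = 0 then 1 else 0)"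
    by simp_all
  define \<nu> where "\<nu> = point_measure R (\<lambda>x. ennreal (w x))"
  define \<mu> where "\<mu> = distr \<nu> borel (\<lambda>x. x)"
  have meas: "f \<in> borel_measurable \<nu>" for f :: "real \<Rightarrow> real"
    by (simp add: \<nu>_def)
  have "(\<Sum>x\<in>R. w x) = 1"
    using orth[of 0] by simp
  then have "(\<Sum>x\<in>R. ennreal (w x)) = 1"
    using R(2) by (simp add: sum_ennreal less_imp_le)
  then have "emeasure \<nu> (space \<nu>) = 1"
    using R by (simp add: \<nu>_def space_point_measure emeasure_point_measure_finite)
  then interpret \<nu>: prob_space \<nu> by (rule prob_spaceI)
  have \<mu>: "real_distribution \<mu>"
    unfolding \<mu>_def by (intro \<nu>.real_distribution_distr meas)
  have int: "integrable \<mu> (\<lambda>x. x ^ k)" and mom: "(\<integral>x. x ^ k \<partial>\<mu>) = (\<Sum>x\<in>R. w x * x ^ k)" for k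
  proof -
    have "integrable \<nu> (\<lambda>x. x ^ k)"
      unfolding \<nu>_def using R by (intro integrable_point_measure_finite) auto
    then show "integrable \<mu> (\<lambda>x. x ^ k)"
      unfolding \<mu>_def by (subst integrable_distr_eq) (auto intro: meas)
    have "(\<integral>x. x ^ k \<partial>\<mu>) = (\<integral>x. x ^ k \<partial>\<nu>)"
      unfolding \<mu>_def by (subst integral_distr) (auto intro: meas)
    also have "\<dots> = (\<Sum>x\<in>R. w x * x ^ k)"
      unfolding \<nu>_def using R lebesgue_integral_point_measure_finite[of R w "\<lambda>x. x ^ k"]
      by (simp add: less_imp_le)
    finally show "(\<integral>x. x ^ k \<partial>\<mu>) = (\<Sum>x\<in>R. w x * x ^ k)" .
  qed
  have "(\<integral>x. x ^ k \<partial>\<mu>) = jacobi_power a b k 0 0" if "k \<le> n" for k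
  proof -
    have "(\<Sum>x\<in>R. w x * (x ^ k * p 0 x)) = jacobi_power a b k 0 0"
      by (rule moments_from_orthogonality[where n = n]) (use orth that in auto)
    then show ?thesis using mom by simp
  qed
  with \<mu> int show ?thesis by blast
qed

end

text \<open>
  Bounds the error of replacing a power by a bounded continuous function by a multiple of a
  higher even moment that tends to 0 as \<open>R\<close> grows.
\<close>

lemma truncated_power_bound:
  fixes x R :: real and k :: nat
  assumes "R > 0"
  shows "\<bar>x ^ k - (max (- R) (min R x)) ^ k\<bar> \<le> x ^ (2 * k) / R ^ k"
proof (cases "\<bar>x\<bar> \<le> R")
  case True
  then have "max (- R) (min R x) = x" by auto
  then show ?thesis using assms by (simp add: power_mult)
next
  case False
  define y where "y = max (- R) (min R x)"
  have y: "\<bar>y\<bar> = R \<and> x * y \<ge> 0"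
  proof (cases "x > R")
    case True
    then have "y = R" using assms by (simp add: y_def)
    then show ?thesis using True assms by simp
  next
    case xR: False
    then have "x < - R" using False by linarith
    then have "y = - R" using assms by (simp add: y_def)
    then show ?thesis using \<open>x < - R\<close> assms by (simp add: mult_nonpos_nonneg)
  qed
  have "0 \<le> x ^ k * y ^ k" using y by (simp flip: power_mult_distrib)
  then have "(0 \<le> x ^ k \<and> 0 \<le> y ^ k) \<or> (x ^ k \<le> 0 \<and> y ^ k \<le> 0)"
    unfolding zero_le_mult_iff .
  then have "\<bar>x ^ k - y ^ k\<bar> \<le> max \<bar>x ^ k\<bar> \<bar>y ^ k\<bar>"
    by linarith
  also have "\<dots> \<le> \<bar>x\<bar> ^ k"
    using False assms y power_mono[of R "\<bar>x\<bar>" k] by (simp add: power_abs)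
  also have "\<dots> \<le> \<bar>x\<bar> ^ k * (\<bar>x\<bar> ^ k / R ^ k)"
  proof -
    have "1 \<le> \<bar>x\<bar> ^ k / R ^ k" using False assms by (simp add: power_mono)
    from mult_left_mono[OF this, of "\<bar>x\<bar> ^ k"] show ?thesis by simp
  qed
  also have "\<dots> = x ^ (2 * k) / R ^ k"
  proof -
    have "x ^ (2 * k) = (\<bar>x\<bar> * \<bar>x\<bar>) ^ k" by (simp add: power_mult power2_eq_square)
    then show ?thesis by (simp only: power_mult_distrib times_divide_eq_right)
  qed
  finally show ?thesis by (simp add: y_def)
qed

text \<open>Chebyshev's inequality, in the form needed for tightness.\<close>

lemma real_distribution_second_moment:
  assumes "real_distribution M" "integrable M (\<lambda>x. x\<^sup>2)" "(\<integral>x. x\<^sup>2 \<partial>M) \<le> c" "R > 0"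
  shows "measure M {-R<..R} \<ge> 1 - c / R\<^sup>2"
proof -
  interpret real_distribution M by fact
  have "prob {x \<in> space M. x\<^sup>2 \<ge> R\<^sup>2} \<le> (\<integral>x. x\<^sup>2 \<partial>M) / R\<^sup>2"
    by (rule integral_Markov_inequality_measure[where A = "space M"]) (use assms in auto)
  also have "\<dots> \<le> c / R\<^sup>2"
    using assms by (intro divide_right_mono) auto
  finally have "prob {x \<in> space M. x\<^sup>2 \<ge> R\<^sup>2} \<le> c / R\<^sup>2" .
  moreover have "prob (space M - {-R<..R}) \<le> prob {x \<in> space M. x\<^sup>2 \<ge> R\<^sup>2}"
    using assms(4) by (intro finite_measure_mono) (auto simp flip: abs_le_square_iff)
  moreover have "prob (space M - {-R<..R}) = 1 - prob {-R<..R}"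
    by (rule prob_compl) auto
  ultimately show ?thesis by simp
qed

text \<open>
  The second moments make the sequence tight, so a subsequence converges weakly by Helly's
  theorem. Weak convergence only controls bounded functions; the moments of the limit follow
  since the truncated powers are close to the true ones uniformly in \<open>n\<close>, by the bound on
  the next even moments.
\<close>

lemma moment_limit_exists:
  fixes \<mu> :: "nat \<Rightarrow> real measure" and c :: "nat \<Rightarrow> real"
  assumes \<mu>: "\<And>n. real_distribution (\<mu> n)" "\<And>n k. integrable (\<mu> n) (\<lambda>x. x ^ k)"
    and mom: "\<And>n k. k \<le> n + 2 \<Longrightarrow> (\<integral>x. x ^ k \<partial>\<mu> n) = c k"
  shows "\<exists>\<nu>. real_distribution \<nu> \<and> (\<forall>k. integrable \<nu> (\<lambda>x. x ^ k)) \<and> (\<forall>k. (\<integral>x. x ^ k \<partial>\<nu>) = c k)"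
proof -
  interpret \<mu>: real_distribution "\<mu> n" for n by (rule \<mu>)
  have "tight \<mu>"
    unfolding tight_def
  proof (intro conjI allI impI \<mu>)
    fix \<epsilon> :: real assume e: "\<epsilon> > 0"
    define R where "R = sqrt ((\<bar>c 2\<bar> + 1) / \<epsilon>)"
    have R: "R > 0" "R\<^sup>2 = (\<bar>c 2\<bar> + 1) / \<epsilon>" using e by (simp_all add: R_def)
    have "c 2 / R\<^sup>2 < \<epsilon>"
    proof -
      have "\<epsilon> * c 2 < \<epsilon> * (\<bar>c 2\<bar> + 1)" using e by (intro mult_strict_left_mono) auto
      then show ?thesis unfolding R(2) by (simp add: field_simps)
    qed
    moreover have "measure (\<mu> n) {-R<..R} \<ge> 1 - c 2 / R\<^sup>2" for n
      using mom[of 2 n] by (intro real_distribution_second_moment \<mu> R) auto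
    ultimately have "measure (\<mu> n) {-R<..R} > 1 - \<epsilon>" for n
      by (smt (verit))
    then show "\<exists>a b. a < b \<and> (\<forall>n. 1 - \<epsilon> < measure (\<mu> n) {a<..b})"
      using R(1) by (intro exI[of _ "-R"] exI[of _ R]) auto
  qed
  from tight_imp_convergent_subsubsequence[OF this strict_mono_id]
  obtain r \<nu> where r: "strict_mono r" and \<nu>: "real_distribution \<nu>" and "weak_conv_m (\<mu> \<circ> id \<circ> r) \<nu>"
    by auto
  then have weak: "weak_conv_m (\<lambda>n. \<mu> (r n)) \<nu>" by (simp add: comp_def)
  interpret \<nu>: real_distribution \<nu> by fact
  define g where "g R x = max (- R) (min R x)" for R x :: real
  have g_bound: "\<bar>g R x\<bar> \<le> R" if "R > 0" for R x using that by (auto simp: g_def)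
  have g_cont: "isCont (\<lambda>x. g R x ^ k) x" for R x k unfolding g_def by (intro continuous_intros)
  have [measurable]: "g R \<in> borel_measurable borel" for R unfolding g_def by measurable
  have gk_bound: "\<bar>g R x ^ k\<bar> \<le> R ^ k" if "R > 0" for R x k
    using g_bound[OF that, of x] by (simp add: power_abs power_mono)
  have g_int: "integrable \<nu> (\<lambda>x. g R x ^ k)" if "R > 0" for R k
    by (rule \<nu>.integrable_const_bound[where B = "R ^ k"]) (use gk_bound[OF that] in auto)
  have g_int': "integrable (\<mu> n) (\<lambda>x. g R x ^ k)" if "R > 0" for R k n
    by (rule \<mu>.integrable_const_bound[where B = "R ^ k"]) (use gk_bound[OF that] in auto)
  have lim: "(\<lambda>n. \<integral>x. g R x ^ k \<partial>\<mu> (r n)) \<longlonglongrightarrow> (\<integral>x. g R x ^ k \<partial>\<nu>)" if "R > 0" for R k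
    by (rule weak_conv_imp_integral_bdd_continuous_conv[where B = "R ^ k"])
      (use weak \<mu> \<nu> g_cont gk_bound[OF that] in auto)
  have mu_close: "\<bar>c k - (\<integral>x. g R x ^ k \<partial>\<mu> n)\<bar> \<le> c (2 * k) / R ^ k" if "R > 0" "n \<ge> 2 * k" for R k n
  proof -
    have "c k - (\<integral>x. g R x ^ k \<partial>\<mu> n) = (\<integral>x. x ^ k - g R x ^ k \<partial>\<mu> n)"
      using mom[of k n] that \<mu>(2) g_int' by (subst Bochner_Integration.integral_diff) auto
    also have "\<bar>\<dots>\<bar> \<le> (\<integral>x. x ^ (2 * k) / R ^ k \<partial>\<mu> n)"
    proof -
      have "norm (\<integral>x. x ^ k - g R x ^ k \<partial>\<mu> n) \<le> (\<integral>x. x ^ (2 * k) / R ^ k \<partial>\<mu> n)"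
        using \<mu>(2) truncated_power_bound[OF that(1)]
        by (intro integral_norm_le_AE) (auto simp: g_def)
      then show ?thesis by simp
    qed
    also have "\<dots> = c (2 * k) / R ^ k"
      using mom[of "2 * k" n] that by simp
    finally show ?thesis .
  qed
  have nu_close: "\<bar>c k - (\<integral>x. g R x ^ k \<partial>\<nu>)\<bar> \<le> c (2 * k) / R ^ k" if "R > 0" for R k
  proof (rule LIMSEQ_le_const2)
    show "(\<lambda>n. \<bar>c k - (\<integral>x. g R x ^ k \<partial>\<mu> (r n))\<bar>) \<longlonglongrightarrow> \<bar>c k - (\<integral>x. g R x ^ k \<partial>\<nu>)\<bar>"
      by (intro tendsto_intros lim that)
    have "r n \<ge> 2 * k" if "n \<ge> 2 * k" for n
      using seq_suble[OF r, of n] that by simp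
    then show "\<exists>N. \<forall>n\<ge>N. \<bar>c k - (\<integral>x. g R x ^ k \<partial>\<mu> (r n))\<bar> \<le> c (2 * k) / R ^ k"
      using mu_close[OF that] by blast
  qed
  have g_lim: "(\<lambda>i. g (real (Suc i)) x ^ k) \<longlonglongrightarrow> x ^ k" for x k
  proof (rule tendsto_eventually)
    obtain N where "\<bar>x\<bar> \<le> real N" using real_arch_simple by blast
    then have "g (real (Suc i)) x = x" if "i \<ge> N" for i using that by (auto simp: g_def)
    then show "\<forall>\<^sub>F i in sequentially. g (real (Suc i)) x ^ k = x ^ k"
      unfolding eventually_sequentially by (intro exI[of _ N] allI impI) (simp only:)
  qed
  have even_int: "integrable \<nu> (\<lambda>x. x ^ (2 * k))" for k
  proof (rule integrableI_nonneg)
    have "(\<integral>\<^sup>+x. ennreal (x ^ (2 * k)) \<partial>\<nu>) = (\<integral>\<^sup>+x. liminf (\<lambda>i. ennreal (g (real (Suc i)) x ^ (2 * k))) \<partial>\<nu>)"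
      by (intro nn_integral_cong lim_imp_Liminf[symmetric] tendsto_ennrealI g_lim) simp_all
    also have "\<dots> \<le> liminf (\<lambda>i. \<integral>\<^sup>+x. ennreal (g (real (Suc i)) x ^ (2 * k)) \<partial>\<nu>)"
      by (intro nn_integral_liminf) measurable
    also have "\<dots> \<le> ennreal (c (2 * k) + \<bar>c (2 * (2 * k))\<bar>)"
    proof (rule Liminf_le)
      show "\<forall>\<^sub>F i in sequentially. (\<integral>\<^sup>+x. ennreal (g (real (Suc i)) x ^ (2 * k)) \<partial>\<nu>)
          \<le> ennreal (c (2 * k) + \<bar>c (2 * (2 * k))\<bar>)"
      proof (intro always_eventually allI)
        fix i
        have "(\<integral>x. g (real (Suc i)) x ^ (2 * k) \<partial>\<nu>) \<le> c (2 * k) + c (2 * (2 * k)) / real (Suc i) ^ (2 * k)"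
          using nu_close[of "real (Suc i)" "2 * k"] by (auto simp: abs_le_iff)
        also have "c (2 * (2 * k)) / real (Suc i) ^ (2 * k) \<le> \<bar>c (2 * (2 * k))\<bar> / 1"
          by (rule frac_le) (simp_all add: one_le_power)
        finally have le: "(\<integral>x. g (real (Suc i)) x ^ (2 * k) \<partial>\<nu>) \<le> c (2 * k) + \<bar>c (2 * (2 * k))\<bar>"
          by simp
        have "(\<integral>\<^sup>+x. ennreal (g (real (Suc i)) x ^ (2 * k)) \<partial>\<nu>) =
            ennreal (\<integral>x. g (real (Suc i)) x ^ (2 * k) \<partial>\<nu>)"
          by (rule nn_integral_eq_integral[OF g_int]) simp_all
        also have "\<dots> \<le> ennreal (c (2 * k) + \<bar>c (2 * (2 * k))\<bar>)"
          by (rule ennreal_leI[OF le])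
        finally show "(\<integral>\<^sup>+x. ennreal (g (real (Suc i)) x ^ (2 * k)) \<partial>\<nu>)
          \<le> ennreal (c (2 * k) + \<bar>c (2 * (2 * k))\<bar>)" .
      qed
    qed simp
    also have "\<dots> < \<infinity>" by simp
    finally show "(\<integral>\<^sup>+x. ennreal (x ^ (2 * k)) \<partial>\<nu>) < \<infinity>" .
  qed auto
  have int: "integrable \<nu> (\<lambda>x. x ^ k)" for k
  proof (rule Bochner_Integration.integrable_bound)
    show "integrable \<nu> (\<lambda>x. 1 + x ^ (2 * k))" using even_int by auto
    have "\<bar>x ^ k\<bar> \<le> 1 + x ^ (2 * k)" for x :: real
    proof -
      have "0 \<le> (\<bar>x ^ k\<bar> - 1)\<^sup>2" by simp
      moreover have "0 \<le> \<bar>x ^ k\<bar>" by simp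
      moreover have "x ^ (2 * k) = \<bar>x ^ k\<bar>\<^sup>2" by (simp only: power2_abs power_even_eq)
      ultimately show ?thesis by (simp add: power2_diff)
    qed
    then show "AE x in \<nu>. norm (x ^ k) \<le> norm (1 + x ^ (2 * k))"
      by (intro AE_I2) (metis abs_ge_self order.trans real_norm_def)
  qed auto
  have "(\<integral>x. x ^ k \<partial>\<nu>) = c k" for k
  proof (cases "k = 0")
    case True
    then show ?thesis using mom[of 0 0] \<nu>.prob_space \<mu>.prob_space by simp
  next
    case False
    have "(\<lambda>i. \<integral>x. g (real (Suc i)) x ^ k \<partial>\<nu>) \<longlonglongrightarrow> (\<integral>x. x ^ k \<partial>\<nu>)"
    proof (rule integral_dominated_convergence[where w = "\<lambda>x. \<bar>x ^ k\<bar>"])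
      show "AE x in \<nu>. norm (g (real (Suc i)) x ^ k) \<le> \<bar>x ^ k\<bar>" for i
        by (auto simp: g_def power_abs intro!: AE_I2 power_mono)
    qed (use int g_lim in auto)
    moreover have "(\<lambda>i. \<integral>x. g (real (Suc i)) x ^ k \<partial>\<nu>) \<longlonglongrightarrow> c k"
    proof -
      have "(\<lambda>i. c k - (\<integral>x. g (real (Suc i)) x ^ k \<partial>\<nu>)) \<longlonglongrightarrow> 0"
      proof (rule Lim_null_comparison)
        show "\<forall>\<^sub>F i in sequentially. norm (c k - (\<integral>x. g (real (Suc i)) x ^ k \<partial>\<nu>)) \<le> \<bar>c (2 * k)\<bar> / real (Suc i)"
        proof (intro always_eventually allI)
          fix i
          have "norm (c k - (\<integral>x. g (real (Suc i)) x ^ k \<partial>\<nu>)) \<le> c (2 * k) / real (Suc i) ^ k"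
            using nu_close[of "real (Suc i)" k] by simp
          also have "\<dots> \<le> \<bar>c (2 * k)\<bar> / real (Suc i)"
            using False by (intro frac_le self_le_power) auto
          finally show "norm (c k - (\<integral>x. g (real (Suc i)) x ^ k \<partial>\<nu>)) \<le> \<bar>c (2 * k)\<bar> / real (Suc i)" .
        qed
        show "(\<lambda>i. \<bar>c (2 * k)\<bar> / real (Suc i)) \<longlonglongrightarrow> 0"
          by (rule LIMSEQ_Suc[OF lim_const_over_n])
      qed
      from tendsto_diff[OF tendsto_const[of "c k"] this] show ?thesis by simp
    qed
    ultimately show ?thesis by (rule LIMSEQ_unique)
  qed
  with \<nu> int show ?thesis by blast
qed

context jacobi_coeffs
begin

theorem jacobi_moment_measure_exists: "\<exists>\<mu>. jacobi_moment_measure a b \<mu>"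
proof -
  have "\<exists>\<mu>. real_distribution \<mu> \<and> (\<forall>k. integrable \<mu> (\<lambda>x. x ^ k)) \<and>
      (\<forall>k\<le>n + 2. (\<integral>x. x ^ k \<partial>\<mu>) = jacobi_power a b k 0 0)" for n
    by (rule finite_moment_measure)
  then have "\<exists>\<mu>. \<forall>n. real_distribution (\<mu> n) \<and> (\<forall>k. integrable (\<mu> n) (\<lambda>x. x ^ k)) \<and>
      (\<forall>k\<le>n + 2. (\<integral>x. x ^ k \<partial>\<mu> n) = jacobi_power a b k 0 0)"
    by (intro choice allI)
  then obtain \<mu> where \<mu>: "\<And>n. real_distribution (\<mu> n)" "\<And>n k. integrable (\<mu> n) (\<lambda>x. x ^ k)"
    "\<And>n k. k \<le> n + 2 \<Longrightarrow> (\<integral>x. x ^ k \<partial>\<mu> n) = jacobi_power a b k 0 0"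
    by blast
  obtain \<nu> where
    "real_distribution \<nu>" "\<And>k. integrable \<nu> (\<lambda>x. x ^ k)" "\<And>k. (\<integral>x. x ^ k \<partial>\<nu>) = jacobi_power a b k 0 0"
    using moment_limit_exists[of \<mu> "\<lambda>k. jacobi_power a b k 0 0"] \<mu> by blast
  then show ?thesis
    unfolding jacobi_moment_measure_def real_distribution_def real_distribution_axioms_def by blast
qed

end

section \<open>Stieltjes transforms and the Poisson kernel\<close>

definition stieltjes :: "real measure \<Rightarrow> complex \<Rightarrow> complex" where
  "stieltjes \<mu> z = (\<integral>x. 1 / (z - of_real x) \<partial>\<mu>)"

lemma norm_resolvent_le:
  assumes "Im z > 0"
  shows "cmod (1 / (z - of_real x)) \<le> 1 / Im z"
proof -
  have "Im z \<le> cmod (z - of_real x)"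
    using abs_Im_le_cmod[of "z - of_real x"] assms by simp
  then show ?thesis
    using assms by (simp add: norm_divide frac_le)
qed

definition poisson :: "real \<Rightarrow> real \<Rightarrow> real" where
  "poisson y x = y / (pi * (x\<^sup>2 + y\<^sup>2))"

lemma poisson_measurable [measurable]: "poisson y \<in> borel_measurable borel"
  unfolding poisson_def[abs_def] by measurable

lemma poisson_nonneg: "y \<ge> 0 \<Longrightarrow> poisson y x \<ge> 0"
  by (simp add: poisson_def)

lemma poisson_1:
  "integrable lborel (poisson 1)" "(\<integral>x. poisson 1 x \<partial>lborel) = 1"
proof -
  have *: "poisson 1 = (\<lambda>x. inverse (1 + x\<^sup>2) / pi)"
    by (simp add: poisson_def fun_eq_iff divide_simps add.commute)
  have "integrable lborel (\<lambda>x::real. inverse (1 + x\<^sup>2))"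
    using integrable_inverse_1_plus_square by (simp add: set_integrable_def einterval_def)
  then show "integrable lborel (poisson 1)" unfolding * by simp
  have "(\<integral>x. inverse (1 + x\<^sup>2) \<partial>lborel) = pi"
    using LBINT_inverse_1_plus_square
    by (simp add: interval_lebesgue_integral_def set_lebesgue_integral_def einterval_def)
  then show "(\<integral>x. poisson 1 x \<partial>lborel) = 1" unfolding * by simp
qed

text \<open>
  Scaling the kernel to height 1 moves the parameter \<open>y\<close> into the argument of \<open>f\<close>, where
  continuity can be used.
\<close>

lemma poisson_convolution:
  fixes f :: "real \<Rightarrow> real"
  assumes "y > 0"
  shows "(\<integral>x. f x * poisson y (x - t) \<partial>lborel) = (\<integral>s. f (t + y * s) * poisson 1 s \<partial>lborel)"
proof -
  have sc: "y * poisson y (y * s) = poisson 1 s" for s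
  proof -
    have "(y * s)\<^sup>2 + y\<^sup>2 = y * (y * (s\<^sup>2 + 1))" by (simp add: power2_eq_square algebra_simps)
    then show ?thesis using assms by (simp add: poisson_def)
  qed
  have "(\<integral>x. f x * poisson y (x - t) \<partial>lborel) = \<bar>y\<bar> *\<^sub>R (\<integral>s. f (t + y * s) * poisson y ((t + y * s) - t) \<partial>lborel)"
    using assms by (intro lborel_integral_real_affine) auto
  also have "\<dots> = (\<integral>s. f (t + y * s) * (y * poisson y (y * s)) \<partial>lborel)"
    using assms by (simp add: mult_ac flip: integral_mult_right_zero)
  finally show ?thesis unfolding sc .
qed

lemma nn_integral_poisson:
  assumes "y > 0"
  shows "(\<integral>\<^sup>+x. ennreal (poisson y (x - t)) \<partial>lborel) = 1"
proof -
  have sc: "y * poisson y (y * s) = poisson 1 s" for s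
  proof -
    have "(y * s)\<^sup>2 + y\<^sup>2 = y * (y * (s\<^sup>2 + 1))" by (simp add: power2_eq_square algebra_simps)
    then show ?thesis using assms by (simp add: poisson_def)
  qed
  have "(\<integral>\<^sup>+x. ennreal (poisson y (x - t)) \<partial>lborel) = ennreal \<bar>y\<bar> * (\<integral>\<^sup>+s. ennreal (poisson y ((t + y * s) - t)) \<partial>lborel)"
    using assms by (intro nn_integral_real_affine) auto
  also have "\<dots> = (\<integral>\<^sup>+s. ennreal (poisson 1 s) \<partial>lborel)"
    using assms by (subst nn_integral_cmult[symmetric])
      (auto simp: sc poisson_nonneg simp flip: ennreal_mult)
  also have "\<dots> = 1"
    using poisson_1 by (subst nn_integral_eq_integral) (auto simp: poisson_nonneg)
  finally show ?thesis .
qed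

lemma (in real_distribution) integrable_resolvent:
  assumes "Im z > 0"
  shows "integrable M (\<lambda>x. 1 / (z - of_real x))"
  by (rule integrable_const_bound[where B = "1 / Im z"]) (use norm_resolvent_le[OF assms] in auto)

lemma (in real_distribution) norm_stieltjes_le:
  assumes "Im z > 0"
  shows "cmod (stieltjes M z) \<le> 1 / Im z"
proof -
  have "cmod (stieltjes M z) \<le> (\<integral>x. 1 / Im z \<partial>M)"
    unfolding stieltjes_def using norm_resolvent_le[OF assms]
    by (intro integral_norm_le_AE) auto
  then show ?thesis using prob_space by simp
qed

lemma (in real_distribution) Im_stieltjes:
  assumes "y > 0"
  shows "- Im (stieltjes M (Complex x y)) = pi * (\<integral>t. poisson y (x - t) \<partial>M)"
proof -
  have "- Im (1 / (Complex x y - of_real t)) = pi * poisson y (x - t)" for t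
  proof -
    have "- Im (1 / (Complex x y - of_real t)) = y / ((x - t)\<^sup>2 + y\<^sup>2)"
      by (simp add: Im_divide)
    then show ?thesis by (simp add: poisson_def)
  qed
  moreover have "Im (stieltjes M (Complex x y)) = (\<integral>t. Im (1 / (Complex x y - of_real t)) \<partial>M)"
    unfolding stieltjes_def using assms by (intro integral_Im[symmetric] integrable_resolvent) simp
  ultimately show ?thesis
    by (simp flip: integral_mult_right_zero Bochner_Integration.integral_minus)
qed

text \<open>
  By Fubini the left-hand side is the integral of the Poisson averages of \<open>f\<close>, which are
  bounded and converge pointwise to \<open>f\<close>.
\<close>

lemma (in real_distribution) poisson_integral_approximates:
  fixes f :: "real \<Rightarrow> real"
  assumes f: "continuous_on UNIV f" and B: "\<And>x. \<bar>f x\<bar> \<le> B"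
  shows "(\<lambda>n. (\<integral>x. f x * (- Im (stieltjes M (Complex x (1 / real (Suc n)))) / pi) \<partial>lborel))
     \<longlonglongrightarrow> (\<integral>x. f x \<partial>M)"
proof -
  have [measurable]: "f \<in> borel_measurable borel"
    using f by (rule borel_measurable_continuous_onI)
  interpret P: pair_sigma_finite lborel M ..
  define g where "g y t = (\<integral>s. f (t + y * s) * poisson 1 s \<partial>lborel)" for y t
  have dom: "integrable lborel (\<lambda>s. B * poisson 1 s)" using poisson_1(1) by simp
  have bnd: "norm (f u * poisson 1 s) \<le> B * poisson 1 s" for u s
    using B by (simp add: abs_mult poisson_nonneg mult_right_mono)
  have [measurable]: "g y \<in> borel_measurable M" for y
    unfolding g_def by measurable
  have gB: "\<bar>g y t\<bar> \<le> B" for y t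
  proof -
    have "norm (g y t) \<le> (\<integral>s. B * poisson 1 s \<partial>lborel)"
      unfolding g_def by (rule integral_norm_le_AE[OF dom]) (use bnd in auto)
    then show ?thesis using poisson_1(2) by simp
  qed
  have eq: "(\<integral>x. f x * (- Im (stieltjes M (Complex x y)) / pi) \<partial>lborel) = (\<integral>t. g y t \<partial>M)" if y: "y > 0" for y
  proof -
    have "(\<integral>x. f x * (- Im (stieltjes M (Complex x y)) / pi) \<partial>lborel) = (\<integral>x. (\<integral>t. f x * poisson y (x - t) \<partial>M) \<partial>lborel)"
      unfolding Im_stieltjes[OF y] by simp
    also have "\<dots> = (\<integral>t. (\<integral>x. f x * poisson y (x - t) \<partial>lborel) \<partial>M)"
    proof (rule P.Fubini_integral[symmetric])
      show "integrable (lborel \<Otimes>\<^sub>M M) (\<lambda>(x, t). f x * poisson y (x - t))"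
      proof (rule integrableI_bounded)
        have "(\<integral>\<^sup>+p. ennreal (norm (case p of (x, t) \<Rightarrow> f x * poisson y (x - t))) \<partial>(lborel \<Otimes>\<^sub>M M)) \<le>
            (\<integral>\<^sup>+p. ennreal (\<bar>B\<bar> * poisson y (fst p - snd p)) \<partial>(lborel \<Otimes>\<^sub>M M))"
          using B y by (intro nn_integral_mono)
            (auto simp: abs_mult poisson_nonneg intro!: ennreal_leI mult_right_mono order.trans[OF B])
        also have "\<dots> = (\<integral>\<^sup>+t. \<integral>\<^sup>+x. ennreal (\<bar>B\<bar> * poisson y (x - t)) \<partial>lborel \<partial>M)"
          by (subst P.nn_integral_snd[symmetric]) (auto simp: case_prod_beta)
        also have "\<dots> = (\<integral>\<^sup>+t. ennreal \<bar>B\<bar> \<partial>M)"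
          using y by (simp add: ennreal_mult poisson_nonneg nn_integral_cmult nn_integral_poisson)
        also have "\<dots> < \<infinity>" by (simp add: emeasure_space_1[simplified])
        finally show "(\<integral>\<^sup>+p. ennreal (norm (case p of (x, t) \<Rightarrow> f x * poisson y (x - t))) \<partial>(lborel \<Otimes>\<^sub>M M)) < \<infinity>" .
      qed measurable
    qed
    also have "\<dots> = (\<integral>t. g y t \<partial>M)"
      unfolding g_def poisson_convolution[OF y] ..
    finally show ?thesis .
  qed
  have lim_g: "(\<lambda>n. g (1 / real (Suc n)) t) \<longlonglongrightarrow> f t" for t
  proof -
    have "(\<lambda>n. g (1 / real (Suc n)) t) \<longlonglongrightarrow> (\<integral>s. f t * poisson 1 s \<partial>lborel)"
      unfolding g_def
    proof (rule integral_dominated_convergence[OF _ _ dom])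
      show "AE s in lborel. (\<lambda>n. f (t + 1 / real (Suc n) * s) * poisson 1 s) \<longlonglongrightarrow> f t * poisson 1 s"
      proof (intro AE_I2 tendsto_intros)
        fix s
        have "(\<lambda>n. t + 1 / real (Suc n) * s) \<longlonglongrightarrow> t + 0 * s"
          by (intro tendsto_intros LIMSEQ_Suc[OF lim_const_over_n])
        then show "(\<lambda>n. f (t + 1 / real (Suc n) * s)) \<longlonglongrightarrow> f t"
          using f continuous_on_tendsto_compose[OF f, of "\<lambda>n. t + 1 / real (Suc n) * s" t sequentially] by simp
      qed
    qed (use bnd in auto)
    then show ?thesis using poisson_1(2) by simp
  qed
  have "(\<lambda>n. \<integral>t. g (1 / real (Suc n)) t \<partial>M) \<longlonglongrightarrow> (\<integral>t. f t \<partial>M)"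
    by (rule integral_dominated_convergence[where w = "\<lambda>_. B"]) (use gB lim_g in auto)
  then show ?thesis
    by (subst eq) auto
qed

text \<open>
  Open intervals are increasing limits of continuous bumps, and they generate the Borel
  sets. Test functions with compact support suffice, so one of the measures may be given by
  a density whose total mass is not yet known.
\<close>

lemma measure_eqI_bump_functions:
  fixes \<mu> \<nu> :: "real measure"
  assumes sets: "sets \<mu> = sets borel" "sets \<nu> = sets borel"
    and fin: "\<And>c d. emeasure \<mu> {c<..<d} \<noteq> \<infinity>"
    and eq: "\<And>f R. continuous_on UNIV f \<Longrightarrow> (\<And>x. 0 \<le> f x \<and> f x \<le> 1) \<Longrightarrow> (\<And>x. \<bar>x\<bar> > R \<Longrightarrow> f x = 0) \<Longrightarrow>
        (\<integral>\<^sup>+x. ennreal (f x) \<partial>\<mu>) = (\<integral>\<^sup>+x. ennreal (f x) \<partial>\<nu>)"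
  shows "\<mu> = \<nu>"
proof -
  note [measurable_cong] = sets
  have open_eq: "emeasure \<mu> {c<..<d} = emeasure \<nu> {c<..<d}" for c d
  proof -
    \<comment> \<open>trapezoids that increase to the indicator of the interval\<close>
    define g where "g n x = min 1 (real n * max 0 (min (x - c) (d - x)))" for n x
    have [measurable]: "g n \<in> borel_measurable borel" for n
      unfolding g_def by measurable
    have cont: "continuous_on UNIV (g n)" for n
      unfolding g_def by (intro continuous_intros)
    have bd: "0 \<le> g n x \<and> g n x \<le> 1" for n x by (auto simp: g_def)
    have supp: "g n x = 0" if "\<bar>x\<bar> > max \<bar>c\<bar> \<bar>d\<bar>" for n x
    proof -
      have "min (x - c) (d - x) \<le> 0" using that by linarith
      then show ?thesis by (simp add: g_def)
    qed
    have inc: "incseq (\<lambda>n x. ennreal (g n x))"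
    proof (intro incseq_SucI le_funI ennreal_leI)
      fix n x
      have "real n * t \<le> real (Suc n) * t" if "t \<ge> 0" for t
        using that by (intro mult_right_mono) auto
      then show "g n x \<le> g (Suc n) x"
        unfolding g_def by (intro min.mono) auto
    qed
    have sup: "(SUP n. ennreal (g n x)) = indicator {c<..<d} x" for x
    proof (cases "x \<in> {c<..<d}")
      case True
      then have m: "min (x - c) (d - x) > 0" by auto
      obtain N where N: "1 / min (x - c) (d - x) \<le> real N"
        using real_arch_simple by blast
      then have "1 \<le> real N * min (x - c) (d - x)"
        using m by (simp add: pos_divide_le_eq)
      then have "g N x = 1" using m by (simp add: g_def)
      then have "1 \<le> (SUP n. ennreal (g n x))"
        using SUP_upper[of N UNIV "\<lambda>n. ennreal (g n x)"] by simp
      moreover have "(SUP n. ennreal (g n x)) \<le> 1"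
        using bd by (intro SUP_least) simp
      ultimately have "(SUP n. ennreal (g n x)) = 1" by (rule antisym[rotated])
      then show ?thesis using True by simp
    next
      case False
      then have "min (x - c) (d - x) \<le> 0" by auto
      then have "g n x = 0" for n by (simp add: g_def)
      then show ?thesis using False by simp
    qed
    have "(\<integral>\<^sup>+x. indicator {c<..<d} x \<partial>\<rho>) = (SUP n. \<integral>\<^sup>+x. ennreal (g n x) \<partial>\<rho>)"
      if [measurable_cong]: "sets \<rho> = sets borel" for \<rho> :: "real measure"
      unfolding sup[symmetric] by (intro nn_integral_monotone_convergence_SUP inc) measurable
    moreover have "(\<integral>\<^sup>+x. ennreal (g n x) \<partial>\<mu>) = (\<integral>\<^sup>+x. ennreal (g n x) \<partial>\<nu>)" for n
      by (rule eq[OF cont bd supp])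
    ultimately show ?thesis
      using sets by (simp flip: nn_integral_indicator)
  qed
  show ?thesis
  proof (rule measure_eqI_generator_eq[where \<Omega> = UNIV and E = "range (\<lambda>(c, d). {c<..<d::real})"
        and A = "\<lambda>n. {- real n<..<real n}"])
    show "Int_stable (range (\<lambda>(c, d). {c<..<d::real}))"
      by (auto simp: Int_stable_def Int_greaterThanLessThan)
    have "sets borel = sigma_sets UNIV (range (\<lambda>(c, d). {c<..<d::real}))"
      by (subst borel_eq_box) (simp add: case_prod_beta box_real)
    then show "sets \<mu> = sigma_sets UNIV (range (\<lambda>(c, d). {c<..<d::real}))"
      "sets \<nu> = sigma_sets UNIV (range (\<lambda>(c, d). {c<..<d::real}))"
      using sets by simp_all
    show "(\<Union>n. {- real n<..<real n}) = UNIV"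
    proof safe
      fix x :: real
      obtain n where "\<bar>x\<bar> < real n" using reals_Archimedean2 by blast
      then show "x \<in> (\<Union>n. {- real n<..<real n})" by (auto intro!: exI[of _ n])
    qed auto
  qed (use open_eq fin in auto)
qed

lemma real_distribution_eqI:
  assumes \<mu>: "real_distribution \<mu>" and \<nu>: "real_distribution \<nu>"
    and eq: "\<And>f :: real \<Rightarrow> real. continuous_on UNIV f \<Longrightarrow> bounded (range f) \<Longrightarrow> (\<integral>x. f x \<partial>\<mu>) = (\<integral>x. f x \<partial>\<nu>)"
  shows "\<mu> = \<nu>"
proof (rule measure_eqI_bump_functions)
  interpret \<mu>: real_distribution \<mu> by fact
  interpret \<nu>: real_distribution \<nu> by fact
  show "sets \<mu> = sets borel" "sets \<nu> = sets borel" by simp_all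
  show "emeasure \<mu> {c<..<d} \<noteq> \<infinity>" for c d by simp
  fix f :: "real \<Rightarrow> real" and R
  assume f: "continuous_on UNIV f" "\<And>x. 0 \<le> f x \<and> f x \<le> 1"
  have [measurable]: "f \<in> borel_measurable borel"
    using f(1) by (rule borel_measurable_continuous_onI)
  have "integrable \<mu> f" "integrable \<nu> f"
    using f(2) by (auto intro!: \<mu>.integrable_const_bound[where B = 1] \<nu>.integrable_const_bound[where B = 1])
  moreover have "bounded (range f)"
    using f(2) by (auto intro!: boundedI[where B = 1])
  ultimately show "(\<integral>\<^sup>+x. ennreal (f x) \<partial>\<mu>) = (\<integral>\<^sup>+x. ennreal (f x) \<partial>\<nu>)"
    using f eq[of f] by (simp add: nn_integral_eq_integral)
qed

lemma stieltjes_unique: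
  assumes \<mu>: "real_distribution \<mu>" and \<nu>: "real_distribution \<nu>"
    and eq: "\<And>z. Im z > 0 \<Longrightarrow> stieltjes \<mu> z = stieltjes \<nu> z"
  shows "\<mu> = \<nu>"
proof (rule real_distribution_eqI[OF \<mu> \<nu>])
  fix f :: "real \<Rightarrow> real"
  assume f: "continuous_on UNIV f" and "bounded (range f)"
  then obtain B where B: "\<And>x. \<bar>f x\<bar> \<le> B"
    by (auto simp: bounded_iff)
  show "(\<integral>x. f x \<partial>\<mu>) = (\<integral>x. f x \<partial>\<nu>)"
    using real_distribution.poisson_integral_approximates[OF \<mu> f B]
      real_distribution.poisson_integral_approximates[OF \<nu> f B]
    by (auto simp: eq intro: LIMSEQ_unique)
qed

section \<open>Orthonormality with respect to a moment measure\<close>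

context jacobi_coeffs
begin

context
  fixes \<mu> assumes \<mu>: "jacobi_moment_measure a b \<mu>"
begin

interpretation real_distribution \<mu>
  using \<mu> by (simp add: jacobi_moment_measure_def real_distribution_def real_distribution_axioms_def)

lemma integrable_poly: "integrable \<mu> (\<lambda>x. poly q x)"
  unfolding poly_altdef using \<mu> by (auto simp: jacobi_moment_measure_def)

lemma integrable_p_mult: "integrable \<mu> (\<lambda>x. p i x * p j x)"
  using integrable_poly[of "orth_poly a b i * orth_poly a b j"] by simp

text \<open>
  Both sides satisfy the same recurrence in \<open>j\<close>, and agree for \<open>j = 0\<close> by the assumption on
  the moments.
\<close>

lemma integral_power_p: "(\<integral>x. x ^ k * p j x \<partial>\<mu>) = jacobi_power a b k j 0"
proof (induction j arbitrary: k rule: less_induct)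
  case (less j)
  have int: "integrable \<mu> (\<lambda>x. x ^ k * p i x)" for i k
    using integrable_poly[of "monom 1 k * orth_poly a b i"] by (simp add: poly_monom)
  show ?case
  proof (cases j)
    case 0
    then show ?thesis using \<mu> by (simp add: jacobi_moment_measure_def)
  next
    case (Suc i)
    have eq: "b i * (x ^ k * p (Suc i) x) = x ^ Suc k * p i x - a i * (x ^ k * p i x) -
        x ^ k * prev_term b (\<lambda>l. p l x) i" for x :: real
    proof -
      have "b i * (x ^ k * p (Suc i) x) = x ^ k * (b i * p (Suc i) x)" by simp
      also have "b i * p (Suc i) x = (x - a i) * p i x - prev_term b (\<lambda>l. p l x) i"
        using poly_orth_poly_Suc[of i x] by simp
      finally show ?thesis by (simp add: algebra_simps)
    qed
    have pint: "integrable \<mu> (\<lambda>x. x ^ k * prev_term b (\<lambda>l. p l x) i)"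
      using int by (cases i) (auto simp: mult.left_commute)
    have pval: "(\<integral>x. x ^ k * prev_term b (\<lambda>l. p l x) i \<partial>\<mu>) = prev_term b (\<lambda>l. jacobi_power a b k l 0) i"
    proof (cases i)
      case (Suc l)
      then show ?thesis using less[of l k] \<open>j = Suc i\<close> by (simp add: mult.left_commute)
    qed simp
    have "b i * (\<integral>x. x ^ k * p (Suc i) x \<partial>\<mu>) = (\<integral>x. b i * (x ^ k * p (Suc i) x) \<partial>\<mu>)"
      by simp
    also have "\<dots> = (\<integral>x. x ^ Suc k * p i x \<partial>\<mu>) - a i * (\<integral>x. x ^ k * p i x \<partial>\<mu>) -
        (\<integral>x. x ^ k * prev_term b (\<lambda>l. p l x) i \<partial>\<mu>)"
      unfolding eq using int[of "Suc k" i] int[of k i] pint by simp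
    also have "\<dots> = jacobi_power a b (Suc k) i 0 - a i * jacobi_power a b k i 0 -
        prev_term b (\<lambda>l. jacobi_power a b k l 0) i"
      using less[of i k] less[of i "Suc k"] pval Suc by simp
    also have "\<dots> = b i * jacobi_power a b k (Suc i) 0"
      unfolding jacobi_power_Suc_eq by simp
    finally show ?thesis using Suc by simp
  qed
qed

text \<open>
  Expanding \<open>x p\<^sub>i p\<^sub>j\<close> by the recurrence in either factor gives a discrete wave equation
  for the Gram matrix. Its row 0 is that of the identity matrix, and the equation propagates
  this to all rows.
\<close>

lemma orthonormal: "(\<integral>x. p i x * p j x \<partial>\<mu>) = (if i = j then 1 else 0)"
proof (induction i arbitrary: j rule: less_induct)
  case (less i)
  have x_p: "x * p j x = b j * p (Suc j) x + a j * p j x + prev_term b (\<lambda>l. p l x) j" for x :: real and j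
    using poly_orth_poly_Suc[of j x] by (simp add: algebra_simps)
  have exp: "(\<integral>x. x * (p k x * p j x) \<partial>\<mu>) =
      b j * (\<integral>x. p k x * p (Suc j) x \<partial>\<mu>) + a j * (\<integral>x. p k x * p j x \<partial>\<mu>) +
      prev_term b (\<lambda>l. \<integral>x. p k x * p l x \<partial>\<mu>) j" for j k
  proof -
    have pint: "integrable \<mu> (\<lambda>x. prev_term b (\<lambda>l. p k x * p l x) j)"
      using integrable_p_mult by (cases j) auto
    have "x * (p k x * p j x) = b j * (p k x * p (Suc j) x) + a j * (p k x * p j x) +
       prev_term b (\<lambda>l. p k x * p l x) j" for x :: real
    proof -
      have "x * (p k x * p j x) = p k x * (x * p j x)" by simp
      then show ?thesis unfolding x_p by (cases j) (simp_all add: algebra_simps)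
    qed
    then have "(\<integral>x. x * (p k x * p j x) \<partial>\<mu>) = (\<integral>x. b j * (p k x * p (Suc j) x) + a j * (p k x * p j x) +
       prev_term b (\<lambda>l. p k x * p l x) j \<partial>\<mu>)" by simp
    also have "\<dots> = b j * (\<integral>x. p k x * p (Suc j) x \<partial>\<mu>) + a j * (\<integral>x. p k x * p j x \<partial>\<mu>) +
       (\<integral>x. prev_term b (\<lambda>l. p k x * p l x) j \<partial>\<mu>)"
      using integrable_p_mult pint by simp
    also have "(\<integral>x. prev_term b (\<lambda>l. p k x * p l x) j \<partial>\<mu>) = prev_term b (\<lambda>l. \<integral>x. p k x * p l x \<partial>\<mu>) j"
      by (cases j) simp_all
    finally show ?thesis .
  qed
  show ?case
  proof (cases i)
    case 0
    then show ?thesis using integral_power_p[of 0 j] by simp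
  next
    case (Suc k)
    have sym: "(\<integral>x. p i x * p j x \<partial>\<mu>) = (\<integral>x. p j x * p i x \<partial>\<mu>)" for i j
      by (simp add: mult.commute)
    have 1: "(\<integral>x. p k x * p j x \<partial>\<mu>) = (if k = j then 1 else 0)" for j
      using less[of k j] Suc by simp
    have 2: "prev_term b (\<lambda>l. \<integral>x. p j x * p l x \<partial>\<mu>) k = prev_term b (\<lambda>l. if l = j then 1 else 0) k"
      by (cases k) (use less[of "k - 1" j] Suc in \<open>auto simp: sym[of j]\<close>)
    have "(\<integral>x. x * (p k x * p j x) \<partial>\<mu>) = (\<integral>x. x * (p j x * p k x) \<partial>\<mu>)"
      by (simp add: mult_ac)
    then have "b j * (if k = Suc j then 1 else 0) + a j * (if k = j then 1 else 0) +
      prev_term b (\<lambda>l. if k = l then 1 else 0) j =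
      b k * (\<integral>x. p j x * p (Suc k) x \<partial>\<mu>) + a k * (if k = j then 1 else 0) +
      prev_term b (\<lambda>l. if l = j then 1 else 0) k"
      unfolding exp 1 2 using 1[of j] sym[of j k] by simp
    moreover have "b j * (if k = Suc j then 1 else 0) + prev_term b (\<lambda>l. if k = l then 1 else 0) j -
        prev_term b (\<lambda>l. if l = j then 1 else 0) k = (if Suc k = j then b k else 0)"
      by (cases j; cases k) auto
    ultimately have "b k * (\<integral>x. p j x * p (Suc k) x \<partial>\<mu>) = b k * (if Suc k = j then 1 else 0)"
      by (auto split: if_splits)
    then have "(\<integral>x. p j x * p (Suc k) x \<partial>\<mu>) = (if Suc k = j then 1 else 0)" by simp
    with sym[of i j] Suc show ?thesis by (simp only:)
  qed
qed

text \<open>Expand the nonnegative integral of the squared distance between \<open>f\<close> and its projection.\<close>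

lemma bessel_inequality:
  fixes f :: "real \<Rightarrow> real"
  assumes [measurable]: "f \<in> borel_measurable borel" and B: "\<And>x. \<bar>f x\<bar> \<le> B"
  shows "(\<Sum>k\<le>n. (\<integral>x. f x * p k x \<partial>\<mu>)\<^sup>2) \<le> (\<integral>x. (f x)\<^sup>2 \<partial>\<mu>)"
proof -
  define c where "c k = (\<integral>x. f x * p k x \<partial>\<mu>)" for k
  have f2: "integrable \<mu> (\<lambda>x. (f x)\<^sup>2)"
    by (rule integrable_const_bound[where B = "B\<^sup>2"]) (use B in \<open>auto simp: abs_le_square_iff[symmetric] intro!: AE_I2 order.trans[OF B]\<close>)
  have fp: "integrable \<mu> (\<lambda>x. f x * p k x)" for k
    by (rule Bochner_Integration.integrable_bound[where f = "\<lambda>x. B * p k x"])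
      (use integrable_poly[of "orth_poly a b k"] B in \<open>auto simp: abs_mult intro!: mult_right_mono order.trans[OF B]\<close>)
  have "0 \<le> (\<integral>x. (f x - (\<Sum>k\<le>n. c k * p k x))\<^sup>2 \<partial>\<mu>)"
    by (rule integral_nonneg_AE) simp
  also have "\<dots> = (\<integral>x. (f x)\<^sup>2 - 2 * (\<Sum>k\<le>n. c k * (f x * p k x)) +
      (\<Sum>j\<le>n. \<Sum>k\<le>n. c j * c k * (p j x * p k x)) \<partial>\<mu>)"
  proof (rule Bochner_Integration.integral_cong[OF refl])
    fix x
    have "(\<Sum>k\<le>n. c k * p k x)\<^sup>2 = (\<Sum>j\<le>n. \<Sum>k\<le>n. c j * c k * (p j x * p k x))"
      by (simp add: power2_eq_square sum_product mult_ac)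
    moreover have "f x * (\<Sum>k\<le>n. c k * p k x) = (\<Sum>k\<le>n. c k * (f x * p k x))"
      by (simp add: sum_distrib_left mult_ac)
    ultimately show "(f x - (\<Sum>k\<le>n. c k * p k x))\<^sup>2 = (f x)\<^sup>2 - 2 * (\<Sum>k\<le>n. c k * (f x * p k x)) +
      (\<Sum>j\<le>n. \<Sum>k\<le>n. c j * c k * (p j x * p k x))"
      by (simp add: power2_diff)
  qed
  also have "\<dots> = (\<integral>x. (f x)\<^sup>2 \<partial>\<mu>) - 2 * (\<Sum>k\<le>n. c k * c k) +
      (\<Sum>j\<le>n. \<Sum>k\<le>n. c j * c k * (if j = k then 1 else 0))"
    using f2 fp integrable_p_mult by (simp add: Bochner_Integration.integral_sum orthonormal c_def)
  also have "\<dots> = (\<integral>x. (f x)\<^sup>2 \<partial>\<mu>) - (\<Sum>k\<le>n. (c k)\<^sup>2)"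
    by (simp add: if_distrib[of "\<lambda>u. _ * u"] power2_eq_square cong: if_cong)
  finally show ?thesis by (simp add: c_def)
qed

end

end

section \<open>Square summable solutions and uniqueness\<close>

context jacobi_coeffs
begin

text \<open>Row 0 has no preceding term, so the value at 0 determines all others.\<close>

lemma recurrence_unique:
  fixes z :: complex
  assumes "\<And>k. k < n \<Longrightarrow> of_real (b k) * d (Suc k) = (z - of_real (a k)) * d k - prev_term b d k"
    and "k \<le> n"
  shows "d k = d 0 * p k z"
  using assms(2)
proof (induction k rule: less_induct)
  case (less k)
  show ?case
  proof (cases k)
    case 0
    then show ?thesis by simp
  next
    case (Suc i)
    have IH: "d l = d 0 * p l z" if "l \<le> i" for l
      using less.IH[of l] less.prems Suc that by linarith
    have prev: "prev_term b d i = d 0 * prev_term b (\<lambda>l. p l z) i"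
    proof (cases i)
      case (Suc l)
      then show ?thesis using IH[of l] by simp
    qed simp
    have "of_real (b i) * d (Suc i) = (z - of_real (a i)) * d i - prev_term b d i"
      using assms(1)[of i] less.prems Suc by simp
    also have "\<dots> = d 0 * ((z - of_real (a i)) * p i z - prev_term b (\<lambda>l. p l z) i)"
      unfolding prev by (subst IH) (simp_all add: right_diff_distrib mult.left_commute)
    also have "\<dots> = d 0 * (of_real (b i) * p (Suc i) z)"
      by (simp only: poly_orth_poly_Suc)
    also have "\<dots> = of_real (b i) * (d 0 * p (Suc i) z)"
      by simp
    finally show ?thesis using Suc by simp
  qed
qed

text \<open>
  The Fourier coefficients of \<open>1 / (z - x)\<close> in the basis \<open>p\<^sub>n\<close>; equivalently, the first
  column of the resolvent.
\<close>

definition resolvent_coeff :: "real measure \<Rightarrow> complex \<Rightarrow> nat \<Rightarrow> complex" where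
  "resolvent_coeff \<mu> z n = (\<integral>x. of_real (p n x) / (z - of_real x) \<partial>\<mu>)"

lemma resolvent_coeff_0: "resolvent_coeff \<mu> z 0 = stieltjes \<mu> z"
  by (simp add: resolvent_coeff_def stieltjes_def)

lemma moment_measure_real_distribution:
  "jacobi_moment_measure a b \<mu> \<Longrightarrow> real_distribution \<mu>"
  by (simp add: jacobi_moment_measure_def real_distribution_def real_distribution_axioms_def)

lemma integrable_resolvent_coeff:
  assumes \<mu>: "jacobi_moment_measure a b \<mu>" and z: "Im z > 0"
  shows "integrable \<mu> (\<lambda>x. of_real (p n x) / (z - of_real x))"
proof (rule Bochner_Integration.integrable_bound)
  interpret real_distribution \<mu> by (rule moment_measure_real_distribution[OF \<mu>])
  show "integrable \<mu> (\<lambda>x. p n x * (1 / Im z))"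
    using integrable_poly[OF \<mu>, of "orth_poly a b n"] by simp
  show "(\<lambda>x. of_real (p n x) / (z - of_real x)) \<in> borel_measurable \<mu>"
    using integrable_poly[OF \<mu>, of "orth_poly a b n"] by measurable
  show "AE x in \<mu>. norm (of_real (p n x) / (z - of_real x)) \<le> norm (p n x * (1 / Im z))"
  proof (intro AE_I2)
    fix x
    have "norm (of_real (p n x) / (z - of_real x)) = \<bar>p n x\<bar> * cmod (1 / (z - of_real x))"
      by (simp add: norm_divide)
    also have "\<dots> \<le> \<bar>p n x\<bar> * (1 / Im z)"
      by (intro mult_left_mono norm_resolvent_le z) simp
    finally show "norm (of_real (p n x) / (z - of_real x)) \<le> norm (p n x * (1 / Im z))"
      using z by (simp add: abs_mult)
  qed
qed

text \<open>
  Write \<open>x = z - (z - x)\<close> in the recurrence of \<open>p\<^sub>n\<close> and divide by \<open>z - x\<close>. The extra term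
  is the integral of \<open>p\<^sub>n\<close>, which is nonzero in row 0 only.
\<close>

lemma resolvent_coeff_recurrence:
  assumes \<mu>: "jacobi_moment_measure a b \<mu>" and z: "Im z > 0"
  defines "u \<equiv> resolvent_coeff \<mu> z"
  shows "of_real (b n) * u (Suc n) = (z - of_real (a n)) * u n - prev_term b u n - (if n = 0 then 1 else 0)"
proof -
  interpret real_distribution \<mu> by (rule moment_measure_real_distribution[OF \<mu>])
  note int = integrable_resolvent_coeff[OF \<mu> z]
  have nz: "z - of_real x \<noteq> 0" for x using z by (auto simp: complex_eq_iff)
  have pint: "integrable \<mu> (\<lambda>x. prev_term b (\<lambda>k. of_real (p k x) / (z - of_real x) :: complex) n)"
    using int by (cases n) (auto simp del: times_divide_eq_right)
  have p_int: "integrable \<mu> (\<lambda>x. complex_of_real (p n x))"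
    using integrable_poly[OF \<mu>, of "orth_poly a b n"] by simp
  have pt: "of_real (b n) * (of_real (p (Suc n) x) / (z - of_real x)) =
      (z - of_real (a n)) * (of_real (p n x) / (z - of_real x)) -
      prev_term b (\<lambda>k. of_real (p k x) / (z - of_real x)) n - of_real (p n x)" for x
  proof -
    have "b n * p (Suc n) x = (x - a n) * p n x - prev_term b (\<lambda>k. p k x) n"
      using poly_orth_poly_Suc[of n x] by simp
    from arg_cong[OF this, of complex_of_real]
    have "of_real (b n) * of_real (p (Suc n) x) =
        (of_real x - of_real (a n)) * of_real (p n x) - complex_of_real (prev_term b (\<lambda>k. p k x) n)"
      by simp
    also have "\<dots> = (z - of_real (a n)) * of_real (p n x) - of_real (prev_term b (\<lambda>k. p k x) n) - of_real (p n x) * (z - of_real x)"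
      by (simp add: algebra_simps)
    finally have "of_real (b n) * of_real (p (Suc n) x) / (z - of_real x) =
       (z - of_real (a n)) * of_real (p n x) / (z - of_real x) - of_real (prev_term b (\<lambda>k. p k x) n) / (z - of_real x) - of_real (p n x)"
      using nz[of x] by (simp add: diff_divide_distrib)
    moreover have "of_real (prev_term b (\<lambda>k. p k x) n) / (z - of_real x) = prev_term b (\<lambda>k. of_real (p k x) / (z - of_real x)) n"
      by (cases n) simp_all
    ultimately show ?thesis by simp
  qed
  have "of_real (b n) * u (Suc n) = (\<integral>x. of_real (b n) * (of_real (p (Suc n) x) / (z - of_real x)) \<partial>\<mu>)"
    unfolding u_def resolvent_coeff_def by (rule integral_mult_right_zero[symmetric])
  also have "\<dots> = (z - of_real (a n)) * u n -
      (\<integral>x. prev_term b (\<lambda>k. of_real (p k x) / (z - of_real x)) n \<partial>\<mu>) - (\<integral>x. of_real (p n x) \<partial>\<mu>)"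
    unfolding pt u_def resolvent_coeff_def
    using int[of n] pint p_int by (simp del: times_divide_eq_right)
  also have "(\<integral>x. prev_term b (\<lambda>k. of_real (p k x) / (z - of_real x)) n \<partial>\<mu>) = prev_term b u n"
    by (cases n) (simp_all add: u_def resolvent_coeff_def del: times_divide_eq_right)
  also have "(\<integral>x. complex_of_real (p n x) \<partial>\<mu>) = (if n = 0 then 1 else 0)"
    using orthonormal[OF \<mu>, of n 0] by simp
  finally show ?thesis .
qed

lemma resolvent_coeff_bessel:
  assumes \<mu>: "jacobi_moment_measure a b \<mu>" and z: "Im z > 0"
  shows "(\<Sum>k\<le>n. (cmod (resolvent_coeff \<mu> z k))\<^sup>2) \<le> (1 / Im z)\<^sup>2"
proof -
  interpret real_distribution \<mu> by (rule moment_measure_real_distribution[OF \<mu>])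
  define g where "g x = 1 / (z - of_real x)" for x
  have [measurable]: "g \<in> borel_measurable borel" unfolding g_def by measurable
  have gB: "cmod (g x) \<le> 1 / Im z" for x
    unfolding g_def by (rule norm_resolvent_le[OF z])
  have re: "\<bar>Re (g x)\<bar> \<le> 1 / Im z" and im: "\<bar>Im (g x)\<bar> \<le> 1 / Im z" for x
    using gB[of x] abs_Re_le_cmod[of "g x"] abs_Im_le_cmod[of "g x"] by linarith+
  have int: "integrable \<mu> (\<lambda>x. g x * of_real (p k x))" for k
    using integrable_resolvent_coeff[OF \<mu> z, of k] by (simp add: g_def)
  have u: "resolvent_coeff \<mu> z k = (\<integral>x. g x * of_real (p k x) \<partial>\<mu>)" for k
    by (simp add: resolvent_coeff_def g_def)
  have Re_u: "Re (resolvent_coeff \<mu> z k) = (\<integral>x. Re (g x) * p k x \<partial>\<mu>)" 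
   and Im_u: "Im (resolvent_coeff \<mu> z k) = (\<integral>x. Im (g x) * p k x \<partial>\<mu>)" for k
    unfolding u by (simp_all flip: integral_Re[OF int] integral_Im[OF int])
  have "(\<Sum>k\<le>n. (cmod (resolvent_coeff \<mu> z k))\<^sup>2) =
    (\<Sum>k\<le>n. (\<integral>x. Re (g x) * p k x \<partial>\<mu>)\<^sup>2) + (\<Sum>k\<le>n. (\<integral>x. Im (g x) * p k x \<partial>\<mu>)\<^sup>2)"
    by (simp add: cmod_power2 Re_u Im_u sum.distrib)
  also have "\<dots> \<le> (\<integral>x. (Re (g x))\<^sup>2 \<partial>\<mu>) + (\<integral>x. (Im (g x))\<^sup>2 \<partial>\<mu>)"
    by (intro add_mono bessel_inequality[OF \<mu>, where B = "1 / Im z"] re im) measurable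
  also have "\<dots> = (\<integral>x. (Re (g x))\<^sup>2 + (Im (g x))\<^sup>2 \<partial>\<mu>)"
  proof (rule Bochner_Integration.integral_add[symmetric])
    show "integrable \<mu> (\<lambda>x. (Re (g x))\<^sup>2)"
      by (rule integrable_const_bound[where B = "(1 / Im z)\<^sup>2"]) (use re z in \<open>auto simp: abs_le_square_iff[symmetric]\<close>)
    show "integrable \<mu> (\<lambda>x. (Im (g x))\<^sup>2)"
      by (rule integrable_const_bound[where B = "(1 / Im z)\<^sup>2"]) (use im z in \<open>auto simp: abs_le_square_iff[symmetric]\<close>)
  qed
  also have "\<dots> \<le> (\<integral>x. (1 / Im z)\<^sup>2 \<partial>\<mu>)"
  proof -
    have "norm (\<integral>x. (Re (g x))\<^sup>2 + (Im (g x))\<^sup>2 \<partial>\<mu>) \<le> (\<integral>x. (1 / Im z)\<^sup>2 \<partial>\<mu>)"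
    proof (rule integral_norm_le_AE)
      show "AE x in \<mu>. norm ((Re (g x))\<^sup>2 + (Im (g x))\<^sup>2) \<le> (1 / Im z)\<^sup>2"
        using gB z by (intro AE_I2) (simp add: cmod_power2[symmetric] power_mono del: power_divide)
    qed simp
    then show ?thesis by simp
  qed
  also have "\<dots> = (1 / Im z)\<^sup>2" using prob_space by simp
  finally show ?thesis .
qed

lemma resolvent_coeff_l2:
  assumes \<mu>: "jacobi_moment_measure a b \<mu>" and z: "Im z > 0"
  shows "summable (\<lambda>k. (cmod (resolvent_coeff \<mu> z k))\<^sup>2)"
proof (rule summableI_nonneg_bounded[where x = "(1 / Im z)\<^sup>2"])
  fix n
  have "(\<Sum>k<n. (cmod (resolvent_coeff \<mu> z k))\<^sup>2) \<le> (\<Sum>k\<le>n. (cmod (resolvent_coeff \<mu> z k))\<^sup>2)"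
    by (rule sum_mono2) auto
  with resolvent_coeff_bessel[OF \<mu> z, of n]
  show "(\<Sum>k<n. (cmod (resolvent_coeff \<mu> z k))\<^sup>2) \<le> (1 / Im z)\<^sup>2"
    by linarith
qed simp

text \<open>
  The Casorati determinant of two solutions is constant; its value comes from the
  inhomogeneity of \<open>u\<close> in row 0.
\<close>

lemma resolvent_wronskian:
  assumes \<mu>: "jacobi_moment_measure a b \<mu>" and z: "Im z > 0"
  defines "u \<equiv> resolvent_coeff \<mu> z"
  shows "of_real (b n) * (p (Suc n) z * u n - p n z * u (Suc n)) = 1"
proof (induction n)
  case 0
  show ?case
    using resolvent_coeff_recurrence[OF \<mu> z, of 0] poly_orth_poly_Suc[of 0 z]
    by (simp add: u_def[symmetric] right_diff_distrib mult.left_commute[of _ "p 0 z"] flip: mult.assoc)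
next
  case (Suc n)
  have 1: "of_real (b (Suc n)) * u (Suc (Suc n)) = (z - of_real (a (Suc n))) * u (Suc n) - of_real (b n) * u n"
    using resolvent_coeff_recurrence[OF \<mu> z, of "Suc n"] by (simp add: u_def)
  have 2: "of_real (b (Suc n)) * p (Suc (Suc n)) z = (z - of_real (a (Suc n))) * p (Suc n) z - of_real (b n) * p n z"
    using poly_orth_poly_Suc[of "Suc n" z] by simp
  have "of_real (b (Suc n)) * (p (Suc (Suc n)) z * u (Suc n) - p (Suc n) z * u (Suc (Suc n))) =
     (of_real (b (Suc n)) * p (Suc (Suc n)) z) * u (Suc n) - p (Suc n) z * (of_real (b (Suc n)) * u (Suc (Suc n)))"
    by (simp only: algebra_simps)
  also have "\<dots> = of_real (b n) * (p (Suc n) z * u n - p n z * u (Suc n))"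
    unfolding 1 2 by (simp only: algebra_simps)
  finally show ?case using Suc by simp
qed

end

lemma summable_norm_diff_squared:
  fixes u v :: "nat \<Rightarrow> complex"
  assumes "summable (\<lambda>n. (cmod (u n))\<^sup>2)" "summable (\<lambda>n. (cmod (v n))\<^sup>2)"
  shows "summable (\<lambda>n. (cmod (u n - v n))\<^sup>2)"
proof (rule summable_comparison_test'[where N = 0])
  show "summable (\<lambda>n. 2 * ((cmod (u n))\<^sup>2 + (cmod (v n))\<^sup>2))"
    by (rule summable_mult[OF summable_add[OF assms]])
  show "norm ((cmod (u n - v n))\<^sup>2) \<le> 2 * ((cmod (u n))\<^sup>2 + (cmod (v n))\<^sup>2)" for n
  proof -
    have "(cmod (u n - v n))\<^sup>2 \<le> (cmod (u n) + cmod (v n))\<^sup>2"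
      by (intro power_mono norm_triangle_ineq4) simp
    also have "\<dots> \<le> 2 * ((cmod (u n))\<^sup>2 + (cmod (v n))\<^sup>2)"
      using sum_squares_bound[of "cmod (u n)" "cmod (v n)"] by (simp add: power2_sum)
    finally show ?thesis by simp
  qed
qed

locale jacobi_limit_point = jacobi_coeffs +
  assumes not_summable_b: "\<not> summable (\<lambda>n. 1 / b n)"
begin

text \<open>
  If the polynomial solution were square summable too, the Wronskian identity would bound
  \<open>1 / b\<^sub>n\<close> by products of square summable sequences.
\<close>

lemma p_not_l2:
  assumes z: "Im z > 0"
  shows "\<not> summable (\<lambda>n. (cmod (p n z))\<^sup>2)"
proof
  assume P: "summable (\<lambda>n. (cmod (p n z))\<^sup>2)"
  obtain \<mu> where \<mu>: "jacobi_moment_measure a b \<mu>"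
    using jacobi_moment_measure_exists by blast
  define u where "u = resolvent_coeff \<mu> z"
  have U: "summable (\<lambda>n. (cmod (u n))\<^sup>2)"
    unfolding u_def by (rule resolvent_coeff_l2[OF \<mu> z])
  have PU': "summable (\<lambda>n. (cmod (p (Suc n) z))\<^sup>2)" "summable (\<lambda>n. (cmod (u (Suc n)))\<^sup>2)"
    using summable_ignore_initial_segment[OF P, of 1] summable_ignore_initial_segment[OF U, of 1] by simp_all
  define A where "A n = (cmod (p n z))\<^sup>2" for n
  define B where "B n = (cmod (u n))\<^sup>2" for n
  have AB: "summable A" "summable (\<lambda>n. A (Suc n))" "summable B" "summable (\<lambda>n. B (Suc n))"
    using P U PU' unfolding A_def B_def by simp_all
  have sum: "summable (\<lambda>n. A (Suc n) + B n + (A n + B (Suc n)))"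
    using summable_add[OF summable_add[OF AB(2,3)] summable_add[OF AB(1,4)]] .
  have bound: "norm (1 / b n) \<le> A (Suc n) + B n + (A n + B (Suc n))" for n
  proof -
    have am_gm: "x * y \<le> x\<^sup>2 + y\<^sup>2" if "x \<ge> 0" "y \<ge> 0" for x y :: real
      using sum_squares_bound[of x y] mult_nonneg_nonneg[OF that] by linarith
    have "1 / complex_of_real (b n) = p (Suc n) z * u n - p n z * u (Suc n)"
      using resolvent_wronskian[OF \<mu> z, of n] by (simp add: u_def divide_eq_eq mult.commute)
    moreover have "cmod (1 / complex_of_real (b n)) = 1 / b n"
      using b_pos[of n] by (simp add: norm_divide)
    ultimately have "1 / b n = cmod (p (Suc n) z * u n - p n z * u (Suc n))"
      by simp
    also have "\<dots> \<le> cmod (p (Suc n) z) * cmod (u n) + cmod (p n z) * cmod (u (Suc n))"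
      by (rule order.trans[OF norm_triangle_ineq4]) (simp add: norm_mult)
    also have "\<dots> \<le> A (Suc n) + B n + (A n + B (Suc n))"
      unfolding A_def B_def by (intro add_mono am_gm) auto
    finally show ?thesis using b_pos[of n] by simp
  qed
  have "summable (\<lambda>n. 1 / b n)"
    by (rule summable_comparison_test'[OF sum, of 0]) (rule bound)
  then show False using not_summable_b by simp
qed

lemma l2_recurrence_zero:
  assumes z: "Im z > 0"
    and d: "\<And>k. of_real (b k) * d (Suc k) = (z - of_real (a k)) * d k - prev_term b d k"
    and l2: "summable (\<lambda>n. (cmod (d n))\<^sup>2)"
  shows "d 0 = 0"
proof (rule ccontr)
  assume "d 0 \<noteq> 0"
  define c where "c = d 0"
  have "d n = c * p n z" for n
    unfolding c_def by (rule recurrence_unique[where n = n]) (use d in auto)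
  then have "(\<lambda>n. (cmod (d n))\<^sup>2) = (\<lambda>n. (cmod c)\<^sup>2 * (cmod (p n z))\<^sup>2)"
    by (simp add: fun_eq_iff norm_mult power_mult_distrib)
  with l2 have "summable (\<lambda>n. (cmod c)\<^sup>2 * (cmod (p n z))\<^sup>2)" by (simp only:)
  then have "summable (\<lambda>n. (cmod (p n z))\<^sup>2)"
    using \<open>d 0 \<noteq> 0\<close> unfolding c_def by (subst (asm) summable_cmult_iff) auto
  then show False using p_not_l2[OF z] by simp
qed

text \<open>
  A square summable solution with inhomogeneity \<open>c\<close> differs from \<open>c\<close> times the resolvent
  column by a square summable homogeneous solution, that is, by a multiple of the
  polynomials, hence by 0.
\<close>

lemma l2_solution_stieltjes:
  assumes \<mu>: "jacobi_moment_measure a b \<mu>" and z: "Im z > 0"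
    and v: "\<And>k. of_real (b k) * v (Suc k) = (z - of_real (a k)) * v k - prev_term b v k - (if k = 0 then c else 0)"
    and l2: "summable (\<lambda>n. (cmod (v n))\<^sup>2)"
  shows "v 0 = c * stieltjes \<mu> z"
proof -
  define u where "u = resolvent_coeff \<mu> z"
  define d where "d n = c * u n - v n" for n
  have "d 0 = 0"
  proof (rule l2_recurrence_zero[OF z])
    fix k
    have "of_real (b k) * d (Suc k) = c * (of_real (b k) * u (Suc k)) - of_real (b k) * v (Suc k)"
      by (simp add: d_def algebra_simps)
    also have "\<dots> = (z - of_real (a k)) * d k - prev_term b d k"
      unfolding v u_def resolvent_coeff_recurrence[OF \<mu> z] d_def by (cases k) (simp_all add: algebra_simps)
    finally show "of_real (b k) * d (Suc k) = (z - of_real (a k)) * d k - prev_term b d k" .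
  next
    have "summable (\<lambda>n. (cmod (c * u n))\<^sup>2)"
      using resolvent_coeff_l2[OF \<mu> z] by (simp add: norm_mult power_mult_distrib u_def summable_mult)
    then show "summable (\<lambda>n. (cmod (d n))\<^sup>2)"
      unfolding d_def by (rule summable_norm_diff_squared[OF _ l2])
  qed
  then show ?thesis by (simp add: d_def u_def resolvent_coeff_0)
qed

text \<open>
  The resolvent column of either measure is square summable, so their Stieltjes transforms
  agree.
\<close>

theorem jacobi_moment_measure_unique:
  assumes \<mu>: "jacobi_moment_measure a b \<mu>" and \<nu>: "jacobi_moment_measure a b \<nu>"
  shows "\<nu> = \<mu>"
proof (rule stieltjes_unique)
  fix z assume z: "Im z > 0"
  show "stieltjes \<nu> z = stieltjes \<mu> z"
    using l2_solution_stieltjes[OF \<mu> z, of "resolvent_coeff \<nu> z" 1]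
      resolvent_coeff_recurrence[OF \<nu> z] resolvent_coeff_l2[OF \<nu> z]
    by (simp add: resolvent_coeff_0)
qed (use \<mu> \<nu> moment_measure_real_distribution in auto)

theorem is_spectral_measure_iff:
  "is_spectral_measure a b \<mu> \<longleftrightarrow> jacobi_moment_measure a b \<mu>"
  using jacobi_moment_measure_unique unfolding is_spectral_measure_def by blast

lemma spectral_measure_moment_measure: "jacobi_moment_measure a b (spectral_measure a b)"
proof -
  obtain \<mu> where \<mu>: "jacobi_moment_measure a b \<mu>"
    using jacobi_moment_measure_exists by blast
  have "spectral_measure a b = \<mu>"
    unfolding spectral_measure_def is_spectral_measure_iff
    using \<mu> jacobi_moment_measure_unique by blast
  then show ?thesis using \<mu> by simp
qed

end

section \<open>Convergence of continued fractions\<close>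

text \<open>
  The continued fraction of depth \<open>n\<close>, with the unknown rest replaced by the terminal value
  \<open>w\<close>. The recursion peels off the innermost level, since this is the level at which
  independence of the last pair of entries is used.
\<close>

primrec tail_resolvent :: "(nat \<Rightarrow> real) \<Rightarrow> (nat \<Rightarrow> real) \<Rightarrow> complex \<Rightarrow> nat \<Rightarrow> complex \<Rightarrow> complex" where
  "tail_resolvent a b z 0 w = 1 / w"
| "tail_resolvent a b z (Suc n) w = tail_resolvent a b z n (z - of_real (a n) - of_real ((b n)\<^sup>2) / w)"

lemma Im_continued_fraction_step:
  assumes "Im w > 0"
  shows "Im (z - of_real u - of_real (v\<^sup>2) / w) \<ge> Im z"
proof -
  have "Im (of_real (v\<^sup>2) / w) = - (v\<^sup>2 * Im w / (cmod w)\<^sup>2)"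
    by (simp add: Im_divide cmod_power2)
  moreover have "v\<^sup>2 * Im w / (cmod w)\<^sup>2 \<ge> 0" using assms by simp
  ultimately show ?thesis by simp
qed

lemma norm_tail_resolvent_le:
  assumes "Im z > 0" "Im w \<ge> Im z"
  shows "cmod (tail_resolvent a b z n w) \<le> 1 / Im z"
  using assms(2)
proof (induction n arbitrary: w)
  case 0
  have "Im z \<le> cmod w" using 0 assms(1) abs_Im_le_cmod[of w] by linarith
  then show ?case using assms(1) by (simp add: norm_divide frac_le)
next
  case (Suc n)
  then show ?case using Im_continued_fraction_step[of w z "a n" "b n"] assms(1) by simp
qed

context jacobi_coeffs
begin

text \<open>
  The truncation with terminal value \<open>w\<close> is the first entry of a solution \<open>v\<close> of the
  recurrence on the first \<open>n\<close> rows. Taking imaginary parts of the levels of the continued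
  fraction bounds \<open>\<Sum>|v\<^sub>k|\<^sup>2\<close> just as Bessel's inequality bounds the resolvent column \<open>u\<close>.
  The difference \<open>u - v\<close> is a multiple of the polynomials, and the factor is the difference
  of the two first entries.
\<close>

lemma tail_resolvent_close:
  assumes \<mu>: "jacobi_moment_measure a b \<mu>" and z: "Im z > 0" and w: "Im w > 0"
  shows "(cmod (stieltjes \<mu> z - tail_resolvent a b z n w))\<^sup>2 * (\<Sum>k<n. (cmod (p k z))\<^sup>2) \<le> 4 * (1 / Im z)\<^sup>2"
proof (cases "n = 0")
  case False
  define y where "y = Im z"
  \<comment> \<open>\<open>wl j\<close> is the value of the continued fraction \<open>j\<close> levels above its end, and \<open>W k\<close> the value at level \<open>k\<close>\<close>
  define wl where "wl = rec_nat w (\<lambda>j w'. z - of_real (a (n - Suc j)) - of_real ((b (n - Suc j))\<^sup>2) / w')"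
  define W where "W k = wl (n - k)" for k
  have Wn: "W n = w" by (simp add: W_def wl_def)
  have Wk: "W k = z - of_real (a k) - of_real ((b k)\<^sup>2) / W (Suc k)" if "k < n" for k
  proof -
    have "n - k = Suc (n - Suc k)" using that by simp
    then have "wl (n - k) = z - of_real (a (n - Suc (n - Suc k))) - of_real ((b (n - Suc (n - Suc k)))\<^sup>2) / wl (n - Suc k)"
      by (simp add: wl_def)
    moreover have "n - Suc (n - Suc k) = k" using that by simp
    ultimately show ?thesis by (simp add: W_def)
  qed
  have ImW: "Im (W k) > 0 \<and> (k < n \<longrightarrow> Im (W k) \<ge> y)" if "k \<le> n" for k
    using that
  proof (induction k rule: inc_induct)
    case base
    then show ?case using Wn w by simp
  next
    case (step k)
    then show ?case
      using Im_continued_fraction_step[of "W (Suc k)" z "a k" "b k"] Wk[of k] z by (simp add: y_def)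
  qed
  then have W_nz: "W k \<noteq> 0" if "k \<le> n" for k using that by force
  have tail: "tail_resolvent a b z k (W k) = 1 / W 0" if "k \<le> n" for k
    using that by (induction k) (simp_all add: Wk)
  define v where "v = rec_nat (1 / W 0) (\<lambda>k x. of_real (b k) * x / W (Suc k))"
  have v0: "v 0 = 1 / W 0" and vS: "v (Suc k) = of_real (b k) * v k / W (Suc k)" for k
    by (simp_all add: v_def)
  have v_rec: "of_real (b k) * v (Suc k) = (z - of_real (a k)) * v k - prev_term b v k - (if k = 0 then 1 else 0)"
    if k: "k < n" for k
  proof -
    have "of_real (b k) * v (Suc k) = (of_real ((b k)\<^sup>2) / W (Suc k)) * v k"
      by (simp add: vS power2_eq_square)
    also have "of_real ((b k)\<^sup>2) / W (Suc k) = z - of_real (a k) - W k"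
      using Wk[OF k] by simp
    also have "(z - of_real (a k) - W k) * v k = (z - of_real (a k)) * v k - W k * v k"
      by (simp add: algebra_simps)
    also have "W k * v k = prev_term b v k + (if k = 0 then 1 else 0)"
      using W_nz[of k] k by (cases k) (simp_all add: v0 vS)
    finally show ?thesis by simp
  qed
  \<comment> \<open>each level transfers its imaginary part to the next, up to the loss \<open>y\<close>\<close>
  have energy: "(cmod (v 0))\<^sup>2 * Im (W 0) = y * (\<Sum>j<k. (cmod (v j))\<^sup>2) + (cmod (v k))\<^sup>2 * Im (W k)" if "k \<le> n" for k
    using that
  proof (induction k)
    case (Suc k)
    have "Im (W k) = y + (b k)\<^sup>2 * Im (W (Suc k)) / (cmod (W (Suc k)))\<^sup>2"
      using Wk[of k] Suc by (simp add: y_def Im_divide cmod_power2)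
    then have "(cmod (v k))\<^sup>2 * Im (W k) = y * (cmod (v k))\<^sup>2 + (cmod (v (Suc k)))\<^sup>2 * Im (W (Suc k))"
      by (simp add: vS norm_mult norm_divide power_mult_distrib power_divide algebra_simps)
    then show ?case using Suc by (simp add: algebra_simps)
  qed simp
  have y: "y > 0" using z by (simp add: y_def)
  have W0: "Im (W 0) \<ge> y" using ImW[of 0] False by simp
  have "y * (\<Sum>j<n. (cmod (v j))\<^sup>2) \<le> (cmod (v 0))\<^sup>2 * Im (W 0)"
    using energy[of n] ImW[of n] by simp
  also have "\<dots> = Im (W 0) / (cmod (W 0))\<^sup>2"
    by (simp add: v0 norm_divide power_divide)
  also have "\<dots> \<le> 1 / Im (W 0)"
  proof -
    have "(Im (W 0))\<^sup>2 \<le> (cmod (W 0))\<^sup>2" by (simp add: cmod_power2)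
    moreover have "Im (W 0) > 0" using W0 y by simp
    moreover have "cmod (W 0) > 0" using W_nz[of 0] by simp
    ultimately show ?thesis by (simp add: divide_simps power2_eq_square)
  qed
  also have "\<dots> \<le> 1 / y" using W0 y by (simp add: frac_le)
  finally have sum_v: "(\<Sum>j<n. (cmod (v j))\<^sup>2) \<le> (1 / y)\<^sup>2"
    using y by (simp add: field_simps power2_eq_square)
  define u where "u = resolvent_coeff \<mu> z"
  have "(\<Sum>k<n. (cmod (u k))\<^sup>2) \<le> (\<Sum>k\<le>n. (cmod (u k))\<^sup>2)"
    by (rule sum_mono2) auto
  also have "\<dots> \<le> (1 / y)\<^sup>2"
    unfolding u_def y_def by (rule resolvent_coeff_bessel[OF \<mu> z])
  finally have sum_u: "(\<Sum>k<n. (cmod (u k))\<^sup>2) \<le> (1 / y)\<^sup>2" .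
  define d where "d k = u k - v k" for k
  have d: "d k = d 0 * p k z" if "k \<le> n" for k
  proof (rule recurrence_unique[OF _ that])
    fix k assume k: "k < n"
    show "of_real (b k) * d (Suc k) = (z - of_real (a k)) * d k - prev_term b d k"
    proof -
      have "of_real (b k) * d (Suc k) = of_real (b k) * u (Suc k) - of_real (b k) * v (Suc k)"
        by (simp add: d_def algebra_simps)
      also have "\<dots> = (z - of_real (a k)) * d k - prev_term b d k"
        unfolding v_rec[OF k] u_def resolvent_coeff_recurrence[OF \<mu> z] d_def
        by (cases k) (simp_all add: algebra_simps)
      finally show ?thesis .
    qed
  qed
  have d0: "d 0 = stieltjes \<mu> z - tail_resolvent a b z n w"
    using tail[of n] by (simp add: d_def u_def resolvent_coeff_0 v0 Wn)
  have d_sq: "(cmod (d 0))\<^sup>2 * (cmod (p k z))\<^sup>2 = (cmod (d k))\<^sup>2" if "k < n" for k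
  proof -
    have "cmod (d k) = cmod (d 0) * cmod (p k z)"
      using arg_cong[OF d[OF less_imp_le[OF that]], of cmod] by (simp only: norm_mult)
    then show ?thesis by (simp only: power_mult_distrib)
  qed
  have "(cmod (d 0))\<^sup>2 * (\<Sum>k<n. (cmod (p k z))\<^sup>2) = (\<Sum>k<n. (cmod (d k))\<^sup>2)"
    unfolding sum_distrib_left by (intro sum.cong refl d_sq) simp
  also have "\<dots> \<le> (\<Sum>k<n. 2 * ((cmod (u k))\<^sup>2 + (cmod (v k))\<^sup>2))"
  proof (rule sum_mono)
    fix k
    have "(cmod (u k - v k))\<^sup>2 \<le> (cmod (u k) + cmod (v k))\<^sup>2"
      by (intro power_mono norm_triangle_ineq4) simp
    also have "\<dots> \<le> 2 * ((cmod (u k))\<^sup>2 + (cmod (v k))\<^sup>2)"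
      using sum_squares_bound[of "cmod (u k)" "cmod (v k)"] by (simp add: power2_sum)
    finally show "(cmod (d k))\<^sup>2 \<le> 2 * ((cmod (u k))\<^sup>2 + (cmod (v k))\<^sup>2)" by (simp add: d_def)
  qed
  also have "\<dots> = 2 * ((\<Sum>k<n. (cmod (u k))\<^sup>2) + (\<Sum>k<n. (cmod (v k))\<^sup>2))"
    by (simp add: sum.distrib flip: sum_distrib_left)
  also have "\<dots> \<le> 2 * ((1 / y)\<^sup>2 + (1 / y)\<^sup>2)"
    by (intro mult_left_mono add_mono sum_u sum_v) simp
  also have "\<dots> = 4 * (1 / y)\<^sup>2" by simp
  finally show ?thesis by (simp only: d0 y_def)
qed simp

end

text \<open>
  The sums in the preceding estimate tend to infinity because the polynomials are not square
  summable.
\<close>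

lemma (in jacobi_limit_point) tail_resolvent_tendsto:
  assumes \<mu>: "jacobi_moment_measure a b \<mu>" and z: "Im z > 0" and w: "Im w > 0"
  shows "(\<lambda>n. tail_resolvent a b z n w) \<longlonglongrightarrow> stieltjes \<mu> z"
proof -
  define S where "S n = (\<Sum>k<n. (cmod (p k z))\<^sup>2)" for n
  have S_top: "filterlim S at_top sequentially"
  proof -
    have mono: "S m \<le> S n" if "m \<le> n" for m n
      unfolding S_def using that by (intro sum_mono2) auto
    have "\<exists>n. S n > Z" for Z
    proof (rule ccontr)
      assume "\<nexists>n. S n > Z"
      then have "summable (\<lambda>k. (cmod (p k z))\<^sup>2)"
        by (intro summableI_nonneg_bounded[where x = Z]) (auto simp: S_def not_less)
      then show False using p_not_l2[OF z] by simp
    qed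
    then show ?thesis
      unfolding filterlim_at_top eventually_sequentially by (meson less_imp_le mono order.trans)
  qed
  have "(\<lambda>n. (cmod (tail_resolvent a b z n w - stieltjes \<mu> z))\<^sup>2) \<longlonglongrightarrow> 0"
  proof (rule Lim_null_comparison)
    show "\<forall>\<^sub>F n in sequentially. norm ((cmod (tail_resolvent a b z n w - stieltjes \<mu> z))\<^sup>2) \<le> 4 * (1 / Im z)\<^sup>2 / S n"
      using filterlim_at_top_dense[THEN iffD1, OF S_top, rule_format, of 0]
    proof eventually_elim
      case (elim n)
      then show ?case
        using tail_resolvent_close[OF \<mu> z w, of n]
        by (simp add: S_def pos_le_divide_eq norm_minus_commute)
    qed
    show "(\<lambda>n. 4 * (1 / Im z)\<^sup>2 / S n) \<longlonglongrightarrow> 0"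
      by (rule real_tendsto_divide_at_top[OF tendsto_const S_top])
  qed
  then have "(\<lambda>n. cmod (tail_resolvent a b z n w - stieltjes \<mu> z)) \<longlonglongrightarrow> 0"
    using tendsto_real_sqrt[of "\<lambda>n. (cmod (tail_resolvent a b z n w - stieltjes \<mu> z))\<^sup>2" 0 sequentially] by simp
  then have "(\<lambda>n. tail_resolvent a b z n w - stieltjes \<mu> z) \<longlonglongrightarrow> 0"
    by (rule tendsto_norm_zero_cancel)
  then show ?thesis
    by (rule LIM_zero_cancel)
qed

section \<open>Gamma and Gaussian integrals with a complex rate\<close>

text \<open>
  The parameter \<open>q\<close> is 0 for Gamma integrals and 1 for parabolic cylinder functions, so that
  both share their recurrence and derivative.
\<close>

definition weight :: "real \<Rightarrow> real \<Rightarrow> real \<Rightarrow> real" where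
  "weight q s t = (if t > 0 then t powr (s - 1) * exp (- (q * t\<^sup>2 / 2)) else 0)"

definition weight_laplace :: "real \<Rightarrow> real \<Rightarrow> complex \<Rightarrow> complex" where
  "weight_laplace q s c = (\<integral>t. of_real (weight q s t) * exp (- c * of_real t) \<partial>lborel)"

text \<open>
  The rates \<open>r\<close> for which \<open>weight q s t * exp (- r * t)\<close> is integrable at infinity, for
  \<open>q = 0\<close> and \<open>q = 1\<close>.
\<close>

definition admissible_rate :: "real \<Rightarrow> real \<Rightarrow> bool" where
  "admissible_rate q r \<longleftrightarrow> q = 1 \<or> (q = 0 \<and> r > 0)"

lemma weight_measurable [measurable]: "weight q s \<in> borel_measurable borel"
  unfolding weight_def[abs_def] by measurable

lemma weight_nonneg [simp]: "weight q s t \<ge> 0"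
  by (simp add: weight_def)

lemma weight_Suc: "t * weight q s t = weight q (s + 1) t"
proof (cases "t > 0")
  case True
  have "t powr (s + 1 - 1) = t * t powr (s - 1)"
    using True powr_add[of t 1 "s - 1"] by simp
  then show ?thesis using True by (simp add: weight_def)
qed (simp add: weight_def)

lemma integrable_weight_0:
  assumes s: "s > 0" and r: "r > 0"
  shows "integrable lborel (\<lambda>t. weight 0 s t * exp (- r * t))"
proof -
  have "integrable lborel (\<lambda>t. weight 0 s t * exp (- t))"
  proof (rule integrableI_nonneg)
    have "(\<integral>\<^sup>+t. ennreal (weight 0 s t * exp (- t)) \<partial>lborel) =
        (\<integral>\<^sup>+t. ennreal (indicator {0..} t * t powr (s - 1) / exp t) \<partial>lborel)"
      by (intro nn_integral_cong_AE, use AE_lborel_singleton[of 0] in eventually_elim)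
        (auto simp: weight_def indicator_def exp_minus field_simps)
    also have "\<dots> = ennreal (Gamma s)"
      using Gamma_conv_nn_integral_real[OF s] by simp
    finally show "(\<integral>\<^sup>+t. ennreal (weight 0 s t * exp (- t)) \<partial>lborel) < \<infinity>" by simp
  qed auto
  from lborel_integrable_real_affine[OF this, of r 0]
  have "integrable lborel (\<lambda>t. weight 0 s (r * t) * exp (- (r * t)))" using r by simp
  moreover have "weight 0 s (r * t) = r powr (s - 1) * weight 0 s t" for t
    using r by (auto simp: weight_def powr_mult zero_less_mult_iff)
  ultimately have "integrable lborel (\<lambda>t. r powr (s - 1) * (weight 0 s t * exp (- (r * t))))"
    by (simp add: mult.assoc)
  then show ?thesis using r by simp
qed

text \<open>
  For \<open>q = 1\<close>, completing the square bounds the Gaussian by an exponential of any given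
  rate.
\<close>

lemma weight_bound:
  assumes "admissible_rate q r"
  shows "\<exists>C>0. \<exists>\<rho>>0. \<forall>t>0. exp (- (q * t\<^sup>2 / 2)) * exp (- r * t) \<le> C * exp (- \<rho> * t)"
proof (cases "q = 1")
  case True
  have "exp (- (q * t\<^sup>2 / 2)) * exp (- r * t) \<le> exp ((1 - r)\<^sup>2 / 2) * exp (- 1 * t)" for t
  proof -
    have "- (q * t\<^sup>2 / 2) + (- r * t) \<le> (1 - r)\<^sup>2 / 2 + (- 1 * t)"
    proof -
      have "0 \<le> (t - (1 - r))\<^sup>2" by simp
      then show ?thesis unfolding True by (simp add: power2_eq_square field_simps)
    qed
    then show ?thesis by (simp only: mult_exp_exp exp_le_cancel_iff)
  qed
  then show ?thesis by (intro exI[of _ "exp ((1 - r)\<^sup>2 / 2)"] exI[of _ 1] conjI) auto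
next
  case False
  then have "q = 0" "r > 0" using assms by (auto simp: admissible_rate_def)
  then show ?thesis by (intro exI[of _ 1] exI[of _ r] conjI) auto
qed

lemma integrable_weight:
  assumes s: "s > 0" and c: "admissible_rate q r"
  shows "integrable lborel (\<lambda>t. weight q s t * exp (- r * t))"
proof -
  obtain C \<rho> :: real where C: "C > 0" "\<rho> > 0" "\<And>t. t > 0 \<Longrightarrow> exp (- (q * t\<^sup>2 / 2)) * exp (- r * t) \<le> C * exp (- \<rho> * t)"
    using weight_bound[OF c] by blast
  show ?thesis
  proof (rule Bochner_Integration.integrable_bound)
    show "integrable lborel (\<lambda>t. C * (weight 0 s t * exp (- \<rho> * t)))"
      using integrable_weight_0[OF s C(2)] by simp
    show "AE t in lborel. norm (weight q s t * exp (- r * t)) \<le> norm (C * (weight 0 s t * exp (- \<rho> * t)))"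
    proof (intro AE_I2)
      fix t :: real
      have "t powr (s - 1) * (exp (- (q * t\<^sup>2 / 2)) * exp (- r * t)) \<le> t powr (s - 1) * (C * exp (- \<rho> * t))" if "t > 0"
        using C(3)[OF that] by (intro mult_left_mono) auto
      then show "norm (weight q s t * exp (- r * t)) \<le> norm (C * (weight 0 s t * exp (- \<rho> * t)))"
        using C(1) by (auto simp: weight_def abs_mult mult_ac)
    qed
  qed measurable
qed

lemma norm_weight_exp: "norm (of_real (weight q s t) * exp (- c * of_real t)) = weight q s t * exp (- Re c * t)"
  by (simp add: norm_mult)

lemma integrable_weight_complex:
  assumes s: "s > 0" and c: "admissible_rate q (Re c)"
  shows "integrable lborel (\<lambda>t. of_real (weight q s t) * exp (- c * of_real t))"
proof (rule Bochner_Integration.integrable_bound[OF integrable_weight[OF s c]])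
  show "AE t in lborel. norm (of_real (weight q s t) * exp (- c * of_real t)) \<le> norm (weight q s t * exp (- Re c * t))"
    unfolding norm_weight_exp by simp
qed measurable

lemma exp_second_order_bound:
  "cmod (exp (- w) - 1 + w) \<le> exp (cmod w) * (cmod w)\<^sup>2"
proof -
  have "exp (- w) - 1 + w = exp (- w) - (1 - w)" by simp
  then show ?thesis
    using Taylor_exp_field[of "- w" 1] by (simp only: ) (simp add: numeral_2_eq_2)
qed

text \<open>
  Differentiation under the integral sign, from the second-order bound for the exponential.
  The loss of \<open>exp (|h| t)\<close> is absorbed by a margin \<open>\<delta>\<close> in the rate.
\<close>

lemma weight_laplace_has_derivative:
  assumes s: "s > 0" and c: "admissible_rate q (Re c)"
  shows "(weight_laplace q s has_field_derivative - weight_laplace q (s + 1) c) (at c)"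
proof -
  \<comment> \<open>a margin by which the rate may be lowered without losing convergence\<close>
  define \<delta> where "\<delta> = (if q = 1 then 1 else Re c / 2)"
  have \<delta>: "\<delta> > 0" "admissible_rate q (Re c - \<delta>)"
    using c by (auto simp: \<delta>_def admissible_rate_def)
  define B where "B = (\<integral>t. weight q (s + 2) t * exp (- (Re c - \<delta>) * t) \<partial>lborel)"
  have int_B: "integrable lborel (\<lambda>t. weight q (s + 2) t * exp (- (Re c - \<delta>) * t))"
    using s \<delta> by (intro integrable_weight) auto
  have B: "B \<ge> 0" unfolding B_def by (rule integral_nonneg_AE) auto
  have w2: "t\<^sup>2 * weight q s t = weight q (s + 2) t" for t
  proof -
    have "t\<^sup>2 * weight q s t = t * (t * weight q s t)" by (simp add: power2_eq_square)
    also have "\<dots> = weight q (s + 1 + 1) t" by (simp only: weight_Suc)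
    finally show ?thesis by (simp add: add.assoc)
  qed
  have bound: "cmod (weight_laplace q s (c + h) - weight_laplace q s c + h * weight_laplace q (s + 1) c) \<le> (cmod h)\<^sup>2 * B"
    if h: "cmod h \<le> \<delta>" for h
  proof -
    have ch: "admissible_rate q (Re (c + h))"
      using c h abs_Re_le_cmod[of h] \<delta> by (auto simp: admissible_rate_def)
    let ?f = "\<lambda>c t. complex_of_real (weight q s t) * exp (- c * of_real t)"
    have eq: "?f (c + h) t - ?f c t + h * (of_real (weight q (s + 1) t) * exp (- c * of_real t)) =
        ?f c t * (exp (- (h * of_real t)) - 1 + h * of_real t)" for t
      unfolding weight_Suc[symmetric] by (simp add: algebra_simps exp_add exp_diff exp_minus divide_simps)
    have diff: "weight_laplace q s (c + h) - weight_laplace q s c + h * weight_laplace q (s + 1) c =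
       (\<integral>t. ?f (c + h) t - ?f c t + h * (of_real (weight q (s + 1) t) * exp (- c * of_real t)) \<partial>lborel)"
      unfolding weight_laplace_def
      using integrable_weight_complex[OF s ch] integrable_weight_complex[OF s c] integrable_weight_complex[of "s + 1", OF _ c] s
      by (subst Bochner_Integration.integral_add Bochner_Integration.integral_diff; auto)+
    have "cmod (\<integral>t. ?f (c + h) t - ?f c t + h * (of_real (weight q (s + 1) t) * exp (- c * of_real t)) \<partial>lborel)
        \<le> (\<integral>t. (cmod h)\<^sup>2 * (weight q (s + 2) t * exp (- (Re c - \<delta>) * t)) \<partial>lborel)"
    proof (rule integral_norm_le_AE)
      show "AE t in lborel. norm (?f (c + h) t - ?f c t + h * (of_real (weight q (s + 1) t) * exp (- c * of_real t)))
         \<le> (cmod h)\<^sup>2 * (weight q (s + 2) t * exp (- (Re c - \<delta>) * t))"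
      proof (intro AE_I2)
        fix t
        show "norm (?f (c + h) t - ?f c t + h * (of_real (weight q (s + 1) t) * exp (- c * of_real t)))
         \<le> (cmod h)\<^sup>2 * (weight q (s + 2) t * exp (- (Re c - \<delta>) * t))"
        proof (cases "t > 0")
          case True
          have "cmod (exp (- (h * of_real t)) - 1 + h * of_real t) \<le> exp (cmod h * t) * (cmod h * t)\<^sup>2"
            using exp_second_order_bound[of "h * of_real t"] True by (simp add: norm_mult)
          also have "\<dots> \<le> exp (\<delta> * t) * (cmod h * t)\<^sup>2"
            using h True by (intro mult_right_mono) auto
          finally have "norm (?f c t * (exp (- (h * of_real t)) - 1 + h * of_real t)) \<le>
              (weight q s t * exp (- Re c * t)) * (exp (\<delta> * t) * (cmod h * t)\<^sup>2)"
            unfolding norm_mult[of "?f c t"] norm_weight_exp by (intro mult_left_mono) auto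
          also have "\<dots> = (cmod h)\<^sup>2 * (t\<^sup>2 * weight q s t * (exp (- Re c * t) * exp (\<delta> * t)))"
            by (simp add: power_mult_distrib mult_ac)
          also have "exp (- Re c * t) * exp (\<delta> * t) = exp (- (Re c - \<delta>) * t)"
            by (simp add: mult_exp_exp algebra_simps)
          finally show ?thesis unfolding eq w2 .
        qed (simp add: weight_def)
      qed
    qed (use int_B in simp)
    also have "\<dots> = (cmod h)\<^sup>2 * B" unfolding B_def by simp
    finally show ?thesis unfolding diff .
  qed
  show ?thesis
    unfolding DERIV_def
  proof (rule LIM_I)
    fix \<epsilon> :: real assume e: "\<epsilon> > 0"
    \<comment> \<open>\<open>B\<close> may be 0\<close>
    define \<eta> where "\<eta> = min \<delta> (\<epsilon> / (B + 1))"
    have "\<epsilon> / (B + 1) > 0" using e B by (intro divide_pos_pos) auto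
    then have \<eta>: "\<eta> > 0" using \<delta>(1) by (simp add: \<eta>_def)
    show "\<exists>\<eta>>0. \<forall>h. h \<noteq> 0 \<and> norm (h - 0) < \<eta> \<longrightarrow>
       norm ((weight_laplace q s (c + h) - weight_laplace q s c) / h - (- weight_laplace q (s + 1) c)) < \<epsilon>"
    proof (rule exI[of _ \<eta>], rule conjI[OF \<eta>], intro allI impI)
      fix h :: complex assume h: "h \<noteq> 0 \<and> norm (h - 0) < \<eta>"
      have h\<delta>: "cmod h \<le> \<delta>" and h\<epsilon>: "cmod h < \<epsilon> / (B + 1)" using h by (auto simp: \<eta>_def)
      have quot: "(weight_laplace q s (c + h) - weight_laplace q s c) / h - (- weight_laplace q (s + 1) c) =
          (weight_laplace q s (c + h) - weight_laplace q s c + h * weight_laplace q (s + 1) c) / h"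
        using h by (simp add: field_simps)
      have "cmod ((weight_laplace q s (c + h) - weight_laplace q s c + h * weight_laplace q (s + 1) c) / h)
          \<le> (cmod h)\<^sup>2 * B / cmod h"
        unfolding norm_divide by (intro divide_right_mono bound h\<delta>) simp
      also have "\<dots> = cmod h * B" using h by (simp add: power2_eq_square)
      also have "\<dots> \<le> cmod h * (B + 1)" by (intro mult_left_mono) auto
      also have "\<dots> < \<epsilon>" using h\<epsilon> B by (simp add: pos_less_divide_eq)
      finally show "norm ((weight_laplace q s (c + h) - weight_laplace q s c) / h - (- weight_laplace q (s + 1) c)) < \<epsilon>"
        unfolding quot .
    qed
  qed
qed

lemma powr_exp_tendsto_0:
  fixes s \<rho> :: real
  assumes "s > 0" "\<rho> > 0"
  shows "((\<lambda>t. t powr s * exp (- \<rho> * t)) \<longlongrightarrow> 0) at_top" "((\<lambda>t. t powr s) \<longlongrightarrow> 0) (at_right 0)"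
  using assms by real_asymp+

text \<open>Integration by parts of \<open>t\<^sup>s exp (- c t - q t\<^sup>2 / 2)\<close>.\<close>

lemma weight_laplace_recurrence:
  assumes s: "s > 0" and c: "admissible_rate q (Re c)"
  shows "of_real s * weight_laplace q s c = c * weight_laplace q (s + 1) c + of_real q * weight_laplace q (s + 2) c"
proof -
  define F where "F t = complex_of_real (t powr s) * exp (- of_real (q * t\<^sup>2 / 2) - c * of_real t)" for t
  define f where "f t = of_real s * (of_real (weight q s t) * exp (- c * of_real t)) -
     c * (of_real (weight q (s + 1) t) * exp (- c * of_real t)) -
     of_real q * (of_real (weight q (s + 2) t) * exp (- c * of_real t))" for t
  have int: "integrable lborel f"
    unfolding f_def using s c by (intro Bochner_Integration.integrable_diff integrable_mult_right integrable_weight_complex) auto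
  have f_zero: "f t = 0" if "t \<le> 0" for t using that by (simp add: f_def weight_def)
  have f_pos: "f t = (of_real s * of_real (t powr (s - 1)) - c * of_real (t powr s) - of_real q * of_real (t powr (s + 1))) *
      exp (- of_real (q * t\<^sup>2 / 2) - c * of_real t)" if "t > 0" for t
  proof -
    have E: "complex_of_real (exp (- (q * t\<^sup>2 / 2))) * exp (- c * of_real t) = exp (- of_real (q * t\<^sup>2 / 2) - c * of_real t)"
      by (simp only: exp_of_real[symmetric] mult_exp_exp of_real_minus) simp
    have w: "of_real (weight q s' t) * exp (- c * of_real t) =
        of_real (t powr (s' - 1)) * exp (- of_real (q * t\<^sup>2 / 2) - c * of_real t)" for s'
      using that by (simp only: weight_def if_True of_real_mult mult.assoc E)
    show ?thesis
      unfolding f_def w by (simp add: left_diff_distrib mult.assoc add.commute)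
  qed
  have F_norm: "cmod (F t) = t powr s * (exp (- (q * t\<^sup>2 / 2)) * exp (- Re c * t))" for t
    by (simp add: F_def norm_mult mult_exp_exp)
  have "(LBINT t=0..\<infinity>. f t) = 0 - 0"
  proof (rule interval_integral_FTC_integrable)
    fix t :: real assume "0 < ereal t"
    then have t: "t > 0" by simp
    have "((\<lambda>t. t powr s) has_real_derivative s * t powr (s - 1)) (at t)"
      using t by (auto intro!: derivative_eq_intros)
    then have 1: "((\<lambda>t. complex_of_real (t powr s)) has_vector_derivative of_real (s * t powr (s - 1))) (at t)"
      by (intro has_vector_derivative_of_real) (simp add: has_real_derivative_iff_has_vector_derivative)
    have "((\<lambda>t. exp (- of_real (q * t\<^sup>2 / 2) - c * of_real t)) has_vector_derivative
        (- of_real (q * t) - c) * exp (- of_real (q * t\<^sup>2 / 2) - c * of_real t)) (at t)"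
    proof -
      have "((\<lambda>w. exp (- (of_real q * w\<^sup>2 / 2) - c * w)) has_field_derivative
        (- (of_real q * of_real t) - c) * exp (- (of_real q * (of_real t)\<^sup>2 / 2) - c * of_real t)) (at (of_real t))"
        by (auto intro!: derivative_eq_intros simp: field_simps)
      from has_vector_derivative_real_field[OF this] show ?thesis
        by simp
    qed
    from has_vector_derivative_mult[OF 1 this]
    have "(F has_vector_derivative (of_real (t powr s) * ((- of_real (q * t) - c) * exp (- of_real (q * t\<^sup>2 / 2) - c * of_real t)) +
       of_real (s * t powr (s - 1)) * exp (- of_real (q * t\<^sup>2 / 2) - c * of_real t))) (at t)"
      unfolding F_def[abs_def] .
    moreover have "t powr (s + 1) = t powr s * t" using t by (simp add: powr_add)
    ultimately show "(F has_vector_derivative f t) (at t)"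
      unfolding f_pos[OF t] by (simp add: algebra_simps)
  next
    fix t :: real assume "0 < ereal t"
    then have t: "t > 0" by simp
    have cont: "isCont (\<lambda>t. (of_real s * of_real (t powr (s - 1)) - c * of_real (t powr s) - of_real q * of_real (t powr (s + 1))) *
      exp (- of_real (q * t\<^sup>2 / 2) - c * of_real t)) t"
      using t by (intro continuous_intros) auto
    have ev: "\<forall>\<^sub>F t in nhds t. f t = (of_real s * of_real (t powr (s - 1)) - c * of_real (t powr s) - of_real q * of_real (t powr (s + 1))) *
      exp (- of_real (q * t\<^sup>2 / 2) - c * of_real t)"
      using eventually_nhds_in_open[of "{0<..}" t] t by (auto elim!: eventually_mono simp: f_pos)
    show "isCont f t"
      using cont unfolding isCont_cong[OF ev] .
  next
    show "set_integrable lborel (einterval 0 \<infinity>) f"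
      unfolding set_integrable_def by (rule integrable_mult_indicator) (use int in auto)
    obtain C \<rho> :: real where C: "C > 0" "\<rho> > 0" "\<And>t. t > 0 \<Longrightarrow> exp (- (q * t\<^sup>2 / 2)) * exp (- Re c * t) \<le> C * exp (- \<rho> * t)"
      using weight_bound[OF c] by blast
    have F_le: "cmod (F t) \<le> C * (t powr s * exp (- \<rho> * t))" if "t > 0" for t
      unfolding F_norm using mult_left_mono[OF C(3)[OF that], of "t powr s"] by (simp add: mult_ac)
    have "(F \<longlongrightarrow> 0) at_top"
    proof (rule Lim_null_comparison)
      show "\<forall>\<^sub>F t in at_top. norm (F t) \<le> C * (t powr s * exp (- \<rho> * t))"
        using eventually_gt_at_top[of 0] by eventually_elim (rule F_le)
      show "((\<lambda>t. C * (t powr s * exp (- \<rho> * t))) \<longlongrightarrow> 0) at_top"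
        by (rule tendsto_mult_right_zero[OF powr_exp_tendsto_0(1)[OF s C(2)]])
    qed
    then show "((F \<circ> real_of_ereal) \<longlongrightarrow> 0) (at_left \<infinity>)"
      by (simp add: ereal_tendsto_simps)
    have "(F \<longlongrightarrow> 0) (at_right 0)"
    proof (rule Lim_null_comparison)
      show "\<forall>\<^sub>F t in at_right 0. norm (F t) \<le> C * (t powr s)"
      proof -
        have "\<forall>\<^sub>F t in at_right 0. t > (0::real)" by (simp add: eventually_at_right_less)
        then show ?thesis
        proof eventually_elim
          case (elim t)
          have "C * (t powr s * exp (- \<rho> * t)) \<le> C * (t powr s * 1)"
            using elim C by (intro mult_left_mono) auto
          then show ?case using F_le[OF elim] by simp
        qed
      qed
      show "((\<lambda>t. C * (t powr s)) \<longlongrightarrow> 0) (at_right 0)"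
        by (rule tendsto_mult_right_zero[OF powr_exp_tendsto_0(2)[OF s C(2)]])
    qed
    then show "((F \<circ> real_of_ereal) \<longlongrightarrow> 0) (at_right 0)"
      by (simp add: zero_ereal_def ereal_tendsto_simps)
  qed simp
  then have "(LINT t:{0<..}|lborel. f t) = 0"
    by (simp add: interval_lebesgue_integral_0_infty)
  moreover have "(LINT t:{0<..}|lborel. f t) = (\<integral>t. f t \<partial>lborel)"
    unfolding set_lebesgue_integral_def
    by (rule Bochner_Integration.integral_cong) (auto simp: indicator_def f_zero)
  ultimately have "(\<integral>t. f t \<partial>lborel) = 0" by simp
  moreover have "(\<integral>t. f t \<partial>lborel) = of_real s * weight_laplace q s c - c * weight_laplace q (s + 1) c - of_real q * weight_laplace q (s + 2) c"
    unfolding f_def weight_laplace_def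
    using integrable_weight_complex[of s, OF s c] integrable_weight_complex[of "s + 1", OF _ c] integrable_weight_complex[of "s + 2", OF _ c] s
    by (subst Bochner_Integration.integral_diff; auto)+
  ultimately show ?thesis by (simp add: algebra_simps)
qed

text \<open>
  For \<open>q = 0\<close> the derivative and the recurrence combine to \<open>F' = - (s / c) F\<close>, so \<open>F(c) c\<^sup>s\<close>
  is constant on the right half-plane. This replaces a rotation of the contour of the Gamma
  integral.
\<close>

lemma weight_laplace_gamma:
  assumes s: "s > 0" and c: "Re c > 0"
  shows "weight_laplace 0 s c = of_real (Gamma s) * c powr (- of_real s)"
proof -
  define S where "S = {c. Re c > 0}"
  have conv: "admissible_rate 0 (Re c)" if "c \<in> S" for c using that by (simp add: admissible_rate_def S_def)
  have "\<exists>k. \<forall>c\<in>S. weight_laplace 0 s c * c powr (of_real s) = k"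
  proof (rule has_field_derivative_zero_constant)
    show "convex S" unfolding S_def by (rule convex_halfspace_Re_gt)
    fix c assume cS: "c \<in> S"
    then have c0: "c \<notin> \<real>\<^sub>\<le>\<^sub>0" "c \<noteq> 0" by (auto simp: S_def complex_nonpos_Reals_iff)
    have "((\<lambda>c. weight_laplace 0 s c * c powr (of_real s)) has_field_derivative
       (- weight_laplace 0 (s + 1) c) * c powr (of_real s) + (of_real s * c powr (of_real s - 1)) * weight_laplace 0 s c) (at c)"
      by (intro DERIV_mult weight_laplace_has_derivative[OF s conv[OF cS]] has_field_derivative_powr c0)
    moreover have "c powr (of_real s) = c * c powr (of_real s - 1)"
      using c0 by (simp add: powr_diff)
    then have "(- weight_laplace 0 (s + 1) c) * c powr (of_real s) + (of_real s * c powr (of_real s - 1)) * weight_laplace 0 s c = 0"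
      using weight_laplace_recurrence[OF s conv[OF cS]] by (simp add: algebra_simps)
    ultimately show "((\<lambda>c. weight_laplace 0 s c * c powr (of_real s)) has_field_derivative 0) (at c within S)"
      by (simp add: has_field_derivative_at_within)
  qed
  then obtain k where k: "\<And>c. c \<in> S \<Longrightarrow> weight_laplace 0 s c * c powr (of_real s) = k" by blast
  have "k = weight_laplace 0 s 1"
    using k[of 1] by (simp add: S_def)
  also have "\<dots> = of_real (\<integral>t. weight 0 s t * exp (- t) \<partial>lborel)"
  proof -
    have "complex_of_real (weight 0 s t) * exp (- 1 * of_real t) = of_real (weight 0 s t * exp (- t))" for t
      by (simp add: exp_of_real[symmetric])
    then show ?thesis
      unfolding weight_laplace_def by (simp only: integral_complex_of_real)
  qed
  also have "(\<integral>t. weight 0 s t * exp (- t) \<partial>lborel) = Gamma s"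
  proof -
    have "(\<integral>\<^sup>+t. ennreal (weight 0 s t * exp (- t)) \<partial>lborel) =
        (\<integral>\<^sup>+t. ennreal (indicator {0..} t * t powr (s - 1) / exp t) \<partial>lborel)"
      by (intro nn_integral_cong_AE, use AE_lborel_singleton[of 0] in eventually_elim)
        (auto simp: weight_def indicator_def exp_minus field_simps)
    also have "\<dots> = ennreal (Gamma s)"
      using Gamma_conv_nn_integral_real[OF s] by simp
    finally show ?thesis
      using s by (subst integral_eq_nn_integral) (auto simp: Gamma_real_nonneg)
  qed
  finally have k_val: "k = of_real (Gamma s)" .
  have "c \<noteq> 0" using c by auto
  then show ?thesis
    using k[of c] c by (simp add: S_def k_val powr_minus field_simps)
qed

section \<open>Parabolic cylinder functions\<close>

text \<open>The parabolic cylinder function \<open>D\<^sub>-\<^sub>s (- i z)\<close> times \<open>\<Gamma>(s) exp (- z\<^sup>2 / 4)\<close>.\<close>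

definition cyl :: "real \<Rightarrow> complex \<Rightarrow> complex" where
  "cyl s z = weight_laplace 1 s (- (\<i> * z))"

lemma cyl_recurrence:
  assumes "s > 0"
  shows "cyl (s + 2) z = of_real s * cyl s z + \<i> * z * cyl (s + 1) z"
  using weight_laplace_recurrence[OF assms, of 1 "- (\<i> * z)"]
  by (simp add: cyl_def admissible_rate_def algebra_simps)

lemma cyl_has_derivative:
  assumes "s > 0"
  shows "(cyl s has_field_derivative \<i> * cyl (s + 1) z) (at z within A)"
proof -
  have "((\<lambda>z. - (\<i> * z)) has_field_derivative - \<i>) (at z within A)"
    by (auto intro!: derivative_eq_intros)
  moreover have "(weight_laplace 1 s has_field_derivative - weight_laplace 1 (s + 1) (- (\<i> * z))) (at (- (\<i> * z)))"
    using assms by (intro weight_laplace_has_derivative) (auto simp: admissible_rate_def)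
  ultimately have "((weight_laplace 1 s \<circ> (\<lambda>z. - (\<i> * z))) has_field_derivative
     - weight_laplace 1 (s + 1) (- (\<i> * z)) * - \<i>) (at z within A)"
    by (rule DERIV_chain[rotated])
  then show ?thesis by (simp add: cyl_def[abs_def] comp_def mult.commute)
qed

lemma continuous_on_cyl: "s > 0 \<Longrightarrow> continuous_on A (cyl s)"
  by (meson DERIV_continuous_on cyl_has_derivative)

lemma norm_cyl_le:
  "cmod (cyl s z) \<le> (\<integral>t. weight 1 s t * exp (- Im z * t) \<partial>lborel)" if "s > 0"
  unfolding cyl_def weight_laplace_def
proof (rule integral_norm_le_AE)
  show "integrable lborel (\<lambda>t. weight 1 s t * exp (- Im z * t))"
    using that by (intro integrable_weight) (auto simp: admissible_rate_def)
  show "AE t in lborel. norm (of_real (weight 1 s t) * exp (- (- (\<i> * z)) * of_real t)) \<le> weight 1 s t * exp (- Im z * t)"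
    by (intro AE_I2) (simp add: norm_mult)
qed

text \<open>The substitution \<open>u = t\<^sup>2 / 2\<close> in the Gamma integral.\<close>

lemma cyl_0:
  assumes "s > 0"
  shows "cyl s 0 = of_real (2 powr (s / 2 - 1) * Gamma (s / 2))"
proof -
  define f where "f u = weight 0 (s / 2) u * exp (- u)" for u
  have scale: "f (t\<^sup>2 / 2) * t = 2 powr (1 - s / 2) * weight 1 s t" if "t > 0" for t
  proof -
    have "(t\<^sup>2 / 2) powr (s / 2 - 1) * t = 2 powr (1 - s / 2) * t powr (s - 1)"
    proof -
      have "(t\<^sup>2 / 2) powr (s / 2 - 1) = (t powr 2) powr (s / 2 - 1) * (1 / 2) powr (s / 2 - 1)"
        using that by (simp flip: powr_mult)
      also have "(t powr 2) powr (s / 2 - 1) = t powr (s - 2)"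
        by (simp add: powr_powr algebra_simps)
      also have "(1 / 2) powr (s / 2 - 1) = (2::real) powr (1 - s / 2)"
        by (simp add: powr_divide powr_minus_divide[symmetric])
      also have "t powr (s - 2) * 2 powr (1 - s / 2) * t = 2 powr (1 - s / 2) * (t powr (s - 2) * t powr 1)"
        using that by simp
      also have "t powr (s - 2) * t powr 1 = t powr (s - 1)"
        by (simp only: powr_add[symmetric]) simp
      finally show ?thesis .
    qed
    then show ?thesis
      using that by (simp add: f_def weight_def mult_ac)
  qed
  have int: "integrable lborel (\<lambda>t. weight 1 s t)"
    using integrable_weight[OF assms, of 1 0] by (simp add: admissible_rate_def)
  have set_int: "set_integrable lborel (einterval 0 \<infinity>) (\<lambda>t. 2 powr (1 - s / 2) * weight 1 s t)"
    unfolding set_integrable_def by (rule integrable_mult_indicator) (use int in auto)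
  have "(LBINT u=0..\<infinity>. f u) = (LBINT t=0..\<infinity>. f (t\<^sup>2 / 2) * t)"
  proof (rule interval_integral_substitution_nonneg(2))
    show "set_integrable lborel (einterval 0 \<infinity>) (\<lambda>t. f (t\<^sup>2 / 2) * t)"
      by (rule set_integrable_cong[THEN iffD1, OF refl refl _ set_int]) (auto simp: einterval_def scale)
    fix t :: real assume t: "0 < ereal t"
    show "DERIV (\<lambda>t. t\<^sup>2 / 2) t :> t"
      by (auto intro!: derivative_eq_intros)
    have "isCont (\<lambda>u. u powr (s / 2 - 1) * exp (- u)) (t\<^sup>2 / 2)"
      using t by (intro continuous_intros) auto
    moreover have ev: "\<forall>\<^sub>F u in nhds (t\<^sup>2 / 2). f u = u powr (s / 2 - 1) * exp (- u)"
      using eventually_nhds_in_open[of "{0<..}" "t\<^sup>2 / 2"] t by (auto elim!: eventually_mono simp: f_def weight_def)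
    ultimately show "isCont f (t\<^sup>2 / 2)"
      unfolding isCont_cong[OF ev] by simp
    show "0 \<le> f (t\<^sup>2 / 2)" by (simp add: f_def)
  next
    have "((\<lambda>t::real. t\<^sup>2 / 2) \<longlongrightarrow> 0) (at_right 0)" by real_asymp
    then show "((ereal \<circ> (\<lambda>t. t\<^sup>2 / 2) \<circ> real_of_ereal) \<longlongrightarrow> 0) (at_right 0)"
      by (simp add: zero_ereal_def ereal_tendsto_simps)
    have "filterlim (\<lambda>t::real. t\<^sup>2 / 2) at_top at_top" by real_asymp
    then show "((ereal \<circ> (\<lambda>t. t\<^sup>2 / 2) \<circ> real_of_ereal) \<longlongrightarrow> \<infinity>) (at_left \<infinity>)"
      by (simp add: ereal_tendsto_simps)
  qed auto
  also have "\<dots> = (LBINT t=0..\<infinity>. 2 powr (1 - s / 2) * weight 1 s t)"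
    by (intro interval_integral_cong) (auto simp: einterval_def scale)
  finally have eq: "(LINT u:{0<..}|lborel. f u) = (LINT t:{0<..}|lborel. 2 powr (1 - s / 2) * weight 1 s t)"
    by (simp only: interval_lebesgue_integral_0_infty)
  have on_pos: "(LINT t:{0<..}|lborel. g t) = (\<integral>t. g t \<partial>lborel)" if "\<And>t. t \<le> 0 \<Longrightarrow> g t = 0" for g :: "real \<Rightarrow> real"
    unfolding set_lebesgue_integral_def
    by (rule Bochner_Integration.integral_cong) (use that in \<open>auto simp: indicator_def not_less\<close>)
  have "(\<integral>u. f u \<partial>lborel) = 2 powr (1 - s / 2) * (\<integral>t. weight 1 s t \<partial>lborel)"
    using eq by (simp add: on_pos f_def weight_def)
  moreover have "(\<integral>u. f u \<partial>lborel) = Gamma (s / 2)"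
  proof -
    have "complex_of_real (\<integral>u. f u \<partial>lborel) = weight_laplace 0 (s / 2) 1"
    proof -
      have "complex_of_real (weight 0 (s / 2) t) * exp (- 1 * of_real t) = of_real (f t)" for t
        by (simp add: f_def exp_of_real[symmetric])
      then show ?thesis unfolding weight_laplace_def by (simp only: integral_complex_of_real)
    qed
    also have "\<dots> = of_real (Gamma (s / 2))"
      using assms by (subst weight_laplace_gamma) auto
    finally show ?thesis by (simp only: of_real_eq_iff)
  qed
  ultimately have "(\<integral>t. weight 1 s t \<partial>lborel) = Gamma (s / 2) / 2 powr (1 - s / 2)"
    by simp
  also have "\<dots> = 2 powr (s / 2 - 1) * Gamma (s / 2)"
    using powr_minus_divide[of 2 "1 - s / 2"] by simp
  finally show ?thesis
    by (simp add: cyl_def weight_laplace_def)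
qed

lemma Gamma_duplication_real:
  fixes x :: real
  assumes "x > 0"
  shows "Gamma x * Gamma (x + 1 / 2) = 2 powr (1 - 2 * x) * sqrt pi * Gamma (2 * x)"
proof -
  have "complex_of_real x \<notin> \<int>\<^sub>\<le>\<^sub>0" "complex_of_real x + 1 / 2 \<notin> \<int>\<^sub>\<le>\<^sub>0"
    using assms by (auto elim!: nonpos_Ints_cases simp: complex_eq_iff)
  from Gamma_legendre_duplication[OF this]
  have "Gamma (complex_of_real x) * Gamma (complex_of_real (x + 1 / 2)) =
      exp (complex_of_real ((1 - 2 * x) * ln 2)) * of_real (sqrt pi) * Gamma (complex_of_real (2 * x))"
    by simp
  moreover have "complex_of_real (Gamma x * Gamma (x + 1 / 2)) = Gamma (complex_of_real x) * Gamma (complex_of_real (x + 1 / 2))"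
    by (simp only: of_real_mult Gamma_complex_of_real)
  moreover have "exp (complex_of_real ((1 - 2 * x) * ln 2)) * of_real (sqrt pi) * Gamma (complex_of_real (2 * x)) =
      of_real (exp ((1 - 2 * x) * ln 2) * sqrt pi * Gamma (2 * x))"
    unfolding Gamma_complex_of_real exp_of_real by (simp only: of_real_mult)
  ultimately have "complex_of_real (Gamma x * Gamma (x + 1 / 2)) = of_real (exp ((1 - 2 * x) * ln 2) * sqrt pi * Gamma (2 * x))"
    by (simp only: )
  then show ?thesis
    by (simp only: of_real_eq_iff powr_def) simp
qed

text \<open>
  With \<open>g = cyl \<alpha>\<close> and \<open>h = cyl (\<alpha> + 1)\<close> the derivative formula and the recurrence give
  \<open>g' = i h\<close> and \<open>h' = i (\<alpha> g + i x h)\<close>. In the derivative of \<open>Re (h * cnj g)\<close> the squares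
  cancel, leaving \<open>- x\<close> times the function.
\<close>

lemma cyl_wronskian:
  assumes \<alpha>: "\<alpha> > 0"
  shows "Re (cyl (\<alpha> + 1) (of_real x) * cnj (cyl \<alpha> (of_real x))) = Gamma \<alpha> * sqrt (pi / 2) * exp (- (x\<^sup>2 / 2))"
proof -
  define g where "g x = cyl \<alpha> (of_real x)" for x :: real
  define h where "h x = cyl (\<alpha> + 1) (of_real x)" for x :: real
  have dg: "(g has_vector_derivative \<i> * h x) (at x)" for x
    unfolding g_def h_def using \<alpha> by (intro has_vector_derivative_real_field cyl_has_derivative)
  have dh: "(h has_vector_derivative \<i> * (of_real \<alpha> * g x + \<i> * of_real x * h x)) (at x)" for x
  proof -
    have "(h has_vector_derivative \<i> * cyl (\<alpha> + 1 + 1) (of_real x)) (at x)"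
      unfolding h_def using \<alpha> by (intro has_vector_derivative_real_field cyl_has_derivative) auto
    moreover have "cyl (\<alpha> + 1 + 1) (of_real x) = of_real \<alpha> * g x + \<i> * of_real x * h x"
      using cyl_recurrence[OF \<alpha>, of "of_real x"] by (simp add: g_def h_def add.assoc)
    ultimately show ?thesis by simp
  qed
  define w where "w x = Re (h x) * Re (g x) + Im (h x) * Im (g x)" for x
  have dw: "(w has_real_derivative - x * w x) (at x)" for x
  proof -
    note re = bounded_linear.has_vector_derivative[OF bounded_linear_Re]
      and im = bounded_linear.has_vector_derivative[OF bounded_linear_Im]
    have d: "((\<lambda>x. Re (g x)) has_real_derivative Re (\<i> * h x)) (at x)"
      "((\<lambda>x. Im (g x)) has_real_derivative Im (\<i> * h x)) (at x)"
      "((\<lambda>x. Re (h x)) has_real_derivative Re (\<i> * (of_real \<alpha> * g x + \<i> * of_real x * h x))) (at x)"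
      "((\<lambda>x. Im (h x)) has_real_derivative Im (\<i> * (of_real \<alpha> * g x + \<i> * of_real x * h x))) (at x)"
      unfolding has_real_derivative_iff_has_vector_derivative
      by (rule re[OF dg] im[OF dg] re[OF dh] im[OF dh])+
    show ?thesis
      unfolding w_def
      by (rule DERIV_cong[OF DERIV_add[OF DERIV_mult[OF d(3) d(1)] DERIV_mult[OF d(4) d(2)]]])
        (simp add: algebra_simps)
  qed
  have "w x * exp (x\<^sup>2 / 2) = w 0 * exp (0\<^sup>2 / 2)"
  proof (rule DERIV_isconst_all[of "\<lambda>x. w x * exp (x\<^sup>2 / 2)"])
    show "\<forall>x. ((\<lambda>x. w x * exp (x\<^sup>2 / 2)) has_real_derivative 0) (at x)"
      by (auto intro!: derivative_eq_intros dw)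
  qed
  moreover have "w 0 = Gamma \<alpha> * sqrt (pi / 2)"
  proof -
    have "w 0 = 2 powr ((\<alpha> + 1) / 2 - 1) * Gamma ((\<alpha> + 1) / 2) * (2 powr (\<alpha> / 2 - 1) * Gamma (\<alpha> / 2))"
      using cyl_0[OF \<alpha>] cyl_0[of "\<alpha> + 1"] \<alpha> by (simp add: w_def g_def h_def)
    also have "\<dots> = (2 powr ((\<alpha> + 1) / 2 - 1) * 2 powr (\<alpha> / 2 - 1)) * (Gamma (\<alpha> / 2) * Gamma (\<alpha> / 2 + 1 / 2))"
      by (simp add: add_divide_distrib mult_ac)
    also have "Gamma (\<alpha> / 2) * Gamma (\<alpha> / 2 + 1 / 2) = 2 powr (1 - \<alpha>) * sqrt pi * Gamma \<alpha>"
      using Gamma_duplication_real[of "\<alpha> / 2"] \<alpha> by simp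
    also have "2 powr ((\<alpha> + 1) / 2 - 1) * 2 powr (\<alpha> / 2 - 1) * (2 powr (1 - \<alpha>) * sqrt pi * Gamma \<alpha>) =
        (2 powr ((\<alpha> + 1) / 2 - 1) * 2 powr (\<alpha> / 2 - 1) * 2 powr (1 - \<alpha>)) * sqrt pi * Gamma \<alpha>"
      by simp
    also have "2 powr ((\<alpha> + 1) / 2 - 1) * 2 powr (\<alpha> / 2 - 1) * 2 powr (1 - \<alpha>) = (2::real) powr (- (1 / 2))"
      by (simp add: powr_add[symmetric] field_simps)
    also have "\<dots> = 1 / sqrt 2"
      by (simp add: powr_minus_divide powr_half_sqrt)
    finally show ?thesis by (simp add: real_sqrt_divide)
  qed
  ultimately have "w x * exp (x\<^sup>2 / 2) = Gamma \<alpha> * sqrt (pi / 2)" by simp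
  then have "w x = Gamma \<alpha> * sqrt (pi / 2) * exp (- (x\<^sup>2 / 2))"
    by (simp add: exp_minus field_simps)
  then show ?thesis by (simp add: w_def g_def h_def)
qed

lemma cyl_nonzero_real:
  assumes "\<alpha> > 0"
  shows "cyl \<alpha> (of_real x) \<noteq> 0"
proof
  assume "cyl \<alpha> (of_real x) = 0"
  then show False
    using cyl_wronskian[OF assms, of x] Gamma_real_pos[OF assms] by simp
qed

section \<open>The spectral measure of the deterministic matrix\<close>

definition hermite_b :: "real \<Rightarrow> nat \<Rightarrow> real" where
  "hermite_b \<alpha> j = sqrt (\<alpha> + real (Suc j))"

text \<open>Comparison with the harmonic series.\<close>

lemma hermite_limit_point:
  assumes \<alpha>: "\<alpha> > 0"
  shows "jacobi_limit_point (hermite_b \<alpha>)"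
proof
  show "hermite_b \<alpha> n > 0" for n using \<alpha> by (simp add: hermite_b_def)
  show "\<not> summable (\<lambda>n. 1 / hermite_b \<alpha> n)"
  proof
    assume *: "summable (\<lambda>n. 1 / hermite_b \<alpha> n)"
    have "summable (\<lambda>n. 1 / (\<alpha> + 1) * inverse (real (Suc n)))"
    proof (rule summable_comparison_test'[OF *, of 0])
      fix n
      have "hermite_b \<alpha> n \<le> sqrt ((\<alpha> + real (Suc n))\<^sup>2)"
        unfolding hermite_b_def using \<alpha> by (intro real_sqrt_le_mono self_le_power) auto
      also have "\<dots> = \<alpha> + real (Suc n)" using \<alpha> by simp
      also have "\<dots> \<le> (\<alpha> + 1) * real (Suc n)" using \<alpha> by (simp add: algebra_simps)
      finally have "1 / ((\<alpha> + 1) * real (Suc n)) \<le> 1 / hermite_b \<alpha> n"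
        using \<alpha> by (intro frac_le) (auto simp: hermite_b_def)
      then show "norm (1 / (\<alpha> + 1) * inverse (real (Suc n))) \<le> 1 / hermite_b \<alpha> n"
        using \<alpha> by (simp add: divide_inverse mult.commute)
    qed
    then have "summable (\<lambda>n. inverse (real (Suc n)))"
      using \<alpha> by (subst (asm) summable_cmult_iff) auto
    then have "summable (\<lambda>n. inverse (real n))"
      by (subst (asm) summable_Suc_iff)
    then show False using not_summable_harmonic[where 'a = real] by simp
  qed
qed

text \<open>
  Cauchy-Schwarz for the factorization \<open>t\<^sup>\<alpha>\<^sup>+\<^sup>k = t\<^sup>k\<^sup>-\<^sup>3\<^sup>/\<^sup>2 t\<^sup>\<alpha>\<^sup>+\<^sup>3\<^sup>/\<^sup>2\<close> with \<open>k = m + 2\<close>.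
  The first factor carries the Gaussian and gives an odd Gaussian moment, the second carries
  the exponential decay. The exponents are shifted so that dividing by \<open>k!\<close> leaves a
  summable bound.
\<close>

lemma cyl_sq_bound:
  assumes \<alpha>: "\<alpha> > 0" and z: "Im z > 0"
  shows "\<exists>C. \<forall>m. (cmod (cyl (\<alpha> + 1 + real (m + 2)) z))\<^sup>2 \<le> C * fact m"
proof -
  define y where "y = Im z"
  have y: "y > 0" using z by (simp add: y_def)
  define C where "C = (\<integral>t. weight 0 (2 * \<alpha> + 4) t * exp (- (2 * y) * t) \<partial>lborel)"
  have int_C: "integrable lborel (\<lambda>t. weight 0 (2 * \<alpha> + 4) t * exp (- (2 * y) * t))"
    using \<alpha> y by (intro integrable_weight_0) auto
  have C0: "C \<ge> 0" unfolding C_def by (rule integral_nonneg_AE) auto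
  have "(cmod (cyl (\<alpha> + 1 + real (m + 2)) z))\<^sup>2 \<le> (C / 2) * fact m" for m
  proof -
    define k where "k = real (m + 2)"
    define I where "I = (\<integral>t. weight 1 (\<alpha> + 1 + k) t * exp (- y * t) \<partial>lborel)"
    have int_I: "integrable lborel (\<lambda>t. weight 1 (\<alpha> + 1 + k) t * exp (- y * t))"
      using \<alpha> by (intro integrable_weight) (auto simp: k_def admissible_rate_def)
    have I0: "I \<ge> 0" unfolding I_def by (rule integral_nonneg_AE) auto
    define f where "f t = weight 1 (k - 1 / 2) t" for t
    define g where "g t = weight 0 (\<alpha> + 5 / 2) t * exp (- y * t)" for t
    have fg: "f t * g t = weight 1 (\<alpha> + 1 + k) t * exp (- y * t)" for t
    proof (cases "t > 0")
      case True
      have "t powr (k - 1 / 2 - 1) * t powr (\<alpha> + 5 / 2 - 1) = t powr (\<alpha> + 1 + k - 1)"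
        by (simp flip: powr_add add: algebra_simps)
      then show ?thesis using True by (simp add: f_def g_def weight_def mult_ac)
    qed (simp add: f_def weight_def)
    have f2: "(f t)\<^sup>2 = indicator {0..} t *\<^sub>R (exp (- t\<^sup>2) * t ^ (2 * m + 1))" for t
    proof (cases "t > 0")
      case True
      have "(t powr (k - 1 / 2 - 1))\<^sup>2 = t powr (real (2 * m + 1))"
        using True by (simp add: power2_eq_square k_def flip: powr_add)
      also have "\<dots> = t ^ (2 * m + 1)" using True by (rule powr_realpow)
      finally have "(t powr (k - 1 / 2 - 1))\<^sup>2 = t ^ (2 * m + 1)" .
      moreover have "(exp (- (t\<^sup>2 / 2)))\<^sup>2 = exp (- t\<^sup>2)"
        by (simp add: power2_eq_square mult_exp_exp)
      ultimately show ?thesis using True by (simp add: f_def weight_def power_mult_distrib)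
    next
      case False
      then show ?thesis by (cases "t = 0") (auto simp: f_def weight_def)
    qed
    have g2: "(g t)\<^sup>2 = weight 0 (2 * \<alpha> + 4) t * exp (- (2 * y) * t)" for t
    proof (cases "t > 0")
      case True
      have "(t powr (\<alpha> + 5 / 2 - 1))\<^sup>2 = t powr (2 * \<alpha> + 4 - 1)"
        by (simp add: power2_eq_square flip: powr_add)
      moreover have "(exp (- y * t))\<^sup>2 = exp (- (2 * y) * t)"
        by (simp add: power2_eq_square mult_exp_exp)
      ultimately show ?thesis using True by (simp add: g_def weight_def power_mult_distrib)
    qed (simp add: g_def weight_def)
    have [measurable]: "f \<in> borel_measurable borel" "g \<in> borel_measurable borel"
      unfolding f_def[abs_def] g_def[abs_def] by measurable
    have nonneg: "f t \<ge> 0" "g t \<ge> 0" for t by (simp_all add: f_def g_def)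
    have "ennreal I = (\<integral>\<^sup>+t. ennreal (f t * g t) \<partial>lborel)"
      unfolding I_def fg by (rule nn_integral_eq_integral[symmetric, OF int_I]) simp
    also have "\<dots> = (\<integral>\<^sup>+t. ennreal (f t) * ennreal (g t) \<partial>lborel)"
      using nonneg by (simp add: ennreal_mult)
    finally have "(ennreal I)\<^sup>2 \<le> (\<integral>\<^sup>+t. (ennreal (f t))\<^sup>2 \<partial>lborel) * (\<integral>\<^sup>+t. (ennreal (g t))\<^sup>2 \<partial>lborel)"
      by (simp add: Cauchy_Schwarz_nn_integral)
    also have "(\<integral>\<^sup>+t. (ennreal (f t))\<^sup>2 \<partial>lborel) = ennreal (fact m / 2)"
    proof -
      have "has_bochner_integral lborel (\<lambda>t. (f t)\<^sup>2) (fact m / 2)"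
        unfolding f2 by (rule gaussian_moment_odd_pos)
      then have "(\<integral>\<^sup>+t. ennreal ((f t)\<^sup>2) \<partial>lborel) = ennreal (fact m / 2)"
        by (auto simp: has_bochner_integral_iff nn_integral_eq_integral)
      then show ?thesis using nonneg by (simp add: ennreal_power)
    qed
    also have "(\<integral>\<^sup>+t. (ennreal (g t))\<^sup>2 \<partial>lborel) = ennreal C"
    proof -
      have "(\<integral>\<^sup>+t. ennreal ((g t)\<^sup>2) \<partial>lborel) = ennreal C"
        unfolding g2 C_def by (rule nn_integral_eq_integral[OF int_C]) simp
      then show ?thesis using nonneg by (simp add: ennreal_power)
    qed
    finally have *: "(ennreal I)\<^sup>2 \<le> ennreal (fact m / 2) * ennreal C" .
    have "(0::real) \<le> fact m / 2" by simp
    from * have "ennreal (I\<^sup>2) \<le> ennreal (fact m / 2 * C)"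
      by (simp only: ennreal_power[OF I0] ennreal_mult[OF \<open>0 \<le> fact m / 2\<close> C0])
    then have "I\<^sup>2 \<le> fact m / 2 * C"
      by (rule ennreal_le_iff[THEN iffD1, rotated]) (simp add: C0)
    moreover have "(cmod (cyl (\<alpha> + 1 + k) z))\<^sup>2 \<le> I\<^sup>2"
      using norm_cyl_le[of "\<alpha> + 1 + k" z] \<alpha> by (intro power_mono) (auto simp: I_def y_def k_def)
    ultimately show ?thesis by (simp add: k_def mult_ac)
  qed
  then show ?thesis by blast
qed

lemma fact_le_hermite_prod:
  assumes "\<alpha> > 0"
  shows "fact k \<le> (\<Prod>j<k. hermite_b \<alpha> j)\<^sup>2"
proof (induction k)
  case (Suc k)
  have "fact (Suc k) = real (Suc k) * fact k" by simp
  also have "\<dots> \<le> (hermite_b \<alpha> k)\<^sup>2 * (\<Prod>j<k. hermite_b \<alpha> j)\<^sup>2"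
    using assms Suc by (intro mult_mono) (auto simp: hermite_b_def)
  finally show ?case by (simp add: power_mult_distrib mult.commute)
qed simp

text \<open>
  The functions \<open>cyl (\<alpha> + 1 + k) z\<close>, divided by \<open>b\<^sub>0 \<cdots> b\<^sub>k\<^sub>-\<^sub>1\<close> and multiplied by \<open>(- i)\<^sup>k\<close>,
  solve the recurrence of the matrix with inhomogeneity \<open>i \<alpha> cyl \<alpha> z\<close>, and they are square
  summable.
\<close>

theorem cyl_stieltjes:
  assumes \<alpha>: "\<alpha> > 0" and z: "Im z > 0"
    and \<mu>: "jacobi_moment_measure (\<lambda>_. 0) (hermite_b \<alpha>) \<mu>"
  shows "cyl (\<alpha> + 1) z = \<i> * of_real \<alpha> * cyl \<alpha> z * stieltjes \<mu> z"
proof -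
  interpret jacobi_limit_point "\<lambda>_. 0" "hermite_b \<alpha>"
    by (rule hermite_limit_point[OF \<alpha>])
  define R where "R k = (\<Prod>j<k. hermite_b \<alpha> j)" for k
  have R: "R k > 0" for k unfolding R_def by (intro prod_pos) (use b_pos in auto)
  have RS: "R (Suc k) = hermite_b \<alpha> k * R k" for k by (simp add: R_def)
  have b2: "(hermite_b \<alpha> k)\<^sup>2 = \<alpha> + real (Suc k)" for k
    using \<alpha> by (simp add: hermite_b_def)
  define U where "U k = (- \<i>) ^ k * cyl (\<alpha> + 1 + real k) z / of_real (R k)" for k
  have bU: "of_real (hermite_b \<alpha> k) * U (Suc k) = (- \<i>) ^ Suc k * cyl (\<alpha> + real k + 2) z / of_real (R k)" for k
  proof -
    have "\<alpha> + 1 + real (Suc k) = \<alpha> + real k + 2" by simp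
    moreover have "of_real (hermite_b \<alpha> k) \<noteq> (0::complex)" using b_pos[of k] by simp
    ultimately show ?thesis unfolding U_def RS by (simp add: field_simps)
  qed
  have cyl_rec: "cyl (\<alpha> + real k + 2) z = of_real (\<alpha> + real k) * cyl (\<alpha> + real k) z + \<i> * z * cyl (\<alpha> + 1 + real k) z" for k
    using cyl_recurrence[of "\<alpha> + real k" z] \<alpha> by (simp add: add_ac)
  have U_rec: "of_real (hermite_b \<alpha> k) * U (Suc k) = (z - of_real 0) * U k - prev_term (hermite_b \<alpha>) U k -
      (if k = 0 then \<i> * of_real \<alpha> * cyl \<alpha> z else 0)" for k
  proof (cases k)
    case 0
    show ?thesis
      unfolding bU cyl_rec 0 by (simp add: U_def R_def algebra_simps)
  next
    case (Suc i)
    have eq1: "(- \<i>) ^ Suc k * (of_real (\<alpha> + real k) * cyl (\<alpha> + real k) z) / of_real (R k) = - prev_term (hermite_b \<alpha>) U k"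
    proof -
      have "complex_of_real (\<alpha> + real k) = of_real (hermite_b \<alpha> i) * of_real (hermite_b \<alpha> i)"
        using b2[of i] Suc by (metis of_real_mult power2_eq_square)
      moreover have "(- \<i>) ^ Suc k = - ((- \<i>) ^ i)" by (simp add: Suc)
      moreover have "of_real (hermite_b \<alpha> i) \<noteq> (0::complex)" using b_pos[of i] by simp
      moreover have "\<alpha> + 1 + real i = \<alpha> + real k" using Suc by simp
      ultimately show ?thesis
        using Suc R[of i] by (simp add: U_def RS field_simps)
    qed
    have eq2: "(- \<i>) ^ Suc k * (\<i> * z * cyl (\<alpha> + 1 + real k) z) / of_real (R k) = z * U k"
    proof -
      have i: "(- \<i>) ^ Suc k * \<i> = (- \<i>) ^ k" by (simp add: mult.commute[of _ \<i>])
      have "(- \<i>) ^ Suc k * (\<i> * z * cyl (\<alpha> + 1 + real k) z) = ((- \<i>) ^ Suc k * \<i>) * (z * cyl (\<alpha> + 1 + real k) z)"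
        by (simp only: mult.assoc)
      then show ?thesis unfolding i by (simp add: U_def)
    qed
    show ?thesis
      unfolding bU cyl_rec distrib_left add_divide_distrib eq1 eq2 using Suc by simp
  qed
  have "summable (\<lambda>k. (cmod (U k))\<^sup>2)"
  proof -
    obtain C where C: "\<And>m. (cmod (cyl (\<alpha> + 1 + real (m + 2)) z))\<^sup>2 \<le> C * fact m"
      using cyl_sq_bound[OF \<alpha> z] by blast
    have "(0::real) \<le> C" using order.trans[OF zero_le_power2 C[of 0]] by simp
    have "summable (\<lambda>m. (cmod (U (m + 2)))\<^sup>2)"
    proof (rule summable_comparison_test'[where N = 0])
      have "summable (\<lambda>m. inverse (real (Suc m) ^ 2))"
        using inverse_power_summable[of 2, where 'a = real] by (subst summable_Suc_iff) simp
      then show "summable (\<lambda>m. C * inverse (real (Suc m) ^ 2))" by (rule summable_mult)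
      fix m :: nat
      have "(cmod (U (m + 2)))\<^sup>2 = (cmod (cyl (\<alpha> + 1 + real (m + 2)) z))\<^sup>2 / (R (m + 2))\<^sup>2"
        by (simp add: U_def norm_divide norm_mult norm_power power_divide del: power_Suc)
      also have "\<dots> \<le> C * fact m / fact (m + 2)"
        using C fact_le_hermite_prod[OF \<alpha>, of "m + 2"] \<open>0 \<le> C\<close>
        by (intro frac_le) (auto simp: R_def simp del: fact_Suc)
      also have "\<dots> = C / (real (m + 2) * real (Suc m))"
        by (simp add: fact_numeral divide_simps)
      also have "\<dots> \<le> C / (real (Suc m) * real (Suc m))"
        using \<open>0 \<le> C\<close> by (intro frac_le mult_right_mono) auto
      finally show "norm ((cmod (U (m + 2)))\<^sup>2) \<le> C * inverse (real (Suc m) ^ 2)"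
        by (simp add: divide_inverse power2_eq_square)
    qed
    then show ?thesis
      by (rule summable_iff_shift[of "\<lambda>k. (cmod (U k))\<^sup>2" 2, THEN iffD1])
  qed
  from l2_solution_stieltjes[OF \<mu> z U_rec this]
  show ?thesis by (simp add: U_def R_def)
qed

text \<open>
  Along a vertical line the derivative of \<open>N = |cyl \<alpha>|\<^sup>2\<close> is \<open>2 \<alpha> N Im m \<ge> - (2 \<alpha> / y) N\<close>,
  so \<open>y\<^sup>2\<^sup>\<alpha> N(y)\<close> is nondecreasing; and it is positive near the real axis, where there are
  no zeros.
\<close>

lemma cyl_nonzero_upper:
  assumes \<alpha>: "\<alpha> > 0" and z: "Im z > 0"
  shows "cyl \<alpha> z \<noteq> 0"
proof -
  interpret jacobi_limit_point "\<lambda>_. 0" "hermite_b \<alpha>"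
    by (rule hermite_limit_point[OF \<alpha>])
  obtain \<mu> where \<mu>: "jacobi_moment_measure (\<lambda>_. 0) (hermite_b \<alpha>) \<mu>"
    using jacobi_moment_measure_exists by blast
  interpret \<mu>: real_distribution \<mu> by (rule moment_measure_real_distribution[OF \<mu>])
  define x where "x = Re z"
  define pt where "pt y = of_real x + \<i> * of_real y" for y :: real
  have Re_pt [simp]: "Re (pt y) = x" and Im_pt [simp]: "Im (pt y) = y" for y by (simp_all add: pt_def)
  define g where "g y = cyl \<alpha> (pt y)" for y
  define m where "m y = stieltjes \<mu> (pt y)" for y
  have dg: "(g has_vector_derivative - (\<i> * of_real \<alpha> * g y * m y)) (at y)" if "y > 0" for y
  proof -
    have "((\<lambda>w. cyl \<alpha> (of_real x + \<i> * w)) has_field_derivative (\<i> * cyl (\<alpha> + 1) (pt y)) * \<i>) (at (of_real y))"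
      unfolding pt_def
      by (rule DERIV_chain2[where f = "cyl \<alpha>"]) (use \<alpha> in \<open>auto intro!: cyl_has_derivative derivative_eq_intros\<close>)
    from has_vector_derivative_real_field[OF this]
    have "(g has_vector_derivative (\<i> * cyl (\<alpha> + 1) (pt y)) * \<i>) (at y)"
      by (simp add: g_def[abs_def] pt_def)
    moreover have "cyl (\<alpha> + 1) (pt y) = \<i> * of_real \<alpha> * g y * m y"
      using cyl_stieltjes[OF \<alpha> _ \<mu>, of "pt y"] that by (simp add: g_def m_def)
    ultimately show ?thesis by (simp add: mult_ac)
  qed
  define N where "N y = (Re (g y))\<^sup>2 + (Im (g y))\<^sup>2" for y
  have dN: "(N has_real_derivative 2 * \<alpha> * N y * Im (m y)) (at y)" if "y > 0" for y
  proof -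
    have d: "((\<lambda>y. Re (g y)) has_real_derivative Re (- (\<i> * of_real \<alpha> * g y * m y))) (at y)"
      "((\<lambda>y. Im (g y)) has_real_derivative Im (- (\<i> * of_real \<alpha> * g y * m y))) (at y)"
      unfolding has_real_derivative_iff_has_vector_derivative
      by (rule bounded_linear.has_vector_derivative[OF bounded_linear_Re dg[OF that]]
          bounded_linear.has_vector_derivative[OF bounded_linear_Im dg[OF that]])+
    show ?thesis
      unfolding N_def power2_eq_square
      by (rule DERIV_cong[OF DERIV_add[OF DERIV_mult[OF d(1) d(1)] DERIV_mult[OF d(2) d(2)]]])
        (simp add: algebra_simps)
  qed
  have Im_m: "- 1 \<le> y * Im (m y)" if "y > 0" for y
  proof -
    have "\<bar>Im (m y)\<bar> \<le> 1 / y"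
      using \<mu>.norm_stieltjes_le[of "pt y"] abs_Im_le_cmod[of "m y"] that by (simp add: m_def)
    then have "- (1 / y) \<le> Im (m y)" by linarith
    from mult_left_mono[OF this, of y] show ?thesis using that by simp
  qed
  have cont: "continuous (at (of_real x)) (cyl \<alpha>)"
    using cyl_has_derivative[OF \<alpha>] DERIV_isCont by blast
  have "\<forall>\<^sub>F w in at (of_real x). cyl \<alpha> w \<noteq> 0"
    using cont cyl_nonzero_real[OF \<alpha>, of x] by (simp add: isCont_def tendsto_imp_eventually_ne)
  then obtain \<delta> where \<delta>: "\<delta> > 0" "\<And>w. w \<noteq> of_real x \<Longrightarrow> dist w (of_real x) < \<delta> \<Longrightarrow> cyl \<alpha> w \<noteq> 0"
    unfolding eventually_at by blast
  define \<epsilon> where "\<epsilon> = min (\<delta> / 2) (Im z)"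
  have \<epsilon>: "\<epsilon> > 0" "\<epsilon> < \<delta>" "\<epsilon> \<le> Im z" using \<delta>(1) z by (auto simp: \<epsilon>_def)
  have "g \<epsilon> \<noteq> 0"
    unfolding g_def
  proof (rule \<delta>(2))
    show "pt \<epsilon> \<noteq> of_real x" using \<epsilon> by (simp add: complex_eq_iff)
    show "dist (pt \<epsilon>) (of_real x) < \<delta>" using \<epsilon> by (simp add: pt_def dist_norm norm_mult)
  qed
  then have "N \<epsilon> > 0" by (simp add: N_def complex_eq_iff sum_power2_gt_zero_iff)
  then have "0 < N \<epsilon> * \<epsilon> powr (2 * \<alpha>)" using \<epsilon> by simp
  also have "\<dots> \<le> N (Im z) * (Im z) powr (2 * \<alpha>)"
  proof (rule DERIV_nonneg_imp_nondecreasing[OF \<epsilon>(3)])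
    fix y assume "\<epsilon> \<le> y"
    then have y: "y > 0" using \<epsilon> by simp
    have "((\<lambda>y. N y * y powr (2 * \<alpha>)) has_real_derivative
        (2 * \<alpha> * N y * Im (m y)) * y powr (2 * \<alpha>) + (2 * \<alpha> * y powr (2 * \<alpha> - 1)) * N y) (at y)"
      by (intro DERIV_mult dN[OF y]) (use y in \<open>auto intro!: derivative_eq_intros\<close>)
    moreover have "y powr (2 * \<alpha>) = y * y powr (2 * \<alpha> - 1)"
      using y powr_add[of y 1 "2 * \<alpha> - 1"] by simp
    then have "(2 * \<alpha> * N y * Im (m y)) * y powr (2 * \<alpha>) + (2 * \<alpha> * y powr (2 * \<alpha> - 1)) * N y =
      (2 * \<alpha> * y powr (2 * \<alpha> - 1) * N y) * (y * Im (m y) + 1)"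
      by (simp add: algebra_simps)
    moreover have "\<dots> \<ge> 0"
      using \<alpha> Im_m[OF y] by (intro mult_nonneg_nonneg) (auto simp: N_def)
    ultimately show "\<exists>D. ((\<lambda>y. N y * y powr (2 * \<alpha>)) has_real_derivative D) (at y) \<and> 0 \<le> D"
      by auto
  qed
  finally have "N (Im z) \<noteq> 0" by auto
  moreover have "pt (Im z) = z" by (simp add: complex_eq_iff x_def)
  ultimately show ?thesis by (auto simp: N_def g_def)
qed

text \<open>
  The boundary value of \<open>- Im m / \<pi>\<close> for \<open>m = cyl (\<alpha> + 1) / (i \<alpha> cyl \<alpha>)\<close>, simplified by
  \<open>cyl_wronskian\<close>.
\<close>

definition hermite_density :: "real \<Rightarrow> real \<Rightarrow> real" where
  "hermite_density \<alpha> x = Gamma \<alpha> / (\<alpha> * sqrt (2 * pi)) * exp (- (x\<^sup>2 / 2)) / (cmod (cyl \<alpha> (of_real x)))\<^sup>2"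

lemma hermite_density_nonneg: "\<alpha> > 0 \<Longrightarrow> hermite_density \<alpha> x \<ge> 0"
  using Gamma_real_pos[of \<alpha>] by (simp add: hermite_density_def)

lemma hermite_density_boundary:
  assumes \<alpha>: "\<alpha> > 0"
  shows "- Im (cyl (\<alpha> + 1) (of_real x) / (\<i> * of_real \<alpha> * cyl \<alpha> (of_real x))) / pi = hermite_density \<alpha> x"
proof -
  define g where "g = cyl \<alpha> (of_real x)"
  define h where "h = cyl (\<alpha> + 1) (of_real x)"
  have g: "g \<noteq> 0" unfolding g_def by (rule cyl_nonzero_real[OF \<alpha>])
  have W: "Re (h * cnj g) = Gamma \<alpha> * sqrt (pi / 2) * exp (- (x\<^sup>2 / 2))"
    unfolding g_def h_def by (rule cyl_wronskian[OF \<alpha>])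
  have "h / (\<i> * of_real \<alpha> * g) = of_real (1 / (\<alpha> * (cmod g)\<^sup>2)) * (- \<i> * (h * cnj g))"
    using g \<alpha> complex_norm_square[of g] by (simp add: field_simps)
  moreover have "- Im (of_real r * (- \<i> * w)) = r * Re w" for r w
    by simp
  ultimately have "- Im (h / (\<i> * of_real \<alpha> * g)) = 1 / (\<alpha> * (cmod g)\<^sup>2) * Re (h * cnj g)"
    by (simp only:)
  then have "- Im (h / (\<i> * of_real \<alpha> * g)) = Re (h * cnj g) / (\<alpha> * (cmod g)\<^sup>2)"
    by simp
  also have "\<dots> / pi = Gamma \<alpha> * (sqrt (pi / 2) / pi) * exp (- (x\<^sup>2 / 2)) / (\<alpha> * (cmod g)\<^sup>2)"
    unfolding W by simp
  also have "sqrt (pi / 2) / pi = 1 / sqrt (2 * pi)"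
  proof -
    have "sqrt (pi / 2) * sqrt (2 * pi) = pi" by (simp flip: real_sqrt_mult)
    then show ?thesis by (simp add: field_simps)
  qed
  finally show ?thesis
    by (simp add: hermite_density_def g_def h_def)
qed

lemma hermite_density_measurable [measurable]:
  assumes "\<alpha> > 0"
  shows "hermite_density \<alpha> \<in> borel_measurable borel"
proof -
  have "continuous_on UNIV (\<lambda>x. cyl \<alpha> (complex_of_real x))"
    by (rule continuous_on_compose2[OF continuous_on_cyl[OF assms, of UNIV]]) (auto intro!: continuous_intros)
  then have "(\<lambda>x. cyl \<alpha> (complex_of_real x)) \<in> borel_measurable borel"
    by (rule borel_measurable_continuous_onI)
  then show ?thesis unfolding hermite_density_def[abs_def] by measurable
qed

text \<open>
  The Stieltjes transform is a quotient of continuous functions on the closed upper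
  half-plane, so for test functions with compact support the limit in the Poisson
  approximation may be taken under the integral sign.
\<close>

theorem hermite_moment_measure_density:
  assumes \<alpha>: "\<alpha> > 0" and \<nu>: "jacobi_moment_measure (\<lambda>_. 0) (hermite_b \<alpha>) \<nu>"
  shows "\<nu> = density lborel (\<lambda>x. ennreal (hermite_density \<alpha> x))"
proof -
  interpret jacobi_limit_point "\<lambda>_. 0" "hermite_b \<alpha>"
    by (rule hermite_limit_point[OF \<alpha>])
  interpret \<nu>: real_distribution \<nu> by (rule moment_measure_real_distribution[OF \<nu>])
  note [measurable] = hermite_density_measurable[OF \<alpha>]
  define S where "S z = cyl (\<alpha> + 1) z / (\<i> * of_real \<alpha> * cyl \<alpha> z)" for z
  have S_stieltjes: "stieltjes \<nu> z = S z" if "Im z > 0" for z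
    using cyl_stieltjes[OF \<alpha> that \<nu>] cyl_nonzero_upper[OF \<alpha> that] \<alpha> by (simp add: S_def)
  have nz: "cyl \<alpha> z \<noteq> 0" if "Im z \<ge> 0" for z
  proof (cases "Im z = 0")
    case True
    then have "z = of_real (Re z)" by (simp add: complex_eq_iff)
    then show ?thesis using cyl_nonzero_real[OF \<alpha>] by metis
  qed (use cyl_nonzero_upper[OF \<alpha>] that in auto)
  have S_cont: "continuous_on {z. Im z \<ge> 0} S"
    unfolding S_def using \<alpha> nz by (intro continuous_intros continuous_on_cyl) auto
  show ?thesis
  proof (rule measure_eqI_bump_functions)
    fix f :: "real \<Rightarrow> real" and R :: real
    assume f: "continuous_on UNIV f" and f01: "\<And>x. 0 \<le> f x \<and> f x \<le> 1" and supp: "\<And>x. \<bar>x\<bar> > R \<Longrightarrow> f x = 0"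
    have [measurable]: "f \<in> borel_measurable borel"
      using f by (rule borel_measurable_continuous_onI)
    define Q where "Q = cbox (Complex (- R) 0) (Complex R 1)"
    have Q: "z \<in> Q \<longleftrightarrow> \<bar>Re z\<bar> \<le> R \<and> 0 \<le> Im z \<and> Im z \<le> 1" for z
      unfolding Q_def in_cbox_complex_iff by auto
    have "compact (S ` Q)"
      using Q by (intro compact_continuous_image continuous_on_subset[OF S_cont]) (auto simp: Q_def)
    then obtain K where K: "\<And>z. z \<in> Q \<Longrightarrow> cmod (S z) \<le> K"
      by (meson bounded_iff compact_imp_bounded imageI)
    have dom: "\<bar>f x * (- Im (S (Complex x y)) / pi)\<bar> \<le> \<bar>K\<bar> * indicator {- R..R} x" if "0 \<le> y" "y \<le> 1" for x y
    proof (cases "\<bar>x\<bar> \<le> R")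
      case True
      have "\<bar>Im (S (Complex x y))\<bar> \<le> \<bar>K\<bar>"
        using abs_Im_le_cmod[of "S (Complex x y)"] K[of "Complex x y"] Q[of "Complex x y"] True that by simp
      then have "\<bar>- Im (S (Complex x y)) / pi\<bar> \<le> \<bar>K\<bar> / 1"
        unfolding abs_divide abs_minus_cancel using pi_gt3 by (intro frac_le) auto
      then have "\<bar>f x\<bar> * \<bar>- Im (S (Complex x y)) / pi\<bar> \<le> 1 * \<bar>K\<bar>"
        using f01[of x] by (intro mult_mono) auto
      then show ?thesis using True by (simp only: abs_mult) (auto simp: indicator_def)
    qed (use supp[of x] in simp)
    have "integrable lborel (indicator {- R..R} :: real \<Rightarrow> real)"
      by (rule integrable_real_indicator) (auto simp: emeasure_lborel_Icc_eq)
    then have dom_int: "integrable lborel (\<lambda>x. \<bar>K\<bar> * indicator {- R..R} x)" by simp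
    have S_meas: "(\<lambda>x. Im (S (Complex x y))) \<in> borel_measurable borel" if "y \<ge> 0" for y
    proof -
      have "continuous_on UNIV (\<lambda>x. S (Complex x y))"
        by (rule continuous_on_compose2[OF S_cont]) (use that in \<open>auto intro!: continuous_intros simp: Complex_eq\<close>)
      then have "(\<lambda>x. S (Complex x y)) \<in> borel_measurable borel"
        by (rule borel_measurable_continuous_onI)
      then show ?thesis by measurable
    qed
    have limit: "(\<lambda>n. \<integral>x. f x * (- Im (S (Complex x (1 / real (Suc n)))) / pi) \<partial>lborel) \<longlonglongrightarrow> (\<integral>x. f x * hermite_density \<alpha> x \<partial>lborel)"
    proof (rule integral_dominated_convergence[OF _ _ dom_int])
      show "AE x in lborel. (\<lambda>n. f x * (- Im (S (Complex x (1 / real (Suc n)))) / pi)) \<longlonglongrightarrow> f x * hermite_density \<alpha> x"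
      proof (intro AE_I2 tendsto_mult tendsto_const)
        fix x
        have "(\<lambda>n. S (Complex x (1 / real (Suc n)))) \<longlonglongrightarrow> S (Complex x 0)"
        proof (rule continuous_on_tendsto_compose[OF S_cont])
          have "(\<lambda>n. 1 / real (Suc n)) \<longlonglongrightarrow> 0" by (rule LIMSEQ_Suc[OF lim_const_over_n])
          then show "(\<lambda>n. Complex x (1 / real (Suc n))) \<longlonglongrightarrow> Complex x 0"
            by (intro tendsto_Complex tendsto_const)
        qed auto
        then have "(\<lambda>n. - Im (S (Complex x (1 / real (Suc n)))) / pi) \<longlonglongrightarrow> - Im (S (Complex x 0)) / pi"
          by (intro tendsto_intros) auto
        also have "- Im (S (Complex x 0)) / pi = hermite_density \<alpha> x"
          using hermite_density_boundary[OF \<alpha>, of x] by (simp add: S_def complex_of_real_def)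
        finally show "(\<lambda>n. - Im (S (Complex x (1 / real (Suc n)))) / pi) \<longlonglongrightarrow> hermite_density \<alpha> x" .
      qed
      show "AE x in lborel. norm (f x * (- Im (S (Complex x (1 / real (Suc n)))) / pi)) \<le> \<bar>K\<bar> * indicator {- R..R} x" for n
        using dom[of "1 / real (Suc n)"] by (intro AE_I2) simp
      show "(\<lambda>x. f x * (- Im (S (Complex x (1 / real (Suc n)))) / pi)) \<in> borel_measurable lborel" for n
        using S_meas[of "1 / real (Suc n)"] by measurable
    qed measurable
    have "(\<lambda>n. \<integral>x. f x * (- Im (S (Complex x (1 / real (Suc n)))) / pi) \<partial>lborel) \<longlonglongrightarrow> (\<integral>x. f x \<partial>\<nu>)"
      using \<nu>.poisson_integral_approximates[OF f, of 1] f01 by (simp add: S_stieltjes)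
    with limit have eq: "(\<integral>x. f x \<partial>\<nu>) = (\<integral>x. f x * hermite_density \<alpha> x \<partial>lborel)"
      by (rule LIMSEQ_unique[rotated])
    have int: "integrable lborel (\<lambda>x. f x * hermite_density \<alpha> x)"
    proof (rule Bochner_Integration.integrable_bound[OF dom_int])
      have "hermite_density \<alpha> x = - Im (S (Complex x 0)) / pi" for x
        using hermite_density_boundary[OF \<alpha>, of x] by (simp add: S_def complex_of_real_def)
      then show "AE x in lborel. norm (f x * hermite_density \<alpha> x) \<le> norm (\<bar>K\<bar> * indicator {- R..R} x)"
        using dom[of 0] by (intro AE_I2) (simp add: indicator_def)
    qed measurable
    have "(\<integral>\<^sup>+x. ennreal (f x) \<partial>\<nu>) = ennreal (\<integral>x. f x \<partial>\<nu>)"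
      using f01 by (intro nn_integral_eq_integral \<nu>.integrable_const_bound[where B = 1]) auto
    also have "\<dots> = (\<integral>\<^sup>+x. ennreal (f x * hermite_density \<alpha> x) \<partial>lborel)"
      unfolding eq using f01 hermite_density_nonneg[OF \<alpha>]
      by (intro nn_integral_eq_integral[symmetric] int) auto
    also have "\<dots> = (\<integral>\<^sup>+x. ennreal (f x) \<partial>density lborel (\<lambda>x. ennreal (hermite_density \<alpha> x)))"
      using f01 hermite_density_nonneg[OF \<alpha>]
      by (subst nn_integral_density) (auto simp: ennreal_mult mult.commute)
    finally show "(\<integral>\<^sup>+x. ennreal (f x) \<partial>\<nu>) = (\<integral>\<^sup>+x. ennreal (f x) \<partial>density lborel (\<lambda>x. ennreal (hermite_density \<alpha> x)))" .
  qed auto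
qed

section \<open>The Laplace transform of the squared off-diagonal entry\<close>

lemma chi_tilde_density_nonneg: "\<alpha> > 0 \<Longrightarrow> chi_tilde_density (2 * \<alpha>) u \<ge> 0"
  using Gamma_real_pos[of \<alpha>] by (simp add: chi_tilde_density_def)

lemma chi_tilde_density_measurable [measurable]: "chi_tilde_density k \<in> borel_measurable borel"
  unfolding chi_tilde_density_def[abs_def] by measurable

lemma integrable_chi_tilde_density:
  assumes \<alpha>: "\<alpha> > 0"
  shows "integrable lborel (chi_tilde_density (2 * \<alpha>))"
proof (rule Bochner_Integration.integrable_bound)
  have "integrable lborel (\<lambda>t. weight 1 (2 * \<alpha>) t)"
    using integrable_weight[of "2 * \<alpha>" 1 0] \<alpha> by (simp add: admissible_rate_def)
  then show "integrable lborel (\<lambda>t. 2 / Gamma \<alpha> * weight 1 (2 * \<alpha>) t)" by simp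
  show "AE u in lborel. norm (chi_tilde_density (2 * \<alpha>) u) \<le> norm (2 / Gamma \<alpha> * weight 1 (2 * \<alpha>) u)"
  proof (intro AE_I2)
    fix u :: real
    have "exp (- u\<^sup>2) \<le> exp (- (1 * u\<^sup>2 / 2))" by simp
    then have "2 / Gamma \<alpha> * u powr (2 * \<alpha> - 1) * exp (- u\<^sup>2) \<le> 2 / Gamma \<alpha> * u powr (2 * \<alpha> - 1) * exp (- (1 * u\<^sup>2 / 2))"
      using Gamma_real_pos[OF \<alpha>] by (intro mult_left_mono) auto
    then show "norm (chi_tilde_density (2 * \<alpha>) u) \<le> norm (2 / Gamma \<alpha> * weight 1 (2 * \<alpha>) u)"
      using chi_tilde_density_nonneg[OF \<alpha>, of u] Gamma_real_pos[OF \<alpha>]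
      by (simp add: chi_tilde_density_def weight_def abs_mult mult.assoc)
  qed
qed measurable

text \<open>
  The square of the variable is Gamma distributed with parameter \<open>\<alpha>\<close>; the substitution
  \<open>t = u\<^sup>2\<close> reduces the claim to the Gamma integral with rate \<open>1 + \<kappa>\<close>.
\<close>

lemma chi_tilde_laplace:
  assumes \<alpha>: "\<alpha> > 0" and \<kappa>: "Re \<kappa> \<ge> 0"
  shows "(\<integral>u. of_real (chi_tilde_density (2 * \<alpha>) u) * exp (- \<kappa> * of_real (u\<^sup>2)) \<partial>lborel) = (1 + \<kappa>) powr (- of_real \<alpha>)"
proof -
  define c where "c = 1 + \<kappa>"
  have c: "Re c > 0" using \<kappa> by (simp add: c_def)
  define f where "f t = of_real (weight 0 \<alpha> t) * exp (- c * of_real t)" for t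
  define h where "h u = complex_of_real (chi_tilde_density (2 * \<alpha>) u) * exp (- \<kappa> * of_real (u\<^sup>2))" for u
  have G: "Gamma \<alpha> > 0" by (rule Gamma_real_pos[OF \<alpha>])
  have fh: "(2 * u) *\<^sub>R f (u\<^sup>2) = of_real (Gamma \<alpha>) * h u" if u: "u > 0" for u
  proof -
    have E1: "2 * u * (u\<^sup>2) powr (\<alpha> - 1) = 2 * u powr (2 * \<alpha> - 1)"
    proof -
      have "(u\<^sup>2) powr (\<alpha> - 1) = u powr (2 * \<alpha> - 2)"
        using u by (simp add: powr_powr algebra_simps flip: powr_numeral)
      then have "2 * u * (u\<^sup>2) powr (\<alpha> - 1) = 2 * (u powr 1 * u powr (2 * \<alpha> - 2))"
        using u by simp
      also have "u powr 1 * u powr (2 * \<alpha> - 2) = u powr (2 * \<alpha> - 1)"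
        by (simp only: powr_add[symmetric]) simp
      finally show ?thesis .
    qed
    have E2: "exp (- c * of_real (u\<^sup>2)) = of_real (exp (- u\<^sup>2)) * exp (- \<kappa> * of_real (u\<^sup>2))"
      unfolding exp_of_real[symmetric] mult_exp_exp by (simp add: c_def algebra_simps)
    have E3: "(2 * u) *\<^sub>R f (u\<^sup>2) = of_real (2 * u * (u\<^sup>2) powr (\<alpha> - 1)) * exp (- c * of_real (u\<^sup>2))"
      using u by (simp add: f_def weight_def scaleR_conv_of_real)
    show ?thesis
      unfolding E3 E1 E2 using u G by (simp add: h_def chi_tilde_density_def)
  qed
  have int_h: "integrable lborel h"
  proof (rule Bochner_Integration.integrable_bound[OF integrable_chi_tilde_density[OF \<alpha>]])
    show "AE u in lborel. norm (h u) \<le> norm (chi_tilde_density (2 * \<alpha>) u)"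
      using \<kappa> by (intro AE_I2) (simp add: h_def norm_mult mult_left_le mult_nonneg_nonneg)
    show "h \<in> borel_measurable lborel" unfolding h_def[abs_def] by measurable
  qed
  have int_f: "integrable lborel f"
    unfolding f_def using \<alpha> c by (intro integrable_weight_complex) (auto simp: admissible_rate_def)
  have "(LBINT t=0..\<infinity>. f t) = (LBINT u=0..\<infinity>. (2 * u) *\<^sub>R f (u\<^sup>2))"
  proof (rule interval_integral_substitution_integrable)
    fix u :: real assume u: "0 < ereal u"
    show "DERIV (\<lambda>u. u\<^sup>2) u :> 2 * u" by (auto intro!: derivative_eq_intros)
    have "isCont (\<lambda>t. of_real (t powr (\<alpha> - 1)) * exp (- c * of_real t)) (u\<^sup>2)"
      using u by (intro continuous_intros) auto
    moreover have ev: "\<forall>\<^sub>F t in nhds (u\<^sup>2). f t = of_real (t powr (\<alpha> - 1)) * exp (- c * of_real t)"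
      using eventually_nhds_in_open[of "{0<..}" "u\<^sup>2"] u by (auto elim!: eventually_mono simp: f_def weight_def)
    ultimately show "isCont f (u\<^sup>2)" unfolding isCont_cong[OF ev] by simp
  next
    have "((\<lambda>u::real. u\<^sup>2) \<longlongrightarrow> 0) (at_right 0)" by real_asymp
    then show "((ereal \<circ> (\<lambda>u. u\<^sup>2) \<circ> real_of_ereal) \<longlongrightarrow> 0) (at_right 0)"
      by (simp add: zero_ereal_def ereal_tendsto_simps)
    have "filterlim (\<lambda>u::real. u\<^sup>2) at_top at_top" by real_asymp
    then show "((ereal \<circ> (\<lambda>u. u\<^sup>2) \<circ> real_of_ereal) \<longlongrightarrow> \<infinity>) (at_left \<infinity>)"
      by (simp add: ereal_tendsto_simps)
    have "set_integrable lborel (einterval 0 \<infinity>) (\<lambda>u. of_real (Gamma \<alpha>) * h u)"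
      unfolding set_integrable_def by (rule integrable_mult_indicator) (use int_h in auto)
    then show "set_integrable lborel (einterval 0 \<infinity>) (\<lambda>u. (2 * u) *\<^sub>R f (u\<^sup>2))"
      by (rule set_integrable_cong[THEN iffD1, OF refl refl, rotated]) (auto simp: einterval_def fh)
    show "set_integrable lborel (einterval 0 \<infinity>) f"
      unfolding set_integrable_def by (rule integrable_mult_indicator) (use int_f in auto)
  qed auto
  also have "\<dots> = (LBINT u=0..\<infinity>. of_real (Gamma \<alpha>) * h u)"
    by (intro interval_integral_cong) (auto simp: einterval_def fh)
  finally have eq: "(LINT t:{0<..}|lborel. f t) = (LINT u:{0<..}|lborel. of_real (Gamma \<alpha>) * h u)"
    by (simp only: interval_lebesgue_integral_0_infty)
  have on_pos: "(LINT t:{0<..}|lborel. g t) = (\<integral>t. g t \<partial>lborel)" if "\<And>t. t \<le> 0 \<Longrightarrow> g t = 0" for g :: "real \<Rightarrow> complex"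
    unfolding set_lebesgue_integral_def
    by (rule Bochner_Integration.integral_cong) (use that in \<open>auto simp: indicator_def not_less\<close>)
  have "weight_laplace 0 \<alpha> c = of_real (Gamma \<alpha>) * (\<integral>u. h u \<partial>lborel)"
    using eq by (simp add: on_pos f_def h_def weight_def chi_tilde_density_def weight_laplace_def)
  then show ?thesis
    using weight_laplace_gamma[OF \<alpha> c] G by (simp add: h_def c_def)
qed

text \<open>The arguments lie in \<open>(- \<pi> / 2, \<pi> / 2)\<close>, so their sum stays on the principal branch.\<close>

lemma powr_mult_right_half_plane:
  assumes "Re u > 0" "Re v > 0" 
  shows "(u * v) powr (- of_real \<alpha>) = u powr (- of_real \<alpha>) * v powr (- of_real \<alpha>)"
proof -
  have nz: "u \<noteq> 0" "v \<noteq> 0" using assms by auto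
  have "\<bar>Im (Ln u)\<bar> < pi / 2" "\<bar>Im (Ln v)\<bar> < pi / 2"
    using assms Re_Ln_pos_lt[OF nz(1)] Re_Ln_pos_lt[OF nz(2)] by blast+
  then have "Ln (u * v) = Ln u + Ln v"
    using nz by (intro Ln_times_simple) linarith+
  then show ?thesis
    using nz by (simp add: powr_def exp_add distrib_left exp_diff exp_minus divide_simps)
qed

section \<open>Continued fractions as Moebius maps\<close>

text \<open>
  The condition \<open>Im q \<ge> 0\<close> is preserved by a level \<open>w \<mapsto> c - g / w\<close> with \<open>Im c > 0\<close> and
  \<open>g \<ge> 0\<close>: the new pole is \<open>g / c\<close>, in the closed lower half-plane.
\<close>

lemma tail_resolvent_moebius:
  assumes z: "Im z > 0"
  shows "\<exists>A B q. Im q \<ge> 0 \<and> (\<forall>w. Im w > 0 \<longrightarrow> tail_resolvent a b z n w = A + B / (w + q))"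
proof (induction n)
  case 0
  show ?case by (intro exI[of _ 0] exI[of _ 1]) simp
next
  case (Suc n)
  then obtain A B q where q: "Im q \<ge> 0" and tm: "\<And>w. Im w > 0 \<Longrightarrow> tail_resolvent a b z n w = A + B / (w + q)"
    by blast
  define c where "c = z - of_real (a n) + q"
  define g where "g = (b n)\<^sup>2"
  have c: "Im c > 0" using z q by (simp add: c_def)
  then have c0: "c \<noteq> 0" by auto
  define q' where "q' = - (of_real g / c)"
  have q': "Im q' \<ge> 0"
    using c by (simp add: q'_def Im_divide g_def)
  have "tail_resolvent a b z (Suc n) w = (A + B / c) + (B * of_real g / c\<^sup>2) / (w + q')" if w: "Im w > 0" for w
  proof -
    have w0: "w \<noteq> 0" "w + q' \<noteq> 0" using w q' by (auto simp: complex_eq_iff)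
    have "Im (z - of_real (a n) - of_real g / w) > 0"
      using Im_continued_fraction_step[OF w, of z "a n" "b n"] z by (simp add: g_def)
    then have "tail_resolvent a b z (Suc n) w = A + B / (z - of_real (a n) - of_real g / w + q)"
      by (simp add: tm g_def)
    also have "z - of_real (a n) - of_real g / w + q = c - of_real g / w"
      by (simp add: c_def)
    also have "c - of_real g / w = c * (w + q') / w"
      using w0 c0 by (simp add: q'_def field_simps)
    also have "B / (c * (w + q') / w) = B / c + (B * of_real g / c\<^sup>2) / (w + q')"
    proof -
      have "B / (c * (w + q') / w) = (B / c) * (w / (w + q'))" using w0 c0 by (simp add: field_simps)
      also have "w / (w + q') = 1 + (of_real g / c) / (w + q')"
        using w0 c0 by (simp add: divide_simps) (simp add: q'_def field_simps)
      also have "B / c * (1 + (G / c) / v) = B / c + (B * G / c\<^sup>2) / v" for G v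
        by (simp add: distrib_left power2_eq_square mult_ac)
      finally show ?thesis .
    qed
    finally show ?thesis by simp
  qed
  then show ?case using q' by blast
qed

lemma tail_resolvent_cong:
  "(\<And>i. i < n \<Longrightarrow> a i = a' i) \<Longrightarrow> (\<And>i. i < n \<Longrightarrow> b i = b' i) \<Longrightarrow>
    tail_resolvent a b z n w = tail_resolvent a' b' z n w"
  by (induction n arbitrary: w) simp_all

lemma tail_resolvent_measurable [measurable]:
  assumes "\<And>i. i < n \<Longrightarrow> (\<lambda>x. a x i) \<in> borel_measurable M" "\<And>i. i < n \<Longrightarrow> (\<lambda>x. b x i) \<in> borel_measurable M"
    and z [measurable]: "z \<in> borel_measurable M" and "w \<in> borel_measurable M"
  shows "(\<lambda>x. tail_resolvent (a x) (b x) (z x) n (w x)) \<in> borel_measurable M"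
  using assms(1,2,4)
proof (induction n arbitrary: w)
  case (Suc n)
  have [measurable]: "(\<lambda>x. a x n) \<in> borel_measurable M" "(\<lambda>x. b x n) \<in> borel_measurable M" "w \<in> borel_measurable M"
    using Suc.prems by auto
  have "(\<lambda>x. z x - of_real (a x n) - of_real ((b x n)\<^sup>2) / w x) \<in> borel_measurable M"
    by measurable
  from Suc.IH[OF _ _ this] Suc.prems show ?case by simp
qed simp

section \<open>Gaussian averages of the complex weight\<close>

lemma integral_std_normal_exp:
  "(\<integral>x. exp (- (\<i> * of_real t * of_real x)) \<partial>std_normal_distribution) = exp (- of_real (t\<^sup>2 / 2))"
proof -
  have "(\<integral>x. exp (- (\<i> * of_real t * of_real x)) \<partial>std_normal_distribution) = char std_normal_distribution (- t)"
    unfolding char_def by (simp add: mult.assoc)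
  then show ?thesis
    unfolding char_std_normal_distribution by (simp add: exp_of_real[symmetric])
qed

lemma integrable_bounded:
  fixes f :: "'a \<Rightarrow> complex"
  assumes "finite_measure M" "f \<in> borel_measurable M" "\<And>x. x \<in> space M \<Longrightarrow> cmod (f x) \<le> C"
  shows "integrable M f"
  using assms by (intro finite_measure.integrable_const_bound[where B = C]) auto

text \<open>
  The resolvent is the Laplace transform of the exponentials \<open>exp (i l v)\<close>; \<open>weight 0 1\<close> is
  the indicator of the positive half-line.
\<close>

lemma resolvent_eq_laplace:
  assumes "Im v > 0"
  shows "1 / v = - \<i> * weight_laplace 0 1 (- (\<i> * v))"
proof -
  have "weight_laplace 0 1 (- (\<i> * v)) = 1 / (- (\<i> * v))"
    using weight_laplace_gamma[of 1 "- (\<i> * v)"] assms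
    by (simp add: powr_minus powr_to_1 inverse_eq_divide)
  then show ?thesis using assms by (simp add: field_simps)
qed

text \<open>
  Shows that the integrals of \<open>k / (v + q)\<close> are determined by those of \<open>k exp (i l v)\<close>. It
  will be applied twice, to two measures for which the latter agree.
\<close>

lemma resolvent_integral_eq_laplace:
  fixes k v :: "'t \<Rightarrow> complex"
  assumes T: "prob_space T" and [measurable]: "k \<in> borel_measurable T" "v \<in> borel_measurable T"
    and k: "\<And>t. t \<in> space T \<Longrightarrow> cmod (k t) \<le> C"
    and v: "\<And>t. t \<in> space T \<Longrightarrow> Im (v t) \<ge> y" and y: "y > 0" and q: "Im q \<ge> 0"
  shows "(\<integral>t. k t / (v t + q) \<partial>T) =
    - \<i> * (\<integral>l. of_real (weight 0 1 l) * exp (\<i> * of_real l * q) * (\<integral>t. k t * exp (\<i> * of_real l * v t) \<partial>T) \<partial>lborel)"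
proof -
  interpret T: prob_space T by fact
  interpret P: pair_sigma_finite T lborel ..
  have C: "C \<ge> 0"
    using k[of "SOME t. t \<in> space T"] T.not_empty some_in_eq order.trans[OF norm_ge_zero] by metis
  have int_w: "integrable lborel (\<lambda>l. weight 0 1 l * exp (- y * l))"
    using y by (intro integrable_weight_0) auto
  define F where "F t l = k t * (of_real (weight 0 1 l) * exp (- (- (\<i> * (v t + q))) * of_real l))" for t l
  have [measurable]: "case_prod F \<in> borel_measurable (T \<Otimes>\<^sub>M lborel)"
    unfolding F_def by measurable
  have F_bound: "cmod (F t l) \<le> C * (weight 0 1 l * exp (- y * l))" if "t \<in> space T" for t l
  proof (cases "l > 0")
    case True
    have "cmod (F t l) = cmod (k t) * (weight 0 1 l * exp (- (Im (v t) + Im q) * l))"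
      by (simp add: F_def norm_mult algebra_simps)
    also have "\<dots> \<le> C * (weight 0 1 l * exp (- y * l))"
    proof (intro mult_mono mult_nonneg_nonneg)
      have "y * l \<le> (Im (v t) + Im q) * l"
        using v[OF that] q True by (intro mult_right_mono) auto
      then show "exp (- (Im (v t) + Im q) * l) \<le> exp (- y * l)"
        by (simp only: exp_le_cancel_iff mult_minus_left neg_le_iff_le)
    qed (use k[OF that] C in auto)
    finally show ?thesis .
  qed (simp add: F_def weight_def)
  have int_F: "integrable (T \<Otimes>\<^sub>M lborel) (case_prod F)"
  proof (rule integrableI_bounded)
    have "(\<integral>\<^sup>+p. ennreal (norm (case_prod F p)) \<partial>(T \<Otimes>\<^sub>M lborel)) = (\<integral>\<^sup>+t. \<integral>\<^sup>+l. ennreal (cmod (F t l)) \<partial>lborel \<partial>T)"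
      by (subst lborel.nn_integral_fst[symmetric]) auto
    also have "\<dots> \<le> (\<integral>\<^sup>+t. \<integral>\<^sup>+l. ennreal (C * (weight 0 1 l * exp (- y * l))) \<partial>lborel \<partial>T)"
      by (intro nn_integral_mono ennreal_leI F_bound)
    also have "\<dots> = (\<integral>\<^sup>+l. ennreal (C * (weight 0 1 l * exp (- y * l))) \<partial>lborel)"
      by (simp add: T.emeasure_space_1)
    also have "\<dots> = ennreal (\<integral>l. C * (weight 0 1 l * exp (- y * l)) \<partial>lborel)"
      using C by (intro nn_integral_eq_integral integrable_mult_right int_w) auto
    also have "\<dots> < \<infinity>" by simp
    finally show "(\<integral>\<^sup>+p. ennreal (norm (case_prod F p)) \<partial>(T \<Otimes>\<^sub>M lborel)) < \<infinity>" .
  qed measurable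
  have "(\<integral>t. k t / (v t + q) \<partial>T) = (\<integral>t. - \<i> * (\<integral>l. F t l \<partial>lborel) \<partial>T)"
  proof (rule Bochner_Integration.integral_cong[OF refl])
    fix t assume t: "t \<in> space T"
    have "Im (v t + q) > 0" using v[OF t] y q by simp
    then have "k t / (v t + q) = k t * (- \<i> * weight_laplace 0 1 (- (\<i> * (v t + q))))"
      by (simp only: resolvent_eq_laplace[symmetric]) simp
    also have "\<dots> = - \<i> * (\<integral>l. F t l \<partial>lborel)"
      unfolding weight_laplace_def F_def by simp
    finally show "k t / (v t + q) = - \<i> * (\<integral>l. F t l \<partial>lborel)" .
  qed
  also have "\<dots> = - \<i> * (\<integral>t. (\<integral>l. F t l \<partial>lborel) \<partial>T)"
    by (rule integral_mult_right_zero)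
  also have "(\<integral>t. (\<integral>l. F t l \<partial>lborel) \<partial>T) = (\<integral>l. (\<integral>t. F t l \<partial>T) \<partial>lborel)"
    by (rule P.Fubini_integral[OF int_F, symmetric])
  also have "\<dots> = (\<integral>l. of_real (weight 0 1 l) * exp (\<i> * of_real l * q) * (\<integral>t. k t * exp (\<i> * of_real l * v t) \<partial>T) \<partial>lborel)"
  proof (rule Bochner_Integration.integral_cong[OF refl])
    fix l
    have "F t l = of_real (weight 0 1 l) * exp (\<i> * of_real l * q) * (k t * exp (\<i> * of_real l * v t))" for t
    proof -
      have "exp (- (- (\<i> * (v t + q))) * of_real l) = exp (\<i> * of_real l * q) * exp (\<i> * of_real l * v t)"
        unfolding mult_exp_exp by (simp add: algebra_simps)
      then show ?thesis by (simp add: F_def)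
    qed
    then show "(\<integral>t. F t l \<partial>T) = of_real (weight 0 1 l) * exp (\<i> * of_real l * q) * (\<integral>t. k t * exp (\<i> * of_real l * v t) \<partial>T)"
      by (simp only: integral_mult_right_zero)
  qed
  finally show ?thesis .
qed

text \<open>
  This is \<open>\<Gamma>(s) (- i (z - x)) powr (- s)\<close>. The integral form is jointly measurable, has an
  evident bound, and makes Gaussian averages computable.
\<close>

definition kern :: "real \<Rightarrow> complex \<Rightarrow> real \<Rightarrow> complex" where
  "kern s z x = weight_laplace 0 s (- (\<i> * (z - of_real x)))"

lemma kern_measurable [measurable]: "kern s z \<in> borel_measurable borel"
  unfolding kern_def[abs_def] weight_laplace_def by measurable

lemma norm_kern_le:
  assumes "s > 0" "Im z > 0"
  shows "cmod (kern s z x) \<le> (\<integral>t. weight 0 s t * exp (- Im z * t) \<partial>lborel)"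
  unfolding kern_def weight_laplace_def
proof (rule integral_norm_le_AE)
  show "integrable lborel (\<lambda>t. weight 0 s t * exp (- Im z * t))"
    using assms by (rule integrable_weight_0)
  show "AE t in lborel. norm (of_real (weight 0 s t) * exp (- (- (\<i> * (z - of_real x))) * of_real t)) \<le> weight 0 s t * exp (- Im z * t)"
    by (intro AE_I2) (simp add: norm_mult)
qed

text \<open>By Fubini the Gaussian average is taken first, where it is the characteristic function.\<close>

lemma integral_kern_exp:
  assumes s: "s > 0" and z: "Im z > 0"
  shows "(\<integral>x. kern s z x * exp (\<i> * of_real l * (z - of_real x)) \<partial>std_normal_distribution) =
    (\<integral>t. of_real (weight 0 s t) * exp (\<i> * of_real (t + l) * z - of_real ((t + l)\<^sup>2 / 2)) \<partial>lborel)"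
proof -
  interpret N: prob_space std_normal_distribution by (rule prob_space_normal_density) simp
  interpret P: pair_sigma_finite std_normal_distribution lborel ..
  define F where "F x t = (of_real (weight 0 s t) * exp (- (- (\<i> * (z - of_real x))) * of_real t)) * exp (\<i> * of_real l * (z - of_real x))" for x t
  have [measurable]: "case_prod F \<in> borel_measurable (std_normal_distribution \<Otimes>\<^sub>M lborel)"
    unfolding F_def by measurable
  have F_norm: "cmod (F x t) = exp (- (l * Im z)) * (weight 0 s t * exp (- Im z * t))" for x t
    by (simp add: F_def norm_mult)
  have int_F: "integrable (std_normal_distribution \<Otimes>\<^sub>M lborel) (case_prod F)"
  proof (rule integrableI_bounded)
    have "(\<integral>\<^sup>+p. ennreal (norm (case_prod F p)) \<partial>(std_normal_distribution \<Otimes>\<^sub>M lborel)) =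
        (\<integral>\<^sup>+x. \<integral>\<^sup>+t. ennreal (cmod (F x t)) \<partial>lborel \<partial>std_normal_distribution)"
      by (subst lborel.nn_integral_fst[symmetric]) auto
    also have "\<dots> = (\<integral>\<^sup>+t. ennreal (exp (- (l * Im z)) * (weight 0 s t * exp (- Im z * t))) \<partial>lborel)"
      unfolding F_norm using N.emeasure_space_1 by simp
    also have "\<dots> = ennreal (\<integral>t. exp (- (l * Im z)) * (weight 0 s t * exp (- Im z * t)) \<partial>lborel)"
      using s z by (intro nn_integral_eq_integral integrable_mult_right integrable_weight_0) auto
    also have "\<dots> < \<infinity>" by simp
    finally show "(\<integral>\<^sup>+p. ennreal (norm (case_prod F p)) \<partial>(std_normal_distribution \<Otimes>\<^sub>M lborel)) < \<infinity>" .
  qed measurable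
  have "(\<integral>x. kern s z x * exp (\<i> * of_real l * (z - of_real x)) \<partial>std_normal_distribution) =
      (\<integral>x. (\<integral>t. F x t \<partial>lborel) \<partial>std_normal_distribution)"
    unfolding F_def kern_def weight_laplace_def by (simp only: integral_mult_left_zero)
  also have "\<dots> = (\<integral>t. (\<integral>x. F x t \<partial>std_normal_distribution) \<partial>lborel)"
    by (rule P.Fubini_integral[OF int_F, symmetric])
  also have "\<dots> = (\<integral>t. of_real (weight 0 s t) * exp (\<i> * of_real (t + l) * z - of_real ((t + l)\<^sup>2 / 2)) \<partial>lborel)"
  proof (rule Bochner_Integration.integral_cong[OF refl])
    fix t
    have F_eq: "F x t = (of_real (weight 0 s t) * exp (\<i> * of_real (t + l) * z)) * exp (- (\<i> * of_real (t + l) * of_real x))" for x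
      unfolding F_def mult.assoc mult_exp_exp by (simp add: algebra_simps)
    have "(\<integral>x. F x t \<partial>std_normal_distribution) =
       (of_real (weight 0 s t) * exp (\<i> * of_real (t + l) * z)) * (\<integral>x. exp (- (\<i> * of_real (t + l) * of_real x)) \<partial>std_normal_distribution)"
      unfolding F_eq by (rule integral_mult_right_zero)
    also have "\<dots> = of_real (weight 0 s t) * (exp (\<i> * of_real (t + l) * z) * exp (- of_real ((t + l)\<^sup>2 / 2)))"
      unfolding integral_std_normal_exp by (rule mult.assoc)
    also have "exp (\<i> * of_real (t + l) * z) * exp (- of_real ((t + l)\<^sup>2 / 2)) = exp (\<i> * of_real (t + l) * z - of_real ((t + l)\<^sup>2 / 2))"
      unfolding mult_exp_exp by simp
    finally show "(\<integral>x. F x t \<partial>std_normal_distribution) = of_real (weight 0 s t) * exp (\<i> * of_real (t + l) * z - of_real ((t + l)\<^sup>2 / 2))" .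
  qed
  finally show ?thesis .
qed

lemma integral_kern:
  assumes s: "s > 0" and z: "Im z > 0"
  shows "(\<integral>x. kern s z x \<partial>std_normal_distribution) = cyl s z"
proof -
  have "of_real (weight 0 s t) * exp (\<i> * of_real (t + 0) * z - of_real ((t + 0)\<^sup>2 / 2)) =
      complex_of_real (weight 1 s t) * exp (- (- (\<i> * z)) * of_real t)" for t
  proof -
    have "complex_of_real (weight 1 s t) = of_real (weight 0 s t) * exp (- of_real (t\<^sup>2 / 2))"
      by (simp add: weight_def exp_of_real[symmetric])
    then show ?thesis
      by (simp add: mult.assoc mult_exp_exp) (simp add: mult.commute mult.left_commute)
  qed
  then show ?thesis
    using integral_kern_exp[OF s z, of 0] by (simp add: cyl_def weight_laplace_def)
qed

text \<open>A complex translation of the Gaussian, read off from the two explicit integrals.\<close>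

lemma integral_kern_shift:
  assumes s: "s > 0" and z: "Im z > 0" and l: "l \<ge> 0"
  shows "exp (\<i> * of_real l * z - of_real (l\<^sup>2 / 2)) * (\<integral>x. kern s (z + \<i> * of_real l) x \<partial>std_normal_distribution) =
    (\<integral>x. kern s z x * exp (\<i> * of_real l * (z - of_real x)) \<partial>std_normal_distribution)"
proof -
  have pt: "exp (\<i> * of_real l * z - of_real (l\<^sup>2 / 2)) * (of_real (weight 0 s t) * exp (\<i> * of_real (t + 0) * (z + \<i> * of_real l) - of_real ((t + 0)\<^sup>2 / 2))) =
     of_real (weight 0 s t) * exp (\<i> * of_real (t + l) * z - of_real ((t + l)\<^sup>2 / 2))" for t
  proof -
    have "\<i> * of_real l * z - of_real (l\<^sup>2 / 2) + (\<i> * of_real (t + 0) * (z + \<i> * of_real l) - of_real ((t + 0)\<^sup>2 / 2)) =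
      \<i> * of_real (t + l) * z - of_real ((t + l)\<^sup>2 / 2)"
      by (simp add: power2_eq_square field_simps)
    then show ?thesis by (simp only: mult.left_commute[of _ "of_real (weight 0 s t)"] mult_exp_exp)
  qed
  have shifted: "(\<integral>x. kern s (z + \<i> * of_real l) x \<partial>std_normal_distribution) =
      (\<integral>t. of_real (weight 0 s t) * exp (\<i> * of_real (t + 0) * (z + \<i> * of_real l) - of_real ((t + 0)\<^sup>2 / 2)) \<partial>lborel)"
    using integral_kern_exp[OF s, of "z + \<i> * of_real l" 0] z l by simp
  show ?thesis
    unfolding integral_kern_exp[OF s z] shifted integral_mult_right_zero[symmetric] pt ..
qed

text \<open>
  This is the step that singles out the weight: the factor produced by averaging over \<open>b\<close>
  shifts the argument of the weight by \<open>i l\<close>.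
\<close>

lemma kern_mult:
  assumes s: "s > 0" and z: "Im z > 0" and l: "l \<ge> 0"
  shows "kern s z x * (1 + \<i> * of_real l / (z - of_real x)) powr (- of_real s) = kern s (z + \<i> * of_real l) x"
proof -
  define w where "w = z - of_real x"
  have w: "Im w > 0" using z by (simp add: w_def)
  then have w0: "w \<noteq> 0" by auto
  have "Re (1 + \<i> * of_real l / w) > 0"
  proof -
    have "Re (\<i> * of_real l / w) = l * Im w / (cmod w)\<^sup>2" by (simp add: Re_divide cmod_power2)
    then show ?thesis using w l by (simp add: add_pos_nonneg)
  qed
  moreover have "Re (- (\<i> * w)) > 0" using w by simp
  ultimately have powr: "((- (\<i> * w)) * (1 + \<i> * of_real l / w)) powr (- of_real s) =
      (- (\<i> * w)) powr (- of_real s) * (1 + \<i> * of_real l / w) powr (- of_real s)"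
    by (intro powr_mult_right_half_plane)
  have prod: "(- (\<i> * w)) * (1 + \<i> * of_real l / w) = - (\<i> * (z + \<i> * of_real l - of_real x))"
    using w0 by (simp add: w_def field_simps)
  have kern_w: "kern s z x = of_real (Gamma s) * (- (\<i> * w)) powr (- of_real s)"
    unfolding kern_def w_def[symmetric] by (rule weight_laplace_gamma[OF s]) (use w in simp)
  have kern_shift: "kern s (z + \<i> * of_real l) x = of_real (Gamma s) * (- (\<i> * (z + \<i> * of_real l - of_real x))) powr (- of_real s)"
    unfolding kern_def by (rule weight_laplace_gamma[OF s]) (use z l in simp)
  show ?thesis
    unfolding kern_w kern_shift prod[symmetric] powr w_def[symmetric] by (rule mult.assoc)
qed

lemma kern_div:
  assumes s: "s > 0" and z: "Im z > 0"
  shows "kern s z x / (z - of_real x) = - \<i> / of_real s * kern (s + 1) z x"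
proof -
  have w0: "z - of_real x \<noteq> 0" using z by (auto simp: complex_eq_iff)
  have "of_real s * kern s z x = - (\<i> * (z - of_real x)) * kern (s + 1) z x"
    using weight_laplace_recurrence[OF s, of 0 "- (\<i> * (z - of_real x))"] z
    by (simp add: kern_def admissible_rate_def)
  then have "kern s z x = - \<i> / of_real s * kern (s + 1) z x * (z - of_real x)"
    using s by (simp add: field_simps)
  then show ?thesis using w0 by simp
qed

section \<open>Invariance of the weight under one random step\<close>

text \<open>
  Averaging over a pair of independent variables may be done with two independent copies of
  the probability space.
\<close>

lemma (in prob_space) expectation_decouple:
  fixes \<phi> :: "'s \<times> 's \<Rightarrow> complex"
  assumes indep: "indep_var S X T Y" and [measurable]: "\<phi> \<in> borel_measurable (S \<Otimes>\<^sub>M T)"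
    and bound: "\<And>p. p \<in> space (S \<Otimes>\<^sub>M T) \<Longrightarrow> cmod (\<phi> p) \<le> C"
  shows "(\<integral>\<omega>. \<phi> (X \<omega>, Y \<omega>) \<partial>M) = (\<integral>\<omega>. (\<integral>\<omega>'. \<phi> (X \<omega>, Y \<omega>') \<partial>M) \<partial>M)"
proof -
  have [measurable]: "X \<in> measurable M S" "Y \<in> measurable M T"
    using indep by (auto dest: indep_var_rv1 indep_var_rv2)
  interpret X: prob_space "distr M S X" by (rule prob_space_distr) simp
  interpret Y: prob_space "distr M T Y" by (rule prob_space_distr) simp
  interpret P: pair_prob_space "distr M S X" "distr M T Y" ..
  have int: "integrable (distr M S X \<Otimes>\<^sub>M distr M T Y) \<phi>"
    by (rule integrable_bounded[where C = C]) (use bound in \<open>auto simp: space_pair_measure intro!: P.P.finite_measure_axioms\<close>)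
  have "(\<integral>\<omega>. \<phi> (X \<omega>, Y \<omega>) \<partial>M) = (\<integral>p. \<phi> p \<partial>distr M (S \<Otimes>\<^sub>M T) (\<lambda>\<omega>. (X \<omega>, Y \<omega>)))"
    by (subst integral_distr) auto
  also have "distr M (S \<Otimes>\<^sub>M T) (\<lambda>\<omega>. (X \<omega>, Y \<omega>)) = distr M S X \<Otimes>\<^sub>M distr M T Y"
    using indep by (simp add: indep_var_distribution_eq)
  also have "(\<integral>p. \<phi> p \<partial>(distr M S X \<Otimes>\<^sub>M distr M T Y)) = (\<integral>x. (\<integral>y. \<phi> (x, y) \<partial>distr M T Y) \<partial>distr M S X)"
    by (rule P.integral_fst'[OF int, symmetric])
  also have "\<dots> = (\<integral>\<omega>. (\<integral>y. \<phi> (X \<omega>, y) \<partial>distr M T Y) \<partial>M)"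
    by (rule integral_distr) measurable
  also have "\<dots> = (\<integral>\<omega>. (\<integral>\<omega>'. \<phi> (X \<omega>, Y \<omega>') \<partial>M) \<partial>M)"
  proof (rule Bochner_Integration.integral_cong[OF refl])
    fix \<omega> assume "\<omega> \<in> space M"
    then have [measurable]: "X \<omega> \<in> space S" using \<open>X \<in> measurable M S\<close> by (rule measurable_space[rotated])
    show "(\<integral>y. \<phi> (X \<omega>, y) \<partial>distr M T Y) = (\<integral>\<omega>'. \<phi> (X \<omega>, Y \<omega>') \<partial>M)"
      by (rule integral_distr) measurable
  qed
  finally show ?thesis .
qed

locale random_jacobi = prob_space M for M :: "'w measure" +
  fixes \<alpha> :: real and a b :: "nat \<Rightarrow> 'w \<Rightarrow> real"
  assumes alpha: "\<alpha> > 0"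
    and dist_a: "\<And>i. distributed M lborel (a i) (\<lambda>x. ennreal (std_normal_density x))"
    and dist_b: "\<And>j. distributed M lborel (b j) (\<lambda>u. ennreal (chi_tilde_density (2 * \<alpha>) u))"
    and indep: "indep_vars (\<lambda>_. borel) (\<lambda>s. case s of Inl i \<Rightarrow> a i | Inr j \<Rightarrow> b j) (UNIV :: (nat + nat) set)"
begin

abbreviation entry :: "nat + nat \<Rightarrow> 'w \<Rightarrow> real" where
  "entry \<equiv> (\<lambda>s. case s of Inl i \<Rightarrow> a i | Inr j \<Rightarrow> b j)"

lemma a_measurable [measurable]: "a i \<in> borel_measurable M"
  using distributed_measurable[OF dist_a[of i]] by simp

lemma b_measurable [measurable]: "b i \<in> borel_measurable M"
  using distributed_measurable[OF dist_b[of i]] by simp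

lemma expectation_a:
  fixes f :: "real \<Rightarrow> 'e::{banach, second_countable_topology}"
  assumes [measurable]: "f \<in> borel_measurable borel"
  shows "(\<integral>\<omega>. f (a i \<omega>) \<partial>M) = (\<integral>x. f x \<partial>std_normal_distribution)"
proof -
  have "(\<integral>\<omega>. f (a i \<omega>) \<partial>M) = (\<integral>x. f x \<partial>distr M lborel (a i))"
    by (rule integral_distr[symmetric]) measurable
  then show ?thesis unfolding distributed_distr_eq_density[OF dist_a] by simp
qed

lemma expectation_b:
  fixes f :: "real \<Rightarrow> 'e::{banach, second_countable_topology}"
  assumes [measurable]: "f \<in> borel_measurable borel"
  shows "(\<integral>\<omega>. f (b i \<omega>) \<partial>M) = (\<integral>u. chi_tilde_density (2 * \<alpha>) u *\<^sub>R f u \<partial>lborel)"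
proof -
  have "(\<integral>\<omega>. f (b i \<omega>) \<partial>M) = (\<integral>x. f x \<partial>distr M lborel (b i))"
    by (rule integral_distr[symmetric]) measurable
  also have "\<dots> = (\<integral>u. chi_tilde_density (2 * \<alpha>) u *\<^sub>R f u \<partial>lborel)"
    unfolding distributed_distr_eq_density[OF dist_b]
    by (rule integral_density) (use chi_tilde_density_nonneg[OF alpha] in auto)
  finally show ?thesis .
qed

text \<open>The exponential factors over the independent entries \<open>a n\<close> and \<open>b n\<close>.\<close>

lemma expectation_exp_step:
  assumes w: "Im w > 0" and l: "l \<ge> 0"
  shows "(\<integral>\<omega>. exp (\<i> * of_real l * (z - of_real (a n \<omega>) - of_real ((b n \<omega>)\<^sup>2) / w)) \<partial>M) =
    exp (\<i> * of_real l * z - of_real (l\<^sup>2 / 2)) * (1 + \<i> * of_real l / w) powr (- of_real \<alpha>)"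
proof -
  define f where "f x = exp (- (\<i> * of_real l * of_real x))" for x :: real
  define g where "g u = exp (- (\<i> * of_real l / w) * of_real (u\<^sup>2))" for u :: real
  have [measurable]: "f \<in> borel_measurable borel" "g \<in> borel_measurable borel"
    unfolding f_def[abs_def] g_def[abs_def] by measurable
  have Re_nonneg: "Re (\<i> * of_real l / w) \<ge> 0"
    using w l by (simp add: Re_divide)
  have f_norm: "cmod (f x) \<le> 1" for x by (simp add: f_def)
  have g_norm: "cmod (g u) \<le> 1" for u
  proof -
    have "0 \<le> Re (\<i> * of_real l / w) * u\<^sup>2" using Re_nonneg by (rule mult_nonneg_nonneg) simp
    moreover have "Re (- \<kappa> * of_real v) = - (Re \<kappa> * v)" for \<kappa> v by simp
    ultimately show ?thesis unfolding g_def norm_exp_eq_Re by (simp only: exp_le_one_iff neg_le_0_iff_le)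
  qed
  have "indep_var (PiM {Inl n} (\<lambda>_. borel)) (\<lambda>\<omega>. restrict (\<lambda>s. entry s \<omega>) {Inl n})
      (PiM {Inr n} (\<lambda>_. borel)) (\<lambda>\<omega>. restrict (\<lambda>s. entry s \<omega>) {Inr n})"
    by (rule indep_var_restrict[OF indep]) auto
  from indep_var_compose[OF this, of "\<lambda>x. f (x (Inl n))" borel "\<lambda>x. g (x (Inr n))" borel]
  have "indep_var borel ((\<lambda>x. f (x (Inl n))) \<circ> (\<lambda>\<omega>. restrict (\<lambda>s. entry s \<omega>) {Inl n}))
      borel ((\<lambda>x. g (x (Inr n))) \<circ> (\<lambda>\<omega>. restrict (\<lambda>s. entry s \<omega>) {Inr n}))"
    by (auto simp: measurable_compose[OF measurable_component_singleton])
  then have ind: "indep_var borel (\<lambda>\<omega>. f (a n \<omega>)) borel (\<lambda>\<omega>. g (b n \<omega>))"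
    by (simp add: comp_def)
  have int: "integrable M (\<lambda>\<omega>. f (a n \<omega>))" "integrable M (\<lambda>\<omega>. g (b n \<omega>))"
    using f_norm g_norm by (auto intro!: integrable_const_bound[where B = 1])
  have split: "exp (\<i> * of_real l * (z - of_real (a n \<omega>) - of_real ((b n \<omega>)\<^sup>2) / w)) =
      exp (\<i> * of_real l * z) * (f (a n \<omega>) * g (b n \<omega>))" for \<omega>
    unfolding f_def g_def mult_exp_exp by (simp add: algebra_simps)
  have "(\<integral>\<omega>. exp (\<i> * of_real l * (z - of_real (a n \<omega>) - of_real ((b n \<omega>)\<^sup>2) / w)) \<partial>M) =
      exp (\<i> * of_real l * z) * (\<integral>\<omega>. f (a n \<omega>) * g (b n \<omega>) \<partial>M)"
    unfolding split by (rule integral_mult_right_zero)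
  also have "(\<integral>\<omega>. f (a n \<omega>) * g (b n \<omega>) \<partial>M) = (\<integral>\<omega>. f (a n \<omega>) \<partial>M) * (\<integral>\<omega>. g (b n \<omega>) \<partial>M)"
    by (rule indep_var_lebesgue_integral[OF ind int])
  also have "(\<integral>\<omega>. f (a n \<omega>) \<partial>M) = exp (- of_real (l\<^sup>2 / 2))"
    unfolding expectation_a[OF \<open>f \<in> borel_measurable borel\<close>] unfolding f_def by (rule integral_std_normal_exp)
  also have "(\<integral>\<omega>. g (b n \<omega>) \<partial>M) = (1 + \<i> * of_real l / w) powr (- of_real \<alpha>)"
    unfolding expectation_b[OF \<open>g \<in> borel_measurable borel\<close>]
    unfolding g_def scaleR_conv_of_real by (rule chi_tilde_laplace[OF alpha Re_nonneg])
  also have "exp (\<i> * of_real l * z) * (exp (- of_real (l\<^sup>2 / 2)) * (1 + \<i> * of_real l / w) powr (- of_real \<alpha>)) =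
      exp (\<i> * of_real l * z - of_real (l\<^sup>2 / 2)) * (1 + \<i> * of_real l / w) powr (- of_real \<alpha>)"
    by (simp only: mult.assoc[symmetric] mult_exp_exp) simp
  finally show ?thesis .
qed

text \<open>
  The innermost level of the continued fraction, with random entries and with terminal value
  \<open>z - x\<close>, where \<open>x\<close> will be Gaussian.
\<close>

definition random_step :: "complex \<Rightarrow> nat \<Rightarrow> 'w \<times> real \<Rightarrow> complex" where
  "random_step z n p = z - of_real (a n (fst p)) - of_real ((b n (fst p))\<^sup>2) / (z - of_real (snd p))"

lemma step_measurable [measurable]: "random_step z n \<in> borel_measurable (M \<Otimes>\<^sub>M std_normal_distribution)"
  unfolding random_step_def[abs_def] by measurable

lemma Im_random_step: "Im z > 0 \<Longrightarrow> Im (random_step z n p) \<ge> Im z"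
  unfolding random_step_def by (rule Im_continued_fraction_step) simp

definition kern_bound :: "complex \<Rightarrow> real" where
  "kern_bound z = (\<integral>t. weight 0 \<alpha> t * exp (- Im z * t) \<partial>lborel)"

lemma kern_le_bound: "Im z > 0 \<Longrightarrow> cmod (kern \<alpha> z x) \<le> kern_bound z"
  unfolding kern_bound_def by (rule norm_kern_le[OF alpha])

lemma prob_space_normal: "prob_space std_normal_distribution"
  by (rule prob_space_normal_density) simp

lemma prob_space_pair_normal: "prob_space (M \<Otimes>\<^sub>M std_normal_distribution)"
proof -
  interpret N: prob_space std_normal_distribution by (rule prob_space_normal)
  interpret pair_prob_space M std_normal_distribution ..
  show ?thesis by (rule P.prob_space_axioms)
qed

text \<open>
  Averaging over the entries replaces the exponential by \<open>(1 + i l / (z - x)) powr (- \<alpha>)\<close>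
  and a constant. The power shifts the weight to \<open>z + i l\<close>, and a Gaussian translation
  undoes the shift.
\<close>

lemma step_invariant_exp:
  assumes z: "Im z > 0" and l: "l \<ge> 0"
  shows "(\<integral>p. kern \<alpha> z (snd p) * exp (\<i> * of_real l * random_step z n p) \<partial>(M \<Otimes>\<^sub>M std_normal_distribution)) =
    (\<integral>x. kern \<alpha> z x * exp (\<i> * of_real l * (z - of_real x)) \<partial>std_normal_distribution)"
proof -
  interpret N: prob_space std_normal_distribution by (rule prob_space_normal)
  interpret P: pair_prob_space M std_normal_distribution ..
  have "cmod (kern \<alpha> z (snd p) * exp (\<i> * of_real l * random_step z n p)) \<le> kern_bound z * 1" for p
    unfolding norm_mult
  proof (rule mult_mono)
    have "0 \<le> l * Im (random_step z n p)" using Im_random_step[OF z, of n p] z l by simp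
    then show "cmod (exp (\<i> * of_real l * random_step z n p)) \<le> 1" by simp
    show "0 \<le> kern_bound z" using order.trans[OF norm_ge_zero kern_le_bound[OF z]] .
  qed (auto simp: kern_le_bound[OF z])
  then have int: "integrable (M \<Otimes>\<^sub>M std_normal_distribution) (\<lambda>(\<omega>, x). kern \<alpha> z x * exp (\<i> * of_real l * random_step z n (\<omega>, x)))"
    by (intro integrable_bounded[where C = "kern_bound z * 1"] P.P.finite_measure_axioms) (auto simp: case_prod_beta)
  have "(\<integral>p. kern \<alpha> z (snd p) * exp (\<i> * of_real l * random_step z n p) \<partial>(M \<Otimes>\<^sub>M std_normal_distribution)) =
      (\<integral>x. (\<integral>\<omega>. kern \<alpha> z x * exp (\<i> * of_real l * random_step z n (\<omega>, x)) \<partial>M) \<partial>std_normal_distribution)"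
    unfolding P.integral_snd[OF int] by (intro Bochner_Integration.integral_cong) auto
  also have "\<dots> = (\<integral>x. exp (\<i> * of_real l * z - of_real (l\<^sup>2 / 2)) * kern \<alpha> (z + \<i> * of_real l) x \<partial>std_normal_distribution)"
  proof (rule Bochner_Integration.integral_cong[OF refl])
    fix x
    have "(\<integral>\<omega>. kern \<alpha> z x * exp (\<i> * of_real l * random_step z n (\<omega>, x)) \<partial>M) =
        kern \<alpha> z x * (\<integral>\<omega>. exp (\<i> * of_real l * random_step z n (\<omega>, x)) \<partial>M)"
      by (rule integral_mult_right_zero)
    also have "(\<integral>\<omega>. exp (\<i> * of_real l * random_step z n (\<omega>, x)) \<partial>M) =
        exp (\<i> * of_real l * z - of_real (l\<^sup>2 / 2)) * (1 + \<i> * of_real l / (z - of_real x)) powr (- of_real \<alpha>)"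
      unfolding random_step_def fst_conv snd_conv using z l by (intro expectation_exp_step) auto
    finally show "(\<integral>\<omega>. kern \<alpha> z x * exp (\<i> * of_real l * random_step z n (\<omega>, x)) \<partial>M) =
        exp (\<i> * of_real l * z - of_real (l\<^sup>2 / 2)) * kern \<alpha> (z + \<i> * of_real l) x"
      unfolding kern_mult[OF alpha z l, of x, symmetric] by simp
  qed
  also have "\<dots> = (\<integral>x. kern \<alpha> z x * exp (\<i> * of_real l * (z - of_real x)) \<partial>std_normal_distribution)"
    unfolding integral_mult_right_zero by (rule integral_kern_shift[OF alpha z l])
  finally show ?thesis .
qed

lemma step_invariant_resolvent:
  assumes z: "Im z > 0" and q: "Im q \<ge> 0"
  shows "(\<integral>p. kern \<alpha> z (snd p) / (random_step z n p + q) \<partial>(M \<Otimes>\<^sub>M std_normal_distribution)) =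
    (\<integral>x. kern \<alpha> z x / (z - of_real x + q) \<partial>std_normal_distribution)"
proof -
  have 1: "(\<integral>p. kern \<alpha> z (snd p) / (random_step z n p + q) \<partial>(M \<Otimes>\<^sub>M std_normal_distribution)) =
    - \<i> * (\<integral>l. of_real (weight 0 1 l) * exp (\<i> * of_real l * q) *
      (\<integral>p. kern \<alpha> z (snd p) * exp (\<i> * of_real l * random_step z n p) \<partial>(M \<Otimes>\<^sub>M std_normal_distribution)) \<partial>lborel)"
    by (rule resolvent_integral_eq_laplace[OF prob_space_pair_normal _ _ kern_le_bound[OF z] Im_random_step[OF z] z q]) measurable
  have 2: "(\<integral>x. kern \<alpha> z x / (z - of_real x + q) \<partial>std_normal_distribution) =
    - \<i> * (\<integral>l. of_real (weight 0 1 l) * exp (\<i> * of_real l * q) *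
      (\<integral>x. kern \<alpha> z x * exp (\<i> * of_real l * (z - of_real x)) \<partial>std_normal_distribution) \<partial>lborel)"
    by (rule resolvent_integral_eq_laplace[OF prob_space_normal _ _ kern_le_bound[OF z] _ z q]) auto
  show ?thesis
    unfolding 1 2
  proof (intro arg_cong[where f = "\<lambda>u. - \<i> * u"] Bochner_Integration.integral_cong refl)
    fix l :: real
    show "of_real (weight 0 1 l) * exp (\<i> * of_real l * q) *
      (\<integral>p. kern \<alpha> z (snd p) * exp (\<i> * of_real l * random_step z n p) \<partial>(M \<Otimes>\<^sub>M std_normal_distribution)) =
      of_real (weight 0 1 l) * exp (\<i> * of_real l * q) *
      (\<integral>x. kern \<alpha> z x * exp (\<i> * of_real l * (z - of_real x)) \<partial>std_normal_distribution)"
      using step_invariant_exp[OF z, of l n] by (cases "l > 0") (simp_all add: weight_def)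
  qed
qed

text \<open>
  As a function of its terminal value the continued fraction has the form \<open>A + B / (w + q)\<close>,
  which reduces the claim to resolvents and constants.
\<close>

lemma step_invariant_tail_resolvent:
  assumes z: "Im z > 0"
  shows "(\<integral>p. kern \<alpha> z (snd p) * tail_resolvent c d z m (random_step z n p) \<partial>(M \<Otimes>\<^sub>M std_normal_distribution)) =
    (\<integral>x. kern \<alpha> z x * tail_resolvent c d z m (z - of_real x) \<partial>std_normal_distribution)"
proof -
  interpret N: prob_space std_normal_distribution by (rule prob_space_normal)
  interpret P: pair_prob_space M std_normal_distribution ..
  obtain A B q where q: "Im q \<ge> 0" and tm: "\<And>w. Im w > 0 \<Longrightarrow> tail_resolvent c d z m w = A + B / (w + q)"
    using tail_resolvent_moebius[OF z, of c d m] by blast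
  have C0: "kern_bound z \<ge> 0" using order.trans[OF norm_ge_zero kern_le_bound[OF z]] .
  have kern_div_bound: "cmod (kern \<alpha> z x / (w + q)) \<le> kern_bound z / Im z" if "Im w \<ge> Im z" for x w
  proof -
    have "Im z \<le> cmod (w + q)" using abs_Im_le_cmod[of "w + q"] q that by simp
    then show ?thesis
      unfolding norm_divide using z C0 kern_le_bound[OF z] by (intro frac_le) auto
  qed
  have int1: "integrable (M \<Otimes>\<^sub>M std_normal_distribution) (\<lambda>p. kern \<alpha> z (snd p))"
    by (intro integrable_bounded[OF P.P.finite_measure_axioms _ kern_le_bound[OF z]]) measurable
  have int2: "integrable (M \<Otimes>\<^sub>M std_normal_distribution) (\<lambda>p. kern \<alpha> z (snd p) / (random_step z n p + q))"
    by (intro integrable_bounded[OF P.P.finite_measure_axioms _ kern_div_bound[OF Im_random_step[OF z]]]) measurable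
  have int3: "integrable std_normal_distribution (kern \<alpha> z)"
    by (intro integrable_bounded[OF N.finite_measure_axioms _ kern_le_bound[OF z]]) measurable
  have int4: "integrable std_normal_distribution (\<lambda>x. kern \<alpha> z x / (z - of_real x + q))"
    by (intro integrable_bounded[OF N.finite_measure_axioms _ kern_div_bound]) auto
  have "(\<integral>p. kern \<alpha> z (snd p) * tail_resolvent c d z m (random_step z n p) \<partial>(M \<Otimes>\<^sub>M std_normal_distribution)) =
      (\<integral>p. A * kern \<alpha> z (snd p) + B * (kern \<alpha> z (snd p) / (random_step z n p + q)) \<partial>(M \<Otimes>\<^sub>M std_normal_distribution))"
  proof (rule Bochner_Integration.integral_cong[OF refl])
    fix p
    have "Im (random_step z n p) > 0" using Im_random_step[OF z, of n p] z by simp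
    then show "kern \<alpha> z (snd p) * tail_resolvent c d z m (random_step z n p) = A * kern \<alpha> z (snd p) + B * (kern \<alpha> z (snd p) / (random_step z n p + q))"
      by (simp add: tm distrib_left mult.commute)
  qed
  also have "\<dots> = A * (\<integral>p. kern \<alpha> z (snd p) \<partial>(M \<Otimes>\<^sub>M std_normal_distribution)) +
      B * (\<integral>p. kern \<alpha> z (snd p) / (random_step z n p + q) \<partial>(M \<Otimes>\<^sub>M std_normal_distribution))"
    using int1 int2 by (simp del: times_divide_eq_right)
  also have "(\<integral>p. kern \<alpha> z (snd p) \<partial>(M \<Otimes>\<^sub>M std_normal_distribution)) = (\<integral>x. kern \<alpha> z x \<partial>std_normal_distribution)"
  proof -
    have "(\<integral>p. kern \<alpha> z (snd p) \<partial>(M \<Otimes>\<^sub>M std_normal_distribution)) = (\<integral>\<omega>. (\<integral>x. kern \<alpha> z x \<partial>std_normal_distribution) \<partial>M)"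
      using P.integral_fst'[OF int1] by simp
    then show ?thesis by (simp add: prob_space)
  qed
  also have "A * (\<integral>x. kern \<alpha> z x \<partial>std_normal_distribution) +
      B * (\<integral>p. kern \<alpha> z (snd p) / (random_step z n p + q) \<partial>(M \<Otimes>\<^sub>M std_normal_distribution)) =
      (\<integral>x. A * kern \<alpha> z x + B * (kern \<alpha> z x / (z - of_real x + q)) \<partial>std_normal_distribution)"
    unfolding step_invariant_resolvent[OF z q] using int3 int4 by (simp del: times_divide_eq_right)
  also have "\<dots> = (\<integral>x. kern \<alpha> z x * tail_resolvent c d z m (z - of_real x) \<partial>std_normal_distribution)"
    using z by (intro Bochner_Integration.integral_cong refl) (simp add: tm distrib_left mult.commute)
  finally show ?thesis .
qed

definition weighted_tail :: "complex \<Rightarrow> nat \<Rightarrow> complex" where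
  "weighted_tail z n = (\<integral>\<omega>. (\<integral>x. kern \<alpha> z x * tail_resolvent (\<lambda>i. a i \<omega>) (\<lambda>i. b i \<omega>) z n (z - of_real x) \<partial>std_normal_distribution) \<partial>M)"

lemma kern_tail_bound:
  assumes z: "Im z > 0" and w: "Im w \<ge> Im z"
  shows "cmod (kern \<alpha> z x * tail_resolvent c d z n w) \<le> kern_bound z * (1 / Im z)"
  unfolding norm_mult
proof (rule mult_mono[OF kern_le_bound[OF z] norm_tail_resolvent_le[OF z w]])
  show "0 \<le> kern_bound z" using order.trans[OF norm_ge_zero kern_le_bound[OF z]] .
qed simp

text \<open>
  The innermost pair of entries is independent of the outer ones, so it may be averaged with
  the outer entries frozen; then the invariance applies.
\<close>

lemma weighted_tail_Suc:
  assumes z: "Im z > 0"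
  shows "weighted_tail z (Suc n) = weighted_tail z n"
proof -
  interpret N: prob_space std_normal_distribution by (rule prob_space_normal)
  interpret P: pair_prob_space M std_normal_distribution ..
  \<comment> \<open>the outer entries and the innermost pair\<close>
  define I where "I = Inl ` {..<n} \<union> (Inr ` {..<n} :: (nat + nat) set)"
  define J where "J = ({Inl n, Inr n} :: (nat + nat) set)"
  define X where "X \<omega> = restrict (\<lambda>s. entry s \<omega>) I" for \<omega>
  define Y where "Y \<omega> = restrict (\<lambda>s. entry s \<omega>) J" for \<omega>
  define S where "S = PiM I (\<lambda>_. borel :: real measure)"
  define T where "T = PiM J (\<lambda>_. borel :: real measure)"
  have ind: "indep_var S X T Y"
    unfolding S_def T_def X_def[abs_def] Y_def[abs_def]
    by (rule indep_var_restrict[OF indep]) (auto simp: I_def J_def)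
  have compS [measurable]: "(\<lambda>x. x s) \<in> borel_measurable S" if "s \<in> I" for s
    unfolding S_def using that by (rule measurable_component_singleton)
  have compT [measurable]: "(\<lambda>x. x (Inl n)) \<in> borel_measurable T" "(\<lambda>x. x (Inr n)) \<in> borel_measurable T"
    unfolding T_def J_def by (auto intro!: measurable_component_singleton)
  have [measurable]: "(\<lambda>x. x (Inl i)) \<in> borel_measurable S" "(\<lambda>x. x (Inr i)) \<in> borel_measurable S" if "i < n" for i
    using that by (auto intro!: compS simp: I_def)
  define G where "G = (\<lambda>((x, y), t). kern \<alpha> z t * tail_resolvent (\<lambda>i. x (Inl i)) (\<lambda>i. x (Inr i)) z n
      (z - of_real (y (Inl n)) - of_real ((y (Inr n))\<^sup>2) / (z - of_real t)))"
  have [measurable]: "G \<in> borel_measurable ((S \<Otimes>\<^sub>M T) \<Otimes>\<^sub>M std_normal_distribution)"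
    unfolding G_def case_prod_beta by measurable
  define \<phi> where "\<phi> p = (\<integral>t. G (p, t) \<partial>std_normal_distribution)" for p
  have [measurable]: "\<phi> \<in> borel_measurable (S \<Otimes>\<^sub>M T)"
    unfolding \<phi>_def[abs_def] by measurable
  have G_bound: "cmod (G (p, t)) \<le> kern_bound z * (1 / Im z)" for p t
    unfolding G_def case_prod_beta fst_conv snd_conv
    by (intro kern_tail_bound[OF z] Im_continued_fraction_step) (use z in simp)
  have \<phi>_bound: "cmod (\<phi> p) \<le> kern_bound z * (1 / Im z)" for p
  proof -
    have "cmod (\<phi> p) \<le> (\<integral>t. kern_bound z * (1 / Im z) \<partial>std_normal_distribution)"
      unfolding \<phi>_def by (rule integral_norm_le_AE) (use G_bound in auto)
    then show ?thesis using N.prob_space by simp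
  qed
  have G_XY: "G ((X \<omega>, Y \<omega>'), t) = kern \<alpha> z t * tail_resolvent (\<lambda>i. a i \<omega>) (\<lambda>i. b i \<omega>) z n (random_step z n (\<omega>', t))" for \<omega> \<omega>' t
  proof -
    have "tail_resolvent (\<lambda>i. X \<omega> (Inl i)) (\<lambda>i. X \<omega> (Inr i)) z n w = tail_resolvent (\<lambda>i. a i \<omega>) (\<lambda>i. b i \<omega>) z n w" for w
      by (rule tail_resolvent_cong) (auto simp: X_def I_def)
    then show ?thesis by (simp add: G_def random_step_def Y_def J_def)
  qed
  have "weighted_tail z (Suc n) = (\<integral>\<omega>. \<phi> (X \<omega>, Y \<omega>) \<partial>M)"
    unfolding weighted_tail_def \<phi>_def G_XY by (simp add: random_step_def)
  also have "\<dots> = (\<integral>\<omega>. (\<integral>\<omega>'. \<phi> (X \<omega>, Y \<omega>') \<partial>M) \<partial>M)"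
    by (rule expectation_decouple[OF ind _ \<phi>_bound]) measurable
  also have "\<dots> = weighted_tail z n"
    unfolding weighted_tail_def
  proof (rule Bochner_Integration.integral_cong[OF refl])
    fix \<omega>
    let ?h = "\<lambda>p. kern \<alpha> z (snd p) * tail_resolvent (\<lambda>i. a i \<omega>) (\<lambda>i. b i \<omega>) z n (random_step z n p)"
    have int: "integrable (M \<Otimes>\<^sub>M std_normal_distribution) ?h"
      by (intro integrable_bounded[OF P.P.finite_measure_axioms _ kern_tail_bound[OF z Im_random_step[OF z]]]) measurable
    have "(\<integral>\<omega>'. \<phi> (X \<omega>, Y \<omega>') \<partial>M) = (\<integral>p. ?h p \<partial>(M \<Otimes>\<^sub>M std_normal_distribution))"
      unfolding \<phi>_def G_XY using P.integral_fst'[OF int] by simp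
    also have "\<dots> = (\<integral>x. kern \<alpha> z x * tail_resolvent (\<lambda>i. a i \<omega>) (\<lambda>i. b i \<omega>) z n (z - of_real x) \<partial>std_normal_distribution)"
      by (rule step_invariant_tail_resolvent[OF z])
    finally show "(\<integral>\<omega>'. \<phi> (X \<omega>, Y \<omega>') \<partial>M) = \<dots>" .
  qed
  finally show ?thesis .
qed

text \<open>Reduce to depth 0, where the weight is divided by \<open>z - x\<close>, which raises its order by one.\<close>

lemma weighted_tail_eq:
  assumes z: "Im z > 0"
  shows "weighted_tail z n = - \<i> / of_real \<alpha> * cyl (\<alpha> + 1) z"
proof -
  have "weighted_tail z n = weighted_tail z 0"
    by (induction n) (simp_all add: weighted_tail_Suc[OF z])
  also have "\<dots> = (\<integral>x. kern \<alpha> z x / (z - of_real x) \<partial>std_normal_distribution)"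
    by (simp add: weighted_tail_def prob_space)
  also have "\<dots> = - \<i> / of_real \<alpha> * (\<integral>x. kern (\<alpha> + 1) z x \<partial>std_normal_distribution)"
    unfolding kern_div[OF alpha z] by (rule integral_mult_right_zero)
  also have "(\<integral>x. kern (\<alpha> + 1) z x \<partial>std_normal_distribution) = cyl (\<alpha> + 1) z"
    using alpha by (intro integral_kern[OF _ z]) simp
  finally show ?thesis .
qed

end

section \<open>The mean spectral measure\<close>

lemma poisson_le: "y > 0 \<Longrightarrow> poisson y x \<le> 1 / (pi * y)"
proof -
  assume y: "y > 0"
  have "y / (pi * (x\<^sup>2 + y\<^sup>2)) \<le> y / (pi * y\<^sup>2)"
    using y by (intro divide_left_mono mult_left_mono mult_pos_pos) (auto simp: add_nonneg_pos)
  then show ?thesis using y by (simp add: poisson_def power2_eq_square)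
qed

text \<open>
  The modulus of the transform is only bounded by \<open>1 / y\<close>, which is not integrable in \<open>x\<close>.
  Its imaginary part is a Poisson integral of total mass \<open>\<pi>\<close>, which justifies Fubini below.
\<close>

lemma (in real_distribution) nn_integral_stieltjes_bound:
  fixes f :: "real \<Rightarrow> real"
  assumes y: "y > 0" and B: "\<And>x. \<bar>f x\<bar> \<le> B"
  shows "(\<integral>\<^sup>+x. ennreal (norm (f x * (- Im (stieltjes M (Complex x y)) / pi))) \<partial>lborel) \<le> ennreal B"
proof -
  interpret P: pair_sigma_finite lborel M ..
  have B0: "B \<ge> 0" using order.trans[OF abs_ge_zero B] .
  have int: "integrable M (\<lambda>t. poisson y (x - t))" for x
    by (rule integrable_const_bound[where B = "1 / (pi * y)"]) (use y poisson_le poisson_nonneg in auto)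
  have "(\<integral>\<^sup>+x. ennreal (norm (f x * (- Im (stieltjes M (Complex x y)) / pi))) \<partial>lborel) \<le>
      (\<integral>\<^sup>+x. ennreal B * (\<integral>\<^sup>+t. ennreal (poisson y (x - t)) \<partial>M) \<partial>lborel)"
  proof (rule nn_integral_mono)
    fix x
    have "norm (f x * (- Im (stieltjes M (Complex x y)) / pi)) = \<bar>f x\<bar> * (\<integral>t. poisson y (x - t) \<partial>M)"
      unfolding Im_stieltjes[OF y] using y
      by (simp add: abs_mult poisson_nonneg Bochner_Integration.integral_nonneg)
    also have "\<dots> \<le> B * (\<integral>t. poisson y (x - t) \<partial>M)"
      using y by (intro mult_right_mono B Bochner_Integration.integral_nonneg) (simp add: poisson_nonneg)
    finally have "ennreal (norm (f x * (- Im (stieltjes M (Complex x y)) / pi))) \<le> ennreal (B * (\<integral>t. poisson y (x - t) \<partial>M))"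
      by (rule ennreal_leI)
    also have "\<dots> = ennreal B * ennreal (\<integral>t. poisson y (x - t) \<partial>M)"
      using B0 by (rule ennreal_mult') 
    also have "ennreal (\<integral>t. poisson y (x - t) \<partial>M) = (\<integral>\<^sup>+t. ennreal (poisson y (x - t)) \<partial>M)"
      using y by (intro nn_integral_eq_integral[symmetric] int) (simp add: poisson_nonneg)
    finally show "ennreal (norm (f x * (- Im (stieltjes M (Complex x y)) / pi))) \<le> ennreal B * (\<integral>\<^sup>+t. ennreal (poisson y (x - t)) \<partial>M)" .
  qed
  also have "\<dots> = ennreal B * (\<integral>\<^sup>+x. (\<integral>\<^sup>+t. ennreal (poisson y (x - t)) \<partial>M) \<partial>lborel)"
    by (intro nn_integral_cmult) measurable
  also have "(\<integral>\<^sup>+x. (\<integral>\<^sup>+t. ennreal (poisson y (x - t)) \<partial>M) \<partial>lborel) = (\<integral>\<^sup>+t. (\<integral>\<^sup>+x. ennreal (poisson y (x - t)) \<partial>lborel) \<partial>M)"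
    by (rule P.Fubini'[symmetric]) measurable
  also have "\<dots> = 1"
    unfolding nn_integral_poisson[OF y] using emeasure_space_1 by simp
  finally show ?thesis by simp
qed

lemma measurable_completion_AE_eq:
  fixes f g :: "'a \<Rightarrow> real"
  assumes g: "g \<in> borel_measurable M" and eq: "AE x in M. f x = g x"
  shows "f \<in> borel_measurable (completion M)"
proof (rule borel_measurableI)
  fix S :: "real set" assume "open S"
  have [measurable]: "g \<in> borel_measurable (completion M)" by (rule measurable_completion[OF g])
  have "Measurable.pred (completion M) (\<lambda>x. \<not> f x = g x)"
    by (rule sets_completion_AE) (use eq in simp)
  then have ne: "{x \<in> space M. \<not> f x = g x} \<in> sets (completion M)" by (simp add: pred_def)
  have "Measurable.pred (completion M) (\<lambda>x. f x \<in> S \<and> \<not> f x = g x)"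
    by (rule sets_completion_AE) (use eq in auto)
  then have ne': "{x \<in> space M. f x \<in> S \<and> \<not> f x = g x} \<in> sets (completion M)" by (simp add: pred_def)
  have gS: "g -` S \<inter> space M \<in> sets (completion M)"
    using measurable_sets[OF measurable_completion[OF g], of S] \<open>open S\<close> by simp
  have "f -` S \<inter> space (completion M) = (g -` S \<inter> space M - {x \<in> space M. \<not> f x = g x}) \<union> {x \<in> space M. f x \<in> S \<and> \<not> f x = g x}"
    by auto
  then show "f -` S \<inter> space (completion M) \<in> sets (completion M)"
    by (simp only: sets.Un sets.Diff gS ne ne')
qed

context random_jacobi
begin

lemma AE_b_pos: "AE \<omega> in M. \<forall>j. b j \<omega> > 0"
proof (subst AE_all_countable, rule allI)
  fix j
  have "AE u in distr M lborel (b j). u > 0"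
    unfolding distributed_distr_eq_density[OF dist_b]
    by (subst AE_density) (auto simp: chi_tilde_density_def)
  then show "AE \<omega> in M. b j \<omega> > 0"
    by (subst (asm) AE_distr_iff) auto
qed

text \<open>
  A bounded function of \<open>1 / u\<close> whose products over the entries detect divergence of
  \<open>\<Sum> 1 / b\<^sub>j\<close>.
\<close>

definition damp :: "real \<Rightarrow> real" where
  "damp u = (if u > 0 then exp (- (1 / u)) else 0)"

lemma damp_measurable [measurable]: "damp \<in> borel_measurable borel"
  unfolding damp_def[abs_def] by measurable

lemma damp_bounds: "0 \<le> damp u" "damp u < 1" "damp u \<le> 1"
  by (auto simp: damp_def)

lemma expectation_damp_prod:
  "(\<integral>\<omega>. (\<Prod>j<n. damp (b j \<omega>)) \<partial>M) = (\<integral>\<omega>. damp (b 0 \<omega>) \<partial>M) ^ n"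
proof -
  let ?I = "Inr ` {..<n} :: (nat + nat) set"
  have ind: "indep_vars (\<lambda>_. borel) (\<lambda>s \<omega>. damp (entry s \<omega>)) ?I"
    by (rule indep_vars_compose2[OF indep_vars_subset[OF indep]]) auto
  have int: "integrable M (\<lambda>\<omega>. damp (entry s \<omega>))" if "s \<in> ?I" for s
    using that by (intro integrable_const_bound[where B = 1]) (auto simp: damp_bounds abs_of_nonneg)
  have "(\<integral>\<omega>. (\<Prod>s\<in>?I. damp (entry s \<omega>)) \<partial>M) = (\<Prod>s\<in>?I. \<integral>\<omega>. damp (entry s \<omega>) \<partial>M)"
    by (rule indep_vars_lebesgue_integral[OF _ ind int]) simp_all
  then have "(\<integral>\<omega>. (\<Prod>j<n. damp (b j \<omega>)) \<partial>M) = (\<Prod>j<n. \<integral>\<omega>. damp (b j \<omega>) \<partial>M)"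
    by (simp add: prod.reindex)
  also have "\<dots> = (\<Prod>j<n. \<integral>\<omega>. damp (b 0 \<omega>) \<partial>M)"
    by (intro prod.cong refl) (simp add: expectation_b)
  finally show ?thesis by simp
qed

text \<open>
  The products of \<open>exp (- 1 / b\<^sub>j)\<close> have expectation \<open>c\<^sup>n\<close> with \<open>c < 1\<close>, so they tend to 0
  almost surely; if the series converged they would stay above \<open>exp (- \<Sum> 1 / b\<^sub>j)\<close>.
\<close>

lemma AE_not_summable: "AE \<omega> in M. \<not> summable (\<lambda>j. 1 / b j \<omega>)"
proof -
  define c where "c = (\<integral>\<omega>. damp (b 0 \<omega>) \<partial>M)"
  have int: "integrable M (\<lambda>\<omega>. damp (b 0 \<omega>))"
    by (rule integrable_const_bound[where B = 1]) (auto simp: damp_bounds abs_of_nonneg)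
  have "c < (\<integral>\<omega>. 1 \<partial>M)"
    unfolding c_def using int damp_bounds emeasure_space_1 by (intro integral_less_AE_space) auto
  then have c: "c < 1" by (simp add: prob_space)
  have c0: "c \<ge> 0" unfolding c_def using damp_bounds by (intro Bochner_Integration.integral_nonneg) auto
  define Z where "Z n \<omega> = (\<Prod>j<n. damp (b j \<omega>))" for n \<omega>
  have Z01: "0 \<le> Z n \<omega>" "Z n \<omega> \<le> 1" for n \<omega>
    unfolding Z_def by (rule prod_nonneg prod_le_1, simp add: damp_bounds)+
  have [measurable]: "Z n \<in> borel_measurable M" for n unfolding Z_def[abs_def] by measurable
  have intZ: "integrable M (Z n)" for n
    by (rule integrable_const_bound[where B = 1]) (use Z01 in auto)
  have "(\<integral>\<omega>. Z n \<omega> \<partial>M) = c ^ n" for n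
    unfolding Z_def c_def by (rule expectation_damp_prod)
  then have EZ: "(\<integral>\<^sup>+\<omega>. ennreal (Z n \<omega>) \<partial>M) = ennreal (c ^ n)" for n
    using nn_integral_eq_integral[OF intZ, of n] Z01 by simp
  define L where "L \<omega> = (INF n. ennreal (Z n \<omega>))" for \<omega>
  have [measurable]: "L \<in> borel_measurable M" unfolding L_def[abs_def] by measurable
  have "(\<integral>\<^sup>+\<omega>. L \<omega> \<partial>M) \<le> ennreal (c ^ n)" for n
    unfolding EZ[symmetric] L_def by (intro nn_integral_mono INF_lower) simp
  moreover have "(\<lambda>n. ennreal (c ^ n)) \<longlonglongrightarrow> ennreal 0"
    using c c0 by (intro tendsto_ennrealI LIMSEQ_realpow_zero)
  ultimately have "(\<integral>\<^sup>+\<omega>. L \<omega> \<partial>M) \<le> 0"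
    using LIMSEQ_le_const[of "\<lambda>n. ennreal (c ^ n)" 0 "\<integral>\<^sup>+\<omega>. L \<omega> \<partial>M"] by auto
  then have "AE \<omega> in M. L \<omega> = 0"
    by (subst nn_integral_0_iff_AE[symmetric]) auto
  with AE_b_pos show ?thesis
  proof eventually_elim
    case (elim \<omega>)
    show ?case
    proof
      assume sum: "summable (\<lambda>j. 1 / b j \<omega>)"
      define s where "s = (\<Sum>j. 1 / b j \<omega>)"
      have "exp (- s) \<le> Z n \<omega>" for n
      proof -
        have "Z n \<omega> = exp (- (\<Sum>j<n. 1 / b j \<omega>))"
          unfolding Z_def sum_negf[symmetric] using elim by (simp add: damp_def exp_sum)
        moreover have "(\<Sum>j<n. 1 / b j \<omega>) \<le> s"
          unfolding s_def using elim by (intro sum_le_suminf[OF sum]) (auto simp: less_imp_le)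
        ultimately show ?thesis by simp
      qed
      then have "ennreal (exp (- s)) \<le> L \<omega>"
        unfolding L_def by (intro INF_greatest ennreal_leI)
      then show False using elim by simp
    qed
  qed
qed

lemma AE_limit_point: "AE \<omega> in M. jacobi_limit_point (\<lambda>j. b j \<omega>)"
  using AE_b_pos AE_not_summable
  by eventually_elim (simp add: jacobi_limit_point_def jacobi_limit_point_axioms_def jacobi_coeffs_def)

abbreviation spec :: "'w \<Rightarrow> real measure" where
  "spec \<omega> \<equiv> spectral_measure (\<lambda>i. a i \<omega>) (\<lambda>i. b i \<omega>)"

abbreviation tail :: "'w \<Rightarrow> complex \<Rightarrow> nat \<Rightarrow> complex \<Rightarrow> complex" where
  "tail \<omega> \<equiv> tail_resolvent (\<lambda>i. a i \<omega>) (\<lambda>i. b i \<omega>)"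

text \<open>
  A version of the random Stieltjes transform that is measurable by construction; almost
  surely the limit does not depend on the choice of the terminal value \<open>i\<close>.
\<close>

definition m_lim :: "'w \<Rightarrow> complex \<Rightarrow> complex" where
  "m_lim \<omega> z = lim (\<lambda>n. tail \<omega> z n \<i>)"

lemma AE_spec:
  "AE \<omega> in M. real_distribution (spec \<omega>) \<and> (\<forall>z. Im z > 0 \<longrightarrow> m_lim \<omega> z = stieltjes (spec \<omega>) z) \<and>
     (\<forall>z w. Im z > 0 \<longrightarrow> Im w > 0 \<longrightarrow> (\<lambda>n. tail \<omega> z n w) \<longlonglongrightarrow> m_lim \<omega> z)"
  using AE_limit_point
proof eventually_elim
  case (elim \<omega>)
  interpret jacobi_limit_point "\<lambda>i. a i \<omega>" "\<lambda>i. b i \<omega>" by fact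
  note \<mu> = spectral_measure_moment_measure
  have m: "m_lim \<omega> z = stieltjes (spec \<omega>) z" if "Im z > 0" for z
    unfolding m_lim_def using tail_resolvent_tendsto[OF \<mu> that, of \<i>] by (intro limI) simp
  then show ?case
    using moment_measure_real_distribution[OF \<mu>] tail_resolvent_tendsto[OF \<mu>] by auto
qed

lemma m_lim_measurable [measurable]:
  assumes [measurable]: "g \<in> measurable N M" "z \<in> borel_measurable N"
  shows "(\<lambda>p. m_lim (g p) (z p)) \<in> borel_measurable N"
  unfolding m_lim_def by measurable

text \<open>
  Let the depth tend to infinity in the constant weighted expectation. The limit of the
  continued fraction does not depend on the terminal value, so the weight integrates to
  \<open>cyl \<alpha> z\<close>.
\<close>

theorem expectation_m_lim:
  assumes z: "Im z > 0" and \<nu>: "jacobi_moment_measure (\<lambda>_. 0) (hermite_b \<alpha>) \<nu>"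
  shows "(\<integral>\<omega>. m_lim \<omega> z \<partial>M) = stieltjes \<nu> z"
proof -
  interpret N: prob_space std_normal_distribution by (rule prob_space_normal)
  define C where "C = kern_bound z * (1 / Im z)"
  define F where "F n \<omega> = (\<integral>x. kern \<alpha> z x * tail \<omega> z n (z - of_real x) \<partial>std_normal_distribution)" for n \<omega>
  have [measurable]: "F n \<in> borel_measurable M" for n
    unfolding F_def[abs_def] by measurable
  have F_bound: "cmod (F n \<omega>) \<le> C" for n \<omega>
  proof -
    have "cmod (F n \<omega>) \<le> (\<integral>x. C \<partial>std_normal_distribution)"
      unfolding F_def C_def by (rule integral_norm_le_AE, simp, intro AE_I2 kern_tail_bound[OF z], simp)
    then show ?thesis using N.prob_space by simp
  qed
  have F_lim: "AE \<omega> in M. (\<lambda>n. F n \<omega>) \<longlonglongrightarrow> cyl \<alpha> z * m_lim \<omega> z"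
    using AE_spec
  proof eventually_elim
    case (elim \<omega>)
    have "(\<lambda>n. F n \<omega>) \<longlonglongrightarrow> (\<integral>x. kern \<alpha> z x * m_lim \<omega> z \<partial>std_normal_distribution)"
      unfolding F_def
    proof (rule integral_dominated_convergence[where w = "\<lambda>_. C"])
      show "AE x in std_normal_distribution. (\<lambda>n. kern \<alpha> z x * tail \<omega> z n (z - of_real x)) \<longlonglongrightarrow> kern \<alpha> z x * m_lim \<omega> z"
        using elim z by (intro AE_I2 tendsto_mult tendsto_const) auto
      show "AE x in std_normal_distribution. cmod (kern \<alpha> z x * tail \<omega> z n (z - of_real x)) \<le> C" for n
        unfolding C_def by (intro AE_I2 kern_tail_bound[OF z]) simp
    qed measurable
    then show ?case
      by (simp add: integral_kern[OF alpha z])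
  qed
  have "(\<lambda>n. \<integral>\<omega>. F n \<omega> \<partial>M) \<longlonglongrightarrow> (\<integral>\<omega>. cyl \<alpha> z * m_lim \<omega> z \<partial>M)"
    by (rule integral_dominated_convergence[where w = "\<lambda>_. C"]) (use F_lim F_bound in auto)
  moreover have "(\<integral>\<omega>. F n \<omega> \<partial>M) = - \<i> / of_real \<alpha> * cyl (\<alpha> + 1) z" for n
    using weighted_tail_eq[OF z, of n] by (simp add: weighted_tail_def F_def)
  ultimately have "cyl \<alpha> z * (\<integral>\<omega>. m_lim \<omega> z \<partial>M) = - \<i> / of_real \<alpha> * cyl (\<alpha> + 1) z"
    by (simp add: LIMSEQ_const_iff)
  also have "\<dots> = cyl \<alpha> z * stieltjes \<nu> z"
    using cyl_stieltjes[OF alpha z \<nu>] alpha by simp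
  finally show ?thesis
    using cyl_nonzero_upper[OF alpha z] by simp
qed

text \<open>
  The integral against the spectral measure is the almost sure limit of its Poisson
  approximations. Their expectations involve the expected Stieltjes transform only, and are
  the Poisson approximations for \<open>\<nu>\<close>.
\<close>

lemma mean_spectral_integral:
  fixes f :: "real \<Rightarrow> real"
  assumes \<nu>: "jacobi_moment_measure (\<lambda>_. 0) (hermite_b \<alpha>) \<nu>"
    and f: "continuous_on UNIV f" and "bounded (range f)"
  shows "integrable (completion M) (\<lambda>\<omega>. \<integral>x. f x \<partial>spec \<omega>)"
    and "(\<integral>x. f x \<partial>\<nu>) = (\<integral>\<omega>. (\<integral>x. f x \<partial>spec \<omega>) \<partial>completion M)"
proof -
  interpret herm: jacobi_limit_point "\<lambda>_. 0" "hermite_b \<alpha>" by (rule hermite_limit_point[OF alpha])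
  interpret \<nu>: real_distribution \<nu> by (rule herm.moment_measure_real_distribution[OF \<nu>])
  interpret P: pair_sigma_finite M lborel ..
  obtain B where B: "\<And>x. \<bar>f x\<bar> \<le> B"
    using \<open>bounded (range f)\<close> by (auto simp: bounded_iff)
  have B0: "B \<ge> 0" using order.trans[OF abs_ge_zero B] .
  have [measurable]: "f \<in> borel_measurable borel"
    using f by (rule borel_measurable_continuous_onI)
  define y where "y k = 1 / real (Suc k)" for k
  have y: "y k > 0" for k by (simp add: y_def)
  define h where "h k \<omega> x = f x * (- Im (m_lim \<omega> (Complex x (y k))) / pi)" for k \<omega> x
  have [measurable]: "(\<lambda>x. Complex x c) \<in> borel_measurable borel" for c
    unfolding complex_of_real_def[symmetric] Complex_eq by measurable
  have h_meas [measurable]: "case_prod (h k) \<in> borel_measurable (M \<Otimes>\<^sub>M lborel)" for k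
    unfolding h_def case_prod_beta by measurable
  define F where "F k \<omega> = (\<integral>x. h k \<omega> x \<partial>lborel)" for k \<omega>
  have F_meas [measurable]: "F k \<in> borel_measurable M" for k
    unfolding F_def[abs_def] by measurable
  have h_nn: "AE \<omega> in M. (\<integral>\<^sup>+x. ennreal (norm (h k \<omega> x)) \<partial>lborel) \<le> ennreal B" for k
    using AE_spec
  proof eventually_elim
    case (elim \<omega>)
    have "h k \<omega> x = f x * (- Im (stieltjes (spec \<omega>) (Complex x (y k))) / pi)" for x
      using elim y[of k] by (simp add: h_def)
    then show ?case
      using real_distribution.nn_integral_stieltjes_bound[of "spec \<omega>" "y k" f B] elim y[of k] B by simp
  qed
  have int_h: "integrable (M \<Otimes>\<^sub>M lborel) (case_prod (h k))" for k
  proof (rule integrableI_bounded)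
    have "(\<integral>\<^sup>+p. ennreal (norm (case_prod (h k) p)) \<partial>(M \<Otimes>\<^sub>M lborel)) = (\<integral>\<^sup>+\<omega>. \<integral>\<^sup>+x. ennreal (norm (h k \<omega> x)) \<partial>lborel \<partial>M)"
      by (subst lborel.nn_integral_fst[symmetric]) auto
    also have "\<dots> \<le> (\<integral>\<^sup>+\<omega>. ennreal B \<partial>M)"
      by (intro nn_integral_mono_AE h_nn)
    also have "\<dots> < \<infinity>" by (simp add: emeasure_space_1)
    finally show "(\<integral>\<^sup>+p. ennreal (norm (case_prod (h k) p)) \<partial>(M \<Otimes>\<^sub>M lborel)) < \<infinity>" .
  qed measurable
  have F_bound: "AE \<omega> in M. norm (F k \<omega>) \<le> B" for k
    using h_nn[of k] AE_space
  proof eventually_elim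
    case (elim \<omega>)
    have [measurable]: "h k \<omega> \<in> borel_measurable lborel"
      using measurable_compose_Pair1[OF elim(2) h_meas[of k]] by simp
    have "integrable lborel (h k \<omega>)"
      using elim(1) by (intro integrableI_bounded) (auto simp: top_unique less_top[symmetric])
    from integral_norm_bound_ennreal[OF this] elim(1) have "ennreal (norm (F k \<omega>)) \<le> ennreal B"
      unfolding F_def by (rule order.trans)
    then show ?case using B0 by (subst (asm) ennreal_le_iff)
  qed
  have F_lim: "AE \<omega> in M. (\<lambda>k. F k \<omega>) \<longlonglongrightarrow> (\<integral>x. f x \<partial>spec \<omega>)"
    using AE_spec
  proof eventually_elim
    case (elim \<omega>)
    have "F k \<omega> = (\<integral>x. f x * (- Im (stieltjes (spec \<omega>) (Complex x (1 / real (Suc k)))) / pi) \<partial>lborel)" for k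
      using elim by (simp add: F_def h_def y_def)
    then show ?case
      using real_distribution.poisson_integral_approximates[of "spec \<omega>" f B] elim f B by simp
  qed
  have EF: "(\<integral>\<omega>. F k \<omega> \<partial>M) = (\<integral>x. f x * (- Im (stieltjes \<nu> (Complex x (y k))) / pi) \<partial>lborel)" for k
  proof -
    have "(\<integral>\<omega>. F k \<omega> \<partial>M) = (\<integral>x. (\<integral>\<omega>. h k \<omega> x \<partial>M) \<partial>lborel)"
      unfolding F_def by (rule P.Fubini_integral[OF int_h, symmetric])
    also have "\<dots> = (\<integral>x. f x * (- Im (stieltjes \<nu> (Complex x (y k))) / pi) \<partial>lborel)"
    proof (rule Bochner_Integration.integral_cong[OF refl])
      fix x
      have bd: "AE \<omega> in M. cmod (m_lim \<omega> (Complex x (y k))) \<le> 1 / y k"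
        using AE_spec
      proof eventually_elim
        case (elim \<omega>)
        then show ?case
          using real_distribution.norm_stieltjes_le[of "spec \<omega>" "Complex x (y k)"] y[of k] by simp
      qed
      have int_m: "integrable M (\<lambda>\<omega>. m_lim \<omega> (Complex x (y k)))"
        by (rule integrable_const_bound[OF bd]) measurable
      have "(\<integral>\<omega>. h k \<omega> x \<partial>M) = f x * (- (\<integral>\<omega>. Im (m_lim \<omega> (Complex x (y k))) \<partial>M) / pi)"
        unfolding h_def by simp
      also have "(\<integral>\<omega>. Im (m_lim \<omega> (Complex x (y k))) \<partial>M) = Im (\<integral>\<omega>. m_lim \<omega> (Complex x (y k)) \<partial>M)"
        by (rule integral_Im[OF int_m])
      also have "(\<integral>\<omega>. m_lim \<omega> (Complex x (y k)) \<partial>M) = stieltjes \<nu> (Complex x (y k))"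
        by (rule expectation_m_lim[OF _ \<nu>]) (simp add: y)
      finally show "(\<integral>\<omega>. h k \<omega> x \<partial>M) = f x * (- Im (stieltjes \<nu> (Complex x (y k))) / pi)" .
    qed
    finally show ?thesis .
  qed
  \<comment> \<open>an \<open>M\<close>-measurable version of the integral against the spectral measure, which is itself
     controlled only up to a null set\<close>
  define G where "G \<omega> = lim (\<lambda>k. F k \<omega>)" for \<omega>
  have [measurable]: "G \<in> borel_measurable M" unfolding G_def[abs_def] by measurable
  have G_eq: "AE \<omega> in M. (\<integral>x. f x \<partial>spec \<omega>) = G \<omega>"
    using F_lim by eventually_elim (simp add: G_def limI)
  have F_lim_G: "AE \<omega> in M. (\<lambda>k. F k \<omega>) \<longlonglongrightarrow> G \<omega>"
    using F_lim G_eq by eventually_elim simp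
  have dom: "integrable M (\<lambda>_. B)" by simp
  have int_G: "integrable M G"
    by (rule integrable_dominated_convergence[OF _ _ dom F_lim_G F_bound]) measurable
  have "(\<lambda>k. \<integral>\<omega>. F k \<omega> \<partial>M) \<longlonglongrightarrow> (\<integral>\<omega>. G \<omega> \<partial>M)"
    by (rule integral_dominated_convergence[OF _ _ dom F_lim_G F_bound]) measurable
  moreover have "(\<lambda>k. \<integral>\<omega>. F k \<omega> \<partial>M) \<longlonglongrightarrow> (\<integral>x. f x \<partial>\<nu>)"
    unfolding EF y_def by (rule \<nu>.poisson_integral_approximates[OF f B])
  ultimately have EG: "(\<integral>\<omega>. G \<omega> \<partial>M) = (\<integral>x. f x \<partial>\<nu>)"
    by (rule LIMSEQ_unique)
  have meas: "(\<lambda>\<omega>. \<integral>x. f x \<partial>spec \<omega>) \<in> borel_measurable (completion M)"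
    by (rule measurable_completion_AE_eq[OF _ G_eq]) measurable
  have G_meas: "G \<in> borel_measurable (completion M)" by (rule measurable_completion) measurable
  have "integrable (completion M) G"
    using int_G by (subst integrable_completion) auto
  moreover have "AE \<omega> in completion M. G \<omega> = (\<integral>x. f x \<partial>spec \<omega>)"
    using AE_completion[OF G_eq] by eventually_elim (rule sym)
  ultimately show "integrable (completion M) (\<lambda>\<omega>. \<integral>x. f x \<partial>spec \<omega>)"
    by (rule integrable_cong_AE_imp[OF _ meas])
  have "(\<integral>\<omega>. (\<integral>x. f x \<partial>spec \<omega>) \<partial>completion M) = (\<integral>\<omega>. G \<omega> \<partial>completion M)"
    by (rule integral_cong_AE[OF meas G_meas AE_completion[OF G_eq]])
  also have "\<dots> = (\<integral>\<omega>. G \<omega> \<partial>M)"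
    by (rule integral_completion) measurable
  finally show "(\<integral>x. f x \<partial>\<nu>) = (\<integral>\<omega>. (\<integral>x. f x \<partial>spec \<omega>) \<partial>completion M)"
    using EG by simp
qed

lemma mean_spectral_measure_eq:
  assumes \<nu>: "jacobi_moment_measure (\<lambda>_. 0) (hermite_b \<alpha>) \<nu>"
  shows "mean_spectral_measure M a b = \<nu>"
  unfolding mean_spectral_measure_def
proof (rule the_equality)
  interpret herm: jacobi_limit_point "\<lambda>_. 0" "hermite_b \<alpha>" by (rule hermite_limit_point[OF alpha])
  interpret \<nu>: real_distribution \<nu> by (rule herm.moment_measure_real_distribution[OF \<nu>])
  show "is_mean_spectral_measure M a b \<nu>"
    unfolding is_mean_spectral_measure_def
    using mean_spectral_integral[OF \<nu>] \<nu>.prob_space_axioms by simp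
  fix \<nu>' assume \<nu>': "is_mean_spectral_measure M a b \<nu>'"
  show "\<nu>' = \<nu>"
  proof (rule real_distribution_eqI)
    show "real_distribution \<nu>'"
      using \<nu>' by (simp add: is_mean_spectral_measure_def real_distribution_def real_distribution_axioms_def)
    fix f :: "real \<Rightarrow> real" assume f: "continuous_on UNIV f" "bounded (range f)"
    then show "(\<integral>x. f x \<partial>\<nu>') = (\<integral>x. f x \<partial>\<nu>)"
      using \<nu>' mean_spectral_integral(2)[OF \<nu> f] by (simp add: is_mean_spectral_measure_def)
  qed (rule \<nu>.real_distribution_axioms)
qed

end

section \<open>The density in terms of the half-line Fourier transform\<close>

lemma f_hat_eq_cyl:
  assumes \<alpha>: "\<alpha> > 0"
  shows "f_hat \<alpha> y = of_real (sqrt (\<alpha> / Gamma \<alpha>)) * cyl \<alpha> (of_real y)"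
proof -
  define c where "c = pi * sqrt (\<alpha> / Gamma \<alpha>) / sqrt (2 * pi)"
  have "indicator {0<..} t *\<^sub>R (complex_of_real (f_alpha \<alpha> t) * exp (\<i> * of_real y * of_real t)) =
      of_real c * (of_real (weight 1 \<alpha> t) * exp (- (- (\<i> * of_real y)) * of_real t))" for t
    by (simp add: indicator_def f_alpha_def weight_def c_def)
  then have "(LINT t:{0<..}|lborel. complex_of_real (f_alpha \<alpha> t) * exp (\<i> * of_real y * of_real t)) = of_real c * cyl \<alpha> (of_real y)"
    unfolding set_lebesgue_integral_def cyl_def weight_laplace_def by (simp only: integral_mult_right_zero)
  moreover have "sqrt (2 / pi) * c = sqrt (\<alpha> / Gamma \<alpha>)"
  proof -
    have "sqrt (2 / pi) * pi = sqrt (2 * pi)"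
    proof (rule power2_eq_imp_eq)
      show "(sqrt (2 / pi) * pi)\<^sup>2 = (sqrt (2 * pi))\<^sup>2" by (simp add: power_mult_distrib) (simp add: power2_eq_square)
    qed auto
    then show ?thesis by (simp add: c_def mult.assoc[symmetric])
  qed
  ultimately show ?thesis
    unfolding f_hat_def by (simp only: mult.assoc[symmetric] of_real_mult[symmetric])
qed

lemma hermite_density_eq_f_hat:
  assumes \<alpha>: "\<alpha> > 0"
  shows "exp (- (y\<^sup>2 / 2)) / sqrt (2 * pi) * (1 / (cmod (f_hat \<alpha> y))\<^sup>2) = hermite_density \<alpha> y"
proof -
  have "(cmod (f_hat \<alpha> y))\<^sup>2 = \<alpha> / Gamma \<alpha> * (cmod (cyl \<alpha> (of_real y)))\<^sup>2"
    using \<alpha> Gamma_real_pos[OF \<alpha>] by (simp add: f_hat_eq_cyl norm_mult power_mult_distrib)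
  then show ?thesis by (simp add: hermite_density_def mult_ac)
qed

theorem theorem1:
  fixes \<alpha> :: real
    and M :: "'w measure"
    and a b :: "nat \<Rightarrow> 'w \<Rightarrow> real"
  assumes "\<alpha> > 0"
    and "prob_space M"
    and "\<And>i. distributed M lborel (a i) (\<lambda>x. ennreal (std_normal_density x))"
    and "\<And>j. distributed M lborel (b j) (\<lambda>u. ennreal (chi_tilde_density (2 * \<alpha>) u))"
    and "prob_space.indep_vars M (\<lambda>_. borel)
           (\<lambda>s. case s of Inl i \<Rightarrow> a i | Inr j \<Rightarrow> b j) (UNIV :: (nat + nat) set)"
  shows "is_spectral_measure (\<lambda>_. 0) (\<lambda>j. sqrt (\<alpha> + real (Suc j))) (mean_spectral_measure M a b) \<and>
         mean_spectral_measure M a b =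
           density lborel (\<lambda>y. ennreal (exp (- (y\<^sup>2 / 2)) / sqrt (2 * pi) * (1 / (cmod (f_hat \<alpha> y))\<^sup>2)))"
proof -
  interpret random_jacobi M \<alpha> a b
    using assms by (simp add: random_jacobi_def random_jacobi_axioms_def)
  interpret herm: jacobi_limit_point "\<lambda>_. 0" "hermite_b \<alpha>"
    by (rule hermite_limit_point[OF \<open>\<alpha> > 0\<close>])
  obtain \<nu> where \<nu>: "jacobi_moment_measure (\<lambda>_. 0) (hermite_b \<alpha>) \<nu>"
    using herm.jacobi_moment_measure_exists by blast
  have mean: "mean_spectral_measure M a b = \<nu>"
    by (rule mean_spectral_measure_eq[OF \<nu>])
  have "is_spectral_measure (\<lambda>_. 0) (hermite_b \<alpha>) \<nu>"
    unfolding herm.is_spectral_measure_iff by (rule \<nu>)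
  moreover have "hermite_b \<alpha> = (\<lambda>j. sqrt (\<alpha> + real (Suc j)))"
    by (simp add: fun_eq_iff hermite_b_def)
  moreover have "\<nu> = density lborel (\<lambda>y. ennreal (hermite_density \<alpha> y))"
    by (rule hermite_moment_measure_density[OF \<open>\<alpha> > 0\<close> \<nu>])
  ultimately show ?thesis
    unfolding mean hermite_density_eq_f_hat[OF \<open>\<alpha> > 0\<close>] by simp
qed

end
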